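(* Let $q\in(-1,1)$ and $n\geq 1$ satisfy $q^2n<1$, let $C\in M_n(\mathbb{R})$ be symmetric positive definite, and let $X=(x(e_1),\dots,x(e_n))$ be the tuple of $q$-semicircular operators associated with vectors $e_1,\dots,e_n\in\mathcal{H}_{\mathbb{R}}=\mathbb{R}^n$ satisfying $\langle e_i,e_j\rangle=C_{i,j}$. Then $$A=\Xi_q\otimes I_n$$ is a free Stein kernel for $X$ with respect to the potential $V_C$.
   Context: $\mathcal{H}_{\mathbb{R}}=\mathbb{R}^n$ with complexification $\mathcal{H}_{\mathbb{C}}$. The $q$-Fock space $\mathcal{F}_q(\mathcal{H}_{\mathbb{C}})$ is the completion of $\mathbb{C}\Omega\oplus\bigoplus_{k\ge1}\mathcal{H}_{\mathbb{C}}^{\otimes k}$ for $\langle g_1\otimes\cdots\otimes g_k,h_1\otimes\cdots\otimes h_m\rangle_q=\delta_{k,m}\sum_{\sigma\in S_k}q^{inv(\sigma)}\langle g_1,h_{\sigma(1)}\rangle\cdots\langle g_k,h_{\sigma(k)}\rangle$, where $inv(\sigma)$ is the number of inversions. $l(h)$ is the left creation operator $g_1\otimes\cdots\otimes g_k\mapsto h\otimes g_1\otimes\cdots\otimes g_k$, $l^*(h)$ its adjoint, and $x(h)=l(h)+l^*(h)$ for $h\in\mathcal{H}_{\mathbb{R}}$. $\Gamma_q(\mathcal{H}_{\mathbb{R}})$ is the von Neumann algebra generated by $\{x(h):h\in\mathcal{H}_{\mathbb{R}}\}$ with tracial state $\tau(Y)=\langle Y\Omega,\Omega\rangle$. $\Xi_q=\sum_{N\ge0}q^NP_N$,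 where $P_N$ is the orthogonal projection of $\mathcal{F}_q(\mathcal{H}_{\mathbb{C}})$ on tensors of rank $N$. When $q^2n<1$, $\Xi_q$ is Hilbert–Schmidt, and it is viewed as an element of $L^2(W^*(X)\bar\otimes W^*(X)^{op},\tau\otimes\tau^{op})$ through the identification with Hilbert–Schmidt operators $a\otimes b^{op}\mapsto\langle\cdot,b^*\Omega\rangle a\Omega$ (inner product linear in the slot denoted by the dot). Here $\Xi_q\otimes I_n$ is the diagonal $n\times n$ matrix with all diagonal entries $\Xi_q$. On $\mathbb{C}\langle t_1,\dots,t_n\rangle$: $\partial_jm=\sum_{m=at_jb}a\otimes b^{op}$, $D_jm=\sum_{m=at_jb}ba$ on monomials; $\mathcal{J}P=(\partial_jp_i)_{i,j}$. $V_C=\frac12\sum_{i,j}(C^{-1})_{i,j}t_it_j$, so $[DV_C](X)=C^{-1}X$. With $\mathcal{M}=W^*(X)$, a free Stein kernel of $X$ with respect to $V$ is an $A\in L^2(M_n(\mathcal{M}\bar\otimes\mathcal{M}^{op}),(\tau\otimes\tau^{op})\circ Tr)$ with $\langle[DV](X),P(X)\rangle_2=\langle A,[\mathcal{J}P](X)\rangle_{HS}$ for all $P\in\mathbb{C}\langle t_1,\dots,t_n\rangle^n$, where $\langle X,Y\rangle_2=\sum_i\tau(X_i^*Y_i)$ and $\langle A,B\rangle_{HS}=\sum_{i,j}\langle A_{i,j},B_{i,j}\rangle_{\tau\otimes\tau^{op}}$. *)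

theory Defs
  imports
    "HOL-Analysis.Analysis"
    "HOL-Library.Function_Algebras"
    "HOL-Library.Poly_Mapping"
    "HOL-Combinatorics.Permutations"
begin

section \<open>Hilbert spaces and von Neumann algebras\<close>

text \<open>Complex vector spaces, with the pointwise operations on functions. Both the vectors of the
  Fock space and the operators on it are functions, hence vectors in this sense.\<close>

class complex_vec = ab_group_add +
  fixes scaleC :: "complex \<Rightarrow> 'a \<Rightarrow> 'a" (infixr "*\<^sub>C" 75)
  assumes scaleC_add_right: "c *\<^sub>C (x + y) = c *\<^sub>C x + c *\<^sub>C y"
    and scaleC_add_left: "(c + d) *\<^sub>C x = c *\<^sub>C x + d *\<^sub>C x"
    and scaleC_scaleC: "c *\<^sub>C (d *\<^sub>C x) = (c * d) *\<^sub>C x"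
    and scaleC_one: "1 *\<^sub>C x = x"

instantiation complex :: complex_vec
begin
definition scaleC_complex :: "complex \<Rightarrow> complex \<Rightarrow> complex" where
  "scaleC_complex c x = c * x"
instance by standard (simp_all add: scaleC_complex_def algebra_simps)
end

instantiation "fun" :: (type, complex_vec) complex_vec
begin
definition scaleC_fun :: "complex \<Rightarrow> ('a \<Rightarrow> 'b) \<Rightarrow> 'a \<Rightarrow> 'b" where
  "scaleC_fun c f = (\<lambda>x. c *\<^sub>C f x)"
instance
  by standard (simp_all add: scaleC_fun_def fun_eq_iff scaleC_add_right scaleC_add_left
      scaleC_scaleC scaleC_one)
end

text \<open>A Hilbert space is given by its set of vectors and its inner product, which is linear in the
  first argument and conjugate linear in the second.\<close>

record 'v hilbert =
  vecs :: "'v set"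
  ip :: "'v \<Rightarrow> 'v \<Rightarrow> complex"

definition hnorm :: "'v hilbert \<Rightarrow> 'v \<Rightarrow> real" where
  "hnorm H v = sqrt (Re (ip H v v))"

text \<open>Operators are total functions that vanish outside the space, so that two operators are equal
  as functions iff they agree on the space.\<close>

definition bounded_ops :: "('v::complex_vec) hilbert \<Rightarrow> ('v \<Rightarrow> 'v) set" where
  "bounded_ops H = {T.
     (\<forall>v\<in>vecs H. T v \<in> vecs H) \<and>
     (\<forall>v. v \<notin> vecs H \<longrightarrow> T v = 0) \<and>
     (\<forall>u\<in>vecs H. \<forall>v\<in>vecs H. T (u + v) = T u + T v) \<and>
     (\<forall>c. \<forall>v\<in>vecs H. T (c *\<^sub>C v) = c *\<^sub>C T v) \<and>
     (\<exists>K. \<forall>v\<in>vecs H. hnorm H (T v) \<le> K * hnorm H v)}"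

definition id_op :: "('v::complex_vec) hilbert \<Rightarrow> 'v \<Rightarrow> 'v" where
  "id_op H = (\<lambda>v. if v \<in> vecs H then v else 0)"

definition adjoint_op :: "('v::complex_vec) hilbert \<Rightarrow> ('v \<Rightarrow> 'v) \<Rightarrow> 'v \<Rightarrow> 'v" where
  "adjoint_op H T = (THE S. S \<in> bounded_ops H \<and>
     (\<forall>u\<in>vecs H. \<forall>v\<in>vecs H. ip H (T u) v = ip H u (S v)))"

definition orth_proj :: "('v::complex_vec) hilbert \<Rightarrow> 'v set \<Rightarrow> 'v \<Rightarrow> 'v" where
  "orth_proj H S = (\<lambda>v. if v \<in> vecs H
     then (THE u. u \<in> S \<inter> vecs H \<and> (\<forall>s\<in>S \<inter> vecs H. ip H (v - u) s = 0))
     else 0)"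

definition commutant :: "('v::complex_vec) hilbert \<Rightarrow> ('v \<Rightarrow> 'v) set \<Rightarrow> ('v \<Rightarrow> 'v) set" where
  "commutant H S = {T \<in> bounded_ops H. \<forall>A\<in>S. T \<circ> A = A \<circ> T}"

definition von_neumann_algebra :: "('v::complex_vec) hilbert \<Rightarrow> ('v \<Rightarrow> 'v) set \<Rightarrow> bool" where
  "von_neumann_algebra H M \<longleftrightarrow>
     M \<subseteq> bounded_ops H \<and> (\<forall>T\<in>M. adjoint_op H T \<in> M) \<and> commutant H (commutant H M) = M"

definition vN_generated :: "('v::complex_vec) hilbert \<Rightarrow> ('v \<Rightarrow> 'v) set \<Rightarrow> ('v \<Rightarrow> 'v) set" where
  "vN_generated H S = \<Inter>{M. von_neumann_algebra H M \<and> S \<subseteq> M}"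

text \<open>For a von Neumann algebra \<open>N\<close> on \<open>H\<close> and a vector \<open>\<xi>\<close>, the map \<open>Y \<mapsto> Y \<xi>\<close> identifies
  \<open>L\<^sup>2(N, \<phi>)\<close>, where \<open>\<phi> = \<langle>\<cdot> \<xi>, \<xi>\<rangle>\<close>, with the closure of \<open>N \<xi>\<close> in \<open>H\<close>.\<close>

definition L2_space :: "('v::complex_vec) hilbert \<Rightarrow> ('v \<Rightarrow> 'v) set \<Rightarrow> 'v \<Rightarrow> 'v set" where
  "L2_space H N \<xi> = {v \<in> vecs H. \<forall>\<epsilon>>0. \<exists>Y\<in>N. hnorm H (v - Y \<xi>) < \<epsilon>}"

subsection \<open>Hilbert--Schmidt operators\<close>

definition is_onb :: "('v::complex_vec) hilbert \<Rightarrow> 'v set \<Rightarrow> bool" where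
  "is_onb H E \<longleftrightarrow>
     E \<subseteq> vecs H \<and>
     (\<forall>u\<in>E. \<forall>v\<in>E. ip H u v = (if u = v then 1 else 0)) \<and>
     (\<forall>v\<in>vecs H. (\<forall>u\<in>E. ip H v u = 0) \<longrightarrow> v = 0)"

text \<open>Any orthonormal basis may be used here: neither the Hilbert--Schmidt operators nor their inner
  product depend on the choice.\<close>

definition some_onb :: "('v::complex_vec) hilbert \<Rightarrow> 'v set" where
  "some_onb H = (SOME E. is_onb H E)"

definition hilbert_schmidt :: "('v::complex_vec) hilbert \<Rightarrow> ('v \<Rightarrow> 'v) \<Rightarrow> bool" where
  "hilbert_schmidt H T \<longleftrightarrow>
     T \<in> bounded_ops H \<and> (\<lambda>u. (hnorm H (T u))\<^sup>2) summable_on some_onb H"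

text \<open>The inner product is \<open>\<langle>A, B\<rangle> = Tr (B\<^sup>* A)\<close>.\<close>

definition HS :: "('v::complex_vec) hilbert \<Rightarrow> ('v \<Rightarrow> 'v) hilbert" where
  "HS H = \<lparr>vecs = Collect (hilbert_schmidt H),
           ip = (\<lambda>A B. \<Sum>\<^sub>\<infinity>u\<in>some_onb H. ip H (A u) (B u))\<rparr>"

section \<open>The \<open>q\<close>-Fock space over \<open>\<complex>\<^sup>n\<close>\<close>

text \<open>An element of the algebraic Fock space, and of its completion, is given by its coefficients
  with respect to the words in the standard basis; words of length \<open>k\<close> index the standard basis
  of the \<open>k\<close>-fold tensor power of \<open>\<complex>\<^sup>n\<close>.\<close>

type_synonym 'n fock_vec = "'n list \<Rightarrow> complex"
type_synonym 'n fock_op = "'n fock_vec \<Rightarrow> 'n fock_vec"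

definition cip :: "complex^'n::finite \<Rightarrow> complex^'n \<Rightarrow> complex" where
  "cip g h = (\<Sum>i\<in>UNIV. g $ i * cnj (h $ i))"

definition tensor :: "(complex^'n::finite) list \<Rightarrow> 'n fock_vec" where
  "tensor gs = (\<lambda>w. if length w = length gs then \<Prod>i<length gs. gs ! i $ (w ! i) else 0)"

definition inversions :: "nat \<Rightarrow> (nat \<Rightarrow> nat) \<Rightarrow> nat" where
  "inversions k \<sigma> = card {(i, j). i < j \<and> j < k \<and> \<sigma> j < \<sigma> i}"

text \<open>The sesquilinear extension of the form on elementary tensors of rank \<open>k\<close>; see
  \<open>ip_tensor\<close> below.\<close>

definition level_ip :: "real \<Rightarrow> nat \<Rightarrow> 'n::finite fock_vec \<Rightarrow> 'n fock_vec \<Rightarrow> complex" where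
  "level_ip q k f g = (\<Sum>\<sigma> | \<sigma> permutes {..<k}. of_real (q ^ inversions k \<sigma>) *
     (\<Sum>w | length w = k. f (map (\<lambda>i. w ! \<sigma> i) [0..<k]) * cnj (g w)))"

text \<open>Tensors of different rank are orthogonal and each tensor power is finite dimensional, so the
  completion is the Hilbert space direct sum of the tensor powers.\<close>

definition fock :: "real \<Rightarrow> 'n::finite fock_vec hilbert" where
  "fock q = \<lparr>vecs = {f. summable (\<lambda>k. Re (level_ip q k f f))},
             ip = (\<lambda>f g. suminf (\<lambda>k. level_ip q k f g))\<rparr>"

definition vacuum :: "'n::finite fock_vec" where
  "vacuum = tensor []"

text \<open>The coordinate form of \<open>g\<^sub>1 \<otimes> \<dots> \<otimes> g\<^sub>k \<mapsto> h \<otimes> g\<^sub>1 \<otimes> \<dots> \<otimes> g\<^sub>k\<close>; see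
  \<open>creation_tensor\<close> below.\<close>

definition creation :: "real \<Rightarrow> complex^'n::finite \<Rightarrow> 'n fock_op" where
  "creation q h = (\<lambda>f. if f \<in> vecs (fock q)
     then (\<lambda>w. case w of [] \<Rightarrow> 0 | i # v \<Rightarrow> h $ i * f v) else 0)"

definition complexify :: "real^'n::finite \<Rightarrow> complex^'n" where
  "complexify h = (\<chi> i. complex_of_real (h $ i))"

definition q_semicircular :: "real \<Rightarrow> real^'n::finite \<Rightarrow> 'n fock_op" where
  "q_semicircular q h =
     creation q (complexify h) + adjoint_op (fock q) (creation q (complexify h))"

definition tau :: "real \<Rightarrow> 'n::finite fock_op \<Rightarrow> complex" where
  "tau q Y = ip (fock q) (Y vacuum) vacuum"

definition rank_tensors :: "nat \<Rightarrow> 'n::finite fock_vec set" where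
  "rank_tensors N = {f. \<forall>w. f w \<noteq> 0 \<longrightarrow> length w = N}"

text \<open>For each word only one term of the series is nonzero, so the sum over \<open>N\<close> may be taken
  coefficientwise.\<close>

definition Xi :: "real \<Rightarrow> 'n::finite fock_op" where
  "Xi q = (\<lambda>f w. suminf (\<lambda>N. of_real (q ^ N) * orth_proj (fock q) (rank_tensors N) f w))"

subsection \<open>The coordinate formulas on elementary tensors\<close>

lemma finite_words: "finite {w :: 'n::finite list. length w = k}"
  using finite_lists_length_eq[of "UNIV :: 'n set" k] by simp

lemma prod_sum_words:
  fixes F :: "nat \<Rightarrow> 'n::finite \<Rightarrow> complex"
  shows "(\<Prod>i<k. \<Sum>a\<in>UNIV. F i a) = (\<Sum>w | length w = k. \<Prod>i<k. F i (w ! i))"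
proof (induction k arbitrary: F)
  case 0
  have "{w :: 'n list. length w = 0} = {[]}" by auto
  then show ?case by simp
next
  case (Suc k)
  have words: "{w :: 'n list. length w = Suc k} = (\<lambda>(a, v). a # v) ` (UNIV \<times> {v. length v = k})"
    by (auto simp: length_Suc_conv image_iff)
  have inj: "inj_on (\<lambda>(a, v). a # v) (UNIV \<times> {v :: 'n list. length v = k})"
    by (auto simp: inj_on_def)
  have "(\<Prod>i<Suc k. \<Sum>a\<in>UNIV. F i a)
      = (\<Sum>a\<in>UNIV. F 0 a) * (\<Sum>v | length v = k. \<Prod>i<k. F (Suc i) (v ! i))"
    using Suc.IH[of "\<lambda>i. F (Suc i)"] by (simp add: prod.lessThan_Suc_shift del: prod.lessThan_Suc)
  also have "\<dots> = (\<Sum>(a, v)\<in>UNIV \<times> {v. length v = k}. F 0 a * (\<Prod>i<k. F (Suc i) (v ! i)))"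
    by (simp add: sum_product sum.cartesian_product)
  also have "\<dots> = (\<Sum>w | length w = Suc k. \<Prod>i<Suc k. F i (w ! i))"
    unfolding words sum.reindex[OF inj]
    by (intro sum.cong) (auto simp: prod.lessThan_Suc_shift simp del: prod.lessThan_Suc)
  finally show ?case .
qed

lemma level_ip_tensor:
  assumes "length gs = k" "length hs = k"
  shows "level_ip q k (tensor gs) (tensor hs) =
    (\<Sum>\<sigma> | \<sigma> permutes {..<k}. of_real (q ^ inversions k \<sigma>) * (\<Prod>i<k. cip (gs ! i) (hs ! \<sigma> i)))"
  unfolding level_ip_def
proof (intro sum.cong refl arg_cong2[where f = "(*)"])
  fix \<sigma> assume "\<sigma> \<in> {\<sigma>. \<sigma> permutes {..<k}}"
  then have \<sigma>: "\<sigma> permutes {..<k}" by simp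
  then have \<sigma>': "inv \<sigma> permutes {..<k}" by (rule permutes_inv)
  have lt: "\<sigma> i < k \<longleftrightarrow> i < k" "inv \<sigma> i < k \<longleftrightarrow> i < k" for i
    using permutes_in_image[OF \<sigma>, of i] permutes_in_image[OF \<sigma>', of i] by auto
  let ?W = "{w :: 'a list. length w = k}"
  let ?p = "\<lambda>w :: 'a list. map (\<lambda>i. w ! \<sigma> i) [0..<k]"
  let ?p' = "\<lambda>w :: 'a list. map (\<lambda>i. w ! inv \<sigma> i) [0..<k]"
  have "(\<Sum>w\<in>?W. tensor gs (?p w) * cnj (tensor hs w))
      = (\<Sum>w\<in>?W. \<Prod>i<k. gs ! i $ (?p w ! i) * cnj (hs ! \<sigma> i $ (?p w ! i)))"
  proof (intro sum.cong refl)
    fix w :: "'a list" assume w: "w \<in> ?W"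
    have "(\<Prod>i<k. cnj (hs ! i $ (w ! i))) = (\<Prod>i<k. cnj (hs ! \<sigma> i $ (w ! \<sigma> i)))"
      using prod.permute[OF \<sigma>, of "\<lambda>i. cnj (hs ! i $ (w ! i))"] by (simp add: o_def)
    with w assms show "tensor gs (?p w) * cnj (tensor hs w)
        = (\<Prod>i<k. gs ! i $ (?p w ! i) * cnj (hs ! \<sigma> i $ (?p w ! i)))"
      by (simp add: tensor_def prod.distrib)
  qed
  also have "\<dots> = (\<Sum>u\<in>?W. \<Prod>i<k. gs ! i $ (u ! i) * cnj (hs ! \<sigma> i $ (u ! i)))"
  proof (rule sum.reindex_bij_witness[where i = ?p' and j = ?p])
    fix w assume "w \<in> ?W"
    then have w: "length w = k" by simp
    show "?p' (?p w) = w"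
      by (rule nth_equalityI) (simp_all add: w lt permutes_inverses[OF \<sigma>])
    show "?p (?p' w) = w"
      by (rule nth_equalityI) (simp_all add: w lt permutes_inverses[OF \<sigma>])
  qed simp_all
  also have "\<dots> = (\<Prod>i<k. cip (gs ! i) (hs ! \<sigma> i))"
    unfolding cip_def by (rule prod_sum_words[symmetric])
  finally show "(\<Sum>w\<in>?W. tensor gs (?p w) * cnj (tensor hs w))
      = (\<Prod>i<k. cip (gs ! i) (hs ! \<sigma> i))" .
qed

lemma level_ip_tensor_neq:
  assumes "length gs \<noteq> k \<or> length hs \<noteq> k"
  shows "level_ip q k (tensor gs) (tensor hs) = 0"
proof -
  have "(\<Sum>w | length w = k. tensor gs (map (\<lambda>i. w ! \<sigma> i) [0..<k]) * cnj (tensor hs w)) = 0"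
    for \<sigma> :: "nat \<Rightarrow> nat"
    using assms by (intro sum.neutral) (auto simp: tensor_def)
  then show ?thesis by (simp add: level_ip_def)
qed

lemma tensor_in_fock: "tensor gs \<in> vecs (fock q)"
proof -
  have "summable (\<lambda>k. Re (level_ip q k (tensor gs) (tensor gs)))"
    by (rule summable_finite[of "{length gs}"]) (auto simp: level_ip_tensor_neq)
  then show ?thesis by (simp add: fock_def)
qed

lemma ip_tensor:
  "ip (fock q) (tensor gs) (tensor hs) =
    (if length gs = length hs
     then \<Sum>\<sigma> | \<sigma> permutes {..<length gs}. of_real (q ^ inversions (length gs) \<sigma>) *
            (\<Prod>i<length gs. cip (gs ! i) (hs ! \<sigma> i))
     else 0)"
proof -
  have "ip (fock q) (tensor gs) (tensor hs) = suminf (\<lambda>k. level_ip q k (tensor gs) (tensor hs))"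
    by (simp add: fock_def)
  also have "\<dots> = (\<Sum>k\<in>{length gs}. level_ip q k (tensor gs) (tensor hs))"
    by (rule suminf_finite) (auto simp: level_ip_tensor_neq)
  also have "\<dots> = (if length gs = length hs
     then \<Sum>\<sigma> | \<sigma> permutes {..<length gs}. of_real (q ^ inversions (length gs) \<sigma>) *
            (\<Prod>i<length gs. cip (gs ! i) (hs ! \<sigma> i))
     else 0)"
    by (auto simp: level_ip_tensor level_ip_tensor_neq)
  finally show ?thesis .
qed

lemma creation_tensor: "creation q h (tensor gs) = tensor (h # gs)"
proof
  fix w
  have "creation q h (tensor gs) w = (case w of [] \<Rightarrow> 0 | i # v \<Rightarrow> h $ i * tensor gs v)"
    by (simp add: creation_def tensor_in_fock)
  also have "\<dots> = tensor (h # gs) w"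
    by (cases w) (simp_all add: tensor_def prod.lessThan_Suc_shift del: prod.lessThan_Suc)
  finally show "creation q h (tensor gs) w = tensor (h # gs) w" .
qed

section \<open>Noncommutative polynomials\<close>

text \<open>The word \<open>[i\<^sub>1, \<dots>, i\<^sub>k]\<close> is the monomial \<open>t\<^sub>i\<^sub>1 \<cdots> t\<^sub>i\<^sub>k\<close>, and the pair \<open>(a, b)\<close> of words is the
  basis element \<open>a \<otimes> b\<^sup>o\<^sup>p\<close> of the tensor product of the free algebra with its opposite.\<close>

type_synonym 'n ncpoly = "'n list \<Rightarrow>\<^sub>0 complex"
type_synonym 'n nc2poly = "('n list \<times> 'n list) \<Rightarrow>\<^sub>0 complex"

definition free_diff :: "'n \<Rightarrow> 'n ncpoly \<Rightarrow> 'n nc2poly" where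
  "free_diff j p = (\<Sum>w\<in>Poly_Mapping.keys p. \<Sum>k | k < length w \<and> w ! k = j.
     Poly_Mapping.single (take k w, drop (Suc k) w) (Poly_Mapping.lookup p w))"

definition cyclic_diff :: "'n \<Rightarrow> 'n ncpoly \<Rightarrow> 'n ncpoly" where
  "cyclic_diff j p = (\<Sum>w\<in>Poly_Mapping.keys p. \<Sum>k | k < length w \<and> w ! k = j.
     Poly_Mapping.single (drop (Suc k) w @ take k w) (Poly_Mapping.lookup p w))"

definition jacobian :: "('n \<Rightarrow> 'n ncpoly) \<Rightarrow> 'n \<Rightarrow> 'n \<Rightarrow> 'n nc2poly" where
  "jacobian P i j = free_diff j (P i)"

definition quadratic_potential :: "real^'n^'n \<Rightarrow> 'n::finite ncpoly" where
  "quadratic_potential C = (\<Sum>i\<in>UNIV. \<Sum>j\<in>UNIV.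
     Poly_Mapping.single [i, j] (of_real (1/2 * matrix_inv C $ i $ j)))"

definition eval_word :: "('v::complex_vec) hilbert \<Rightarrow> ('n \<Rightarrow> 'v \<Rightarrow> 'v) \<Rightarrow> 'n list \<Rightarrow> 'v \<Rightarrow> 'v" where
  "eval_word H X w = foldr (\<lambda>i T. X i \<circ> T) w (id_op H)"

definition eval_ncpoly :: "('v::complex_vec) hilbert \<Rightarrow> ('n \<Rightarrow> 'v \<Rightarrow> 'v) \<Rightarrow> 'n ncpoly \<Rightarrow> 'v \<Rightarrow> 'v" where
  "eval_ncpoly H X p =
     (\<Sum>w\<in>Poly_Mapping.keys p. Poly_Mapping.lookup p w *\<^sub>C eval_word H X w)"

section \<open>Free Stein kernels\<close>

text \<open>The Hilbert--Schmidt operator identified with \<open>a \<otimes> b\<^sup>o\<^sup>p\<close>.\<close>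

definition tensor_op :: "real \<Rightarrow> 'n::finite fock_op \<Rightarrow> 'n fock_op \<Rightarrow> 'n fock_op" where
  "tensor_op q a b = (\<lambda>v. if v \<in> vecs (fock q)
     then ip (fock q) v (adjoint_op (fock q) b vacuum) *\<^sub>C a vacuum else 0)"

definition eval_nc2poly :: "real \<Rightarrow> ('k \<Rightarrow> 'n::finite fock_op) \<Rightarrow> 'k nc2poly \<Rightarrow> 'n fock_op" where
  "eval_nc2poly q X B = (\<Sum>(a, b)\<in>Poly_Mapping.keys B.
     Poly_Mapping.lookup B (a, b) *\<^sub>C
       tensor_op q (eval_word (fock q) X a) (eval_word (fock q) X b))"

definition left_mult :: "('v::complex_vec) hilbert \<Rightarrow> ('v \<Rightarrow> 'v) \<Rightarrow> ('v \<Rightarrow> 'v) \<Rightarrow> 'v \<Rightarrow> 'v" where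
  "left_mult H a = (\<lambda>T. if hilbert_schmidt H T then a \<circ> T else 0)"

definition right_mult :: "('v::complex_vec) hilbert \<Rightarrow> ('v \<Rightarrow> 'v) \<Rightarrow> ('v \<Rightarrow> 'v) \<Rightarrow> 'v \<Rightarrow> 'v" where
  "right_mult H b = (\<lambda>T. if hilbert_schmidt H T then T \<circ> b else 0)"

text \<open>The von Neumann tensor product of \<open>M\<close> and \<open>M\<^sup>o\<^sup>p\<close>, represented on \<open>HS H\<close>, the Hilbert space
  tensor product of \<open>H\<close> and its conjugate: \<open>a \<otimes> b\<^sup>o\<^sup>p\<close> acts as \<open>T \<mapsto> a T b\<close>.\<close>

definition vN_tensor_op :: "('v::complex_vec) hilbert \<Rightarrow> ('v \<Rightarrow> 'v) set \<Rightarrow>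
    (('v \<Rightarrow> 'v) \<Rightarrow> 'v \<Rightarrow> 'v) set" where
  "vN_tensor_op H M = vN_generated (HS H) (left_mult H ` M \<union> right_mult H ` M)"

text \<open>In this representation \<open>\<tau> \<otimes> \<tau>\<^sup>o\<^sup>p\<close> is the vector state of \<open>1 \<otimes> 1 = \<langle>\<cdot>, \<Omega>\<rangle> \<Omega>\<close>, and
  \<open>Y \<mapsto> Y (1 \<otimes> 1)\<close> sends \<open>a \<otimes> b\<^sup>o\<^sup>p\<close> to \<open>\<langle>\<cdot>, b\<^sup>* \<Omega>\<rangle> a \<Omega>\<close>. So the following is
  \<open>L\<^sup>2(M \<otimes> M\<^sup>o\<^sup>p, \<tau> \<otimes> \<tau>\<^sup>o\<^sup>p)\<close> as a space of Hilbert--Schmidt operators, for \<open>M = W\<^sup>*(X)\<close>.\<close>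

definition L2_tensor :: "real \<Rightarrow> ('k \<Rightarrow> 'n::finite fock_op) \<Rightarrow> 'n fock_op set" where
  "L2_tensor q X = L2_space (HS (fock q))
     (vN_tensor_op (fock q) (vN_generated (fock q) (range X)))
     (tensor_op q (id_op (fock q)) (id_op (fock q)))"

text \<open>The inner products \<open>\<langle>X, Y\<rangle>\<^sub>2\<close> and \<open>\<langle>A, B\<rangle>\<^sub>H\<^sub>S\<close> of the defining identity are linear in
  the second argument, hence the order of the arguments of \<open>ip\<close>.\<close>

definition free_stein_kernel ::
    "real \<Rightarrow> ('k::finite \<Rightarrow> 'n::finite fock_op) \<Rightarrow> 'k ncpoly \<Rightarrow> ('k \<Rightarrow> 'k \<Rightarrow> 'n fock_op) \<Rightarrow> bool" where
  "free_stein_kernel q X V A \<longleftrightarrow>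
     (\<forall>i j. A i j \<in> L2_tensor q X) \<and>
     (\<forall>P :: 'k \<Rightarrow> 'k ncpoly.
        (\<Sum>i\<in>UNIV. tau q (adjoint_op (fock q) (eval_ncpoly (fock q) X (cyclic_diff i V)) \<circ>
                          eval_ncpoly (fock q) X (P i)))
        = (\<Sum>i\<in>UNIV. \<Sum>j\<in>UNIV.
             ip (HS (fock q)) (eval_nc2poly q X (jacobian P i j)) (A i j)))"

end

theory Submission
  imports Defs
begin

text \<open>Write \<open>X(x) = l(x) + l\<^sup>*(x)\<close> for the left field operators and \<open>Y(x) = r(x) + r\<^sup>*(x)\<close> for the
  right ones, which create and annihilate at the other end of a tensor. Moving the left
  annihilation operator past a right creation operator does not produce the identity: the created
  letter sits at the far end and is reached only after passing all other letters, so
  \<open>l\<^sup>*(x) r(y) - r(y) l\<^sup>*(x) = \<langle>y, x\<rangle> \<Xi>\<^sub>q\<close> (lemma \<open>ann_rcre\<close>), while \<open>l\<^sup>*\<close> and \<open>r\<^sup>*\<close> commute. Hence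
  \<open>l\<^sup>*(x)\<close> passes through a word in the right fields like a free difference quotient that leaves
  \<open>\<Xi>\<^sub>q\<close> at the place of the removed letter. For real vectors the left and right fields commute, and they
  agree on \<open>\<Omega>\<close>; therefore a word in the \<open>X(e\<^sub>i)\<close> applied to \<open>\<Omega>\<close> is the reversed word in the
  \<open>Y(e\<^sub>i)\<close> applied to \<open>\<Omega>\<close>. Together these give (lemma \<open>ip_field_word_vacuum\<close>)
  \<open>\<langle>X\<^sub>w \<Omega>, X(x) \<Omega>\<rangle> = \<Sum> \<langle>x, e\<^sub>i\<rangle> \<langle>\<Xi>\<^sub>q X\<^sub>a \<Omega>, (X\<^sub>b)\<^sup>* \<Omega>\<rangle>\<close>, summed over the factorizations
  \<open>w = a i b\<close>. The summand is the Hilbert--Schmidt pairing of \<open>X\<^sub>a \<otimes> X\<^sub>b\<^sup>o\<^sup>p\<close> with \<open>\<Xi>\<^sub>q\<close>, and multiplying by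
  \<open>C\<^sup>-\<^sup>1\<close> turns the Gram matrix of the \<open>e\<^sub>i\<close> into the identity matrix, which selects the terms of
  \<open>\<partial>\<^sub>i\<close>. This is the defining identity of a Stein kernel on monomials.

  For the identity to concern operators on a Hilbert space, three facts about the Fock space are
  needed. The form is positive definite because \<open>q\<close> to the number of inversions of
  \<open>\<tau>\<^sup>-\<^sup>1 \<sigma>\<close> is, as a matrix, a
  principal submatrix of a tensor product of positive matrices with rows \<open>(1, q)\<close> and \<open>(q, 1)\<close>, one for each pair
  of indices (lemma \<open>level_ip_lower_bound\<close>). The creation operators are bounded by an induction
  over the rank that uses the relation \<open>l\<^sup>*(h) l(h) = \<parallel>h\<parallel>\<^sup>2 + q l(h) l\<^sup>*(h)\<close> (lemma \<open>level_cre_bound\<close>).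
  Finally, bounded functionals are represented by vectors (lemma \<open>fock_hilbert_space\<close>), which makes
  Parseval's identity hold for every maximal orthonormal set.

  That \<open>\<Xi>\<^sub>q\<close> lies in \<open>L\<^sup>2\<close> rests on the dimension \<open>n\<^sup>k\<close> of the \<open>k\<close>-fold tensor power: the truncations
  of \<open>\<Xi>\<^sub>q\<close> to rank below \<open>m\<close> differ from it by at most the tail of the geometric series in \<open>q\<^sup>2 n\<close> in the
  squared Hilbert--Schmidt norm. The truncations are linear combinations of operators
  \<open>\<langle>\<cdot>, b\<rangle> b\<close> with \<open>b\<close> a finite tensor, and the \<open>e\<^sub>i\<close> span, so every such \<open>b\<close> is \<open>a \<Omega>\<close> for some \<open>a\<close> in the
  algebra and \<open>\<langle>\<cdot>, b\<rangle> b\<close> is the vector of \<open>a \<otimes> (a\<^sup>*)\<^sup>o\<^sup>p\<close>.\<close>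

section \<open>Positivity of the \<open>q\<close>-deformed form\<close>

text \<open>The sesquilinear form of the kernel that is \<open>q\<close> to the power of the Hamming distance of \<open>A i\<close> and
  \<open>A j\<close> within \<open>X\<close>.\<close>

definition hamming_form ::
    "real \<Rightarrow> 'x set \<Rightarrow> ('i \<Rightarrow> 'x set) \<Rightarrow> 'i set \<Rightarrow> ('i \<Rightarrow> complex) \<Rightarrow> ('i \<Rightarrow> complex) \<Rightarrow> complex" where
  "hamming_form q X A I F G = (\<Sum>i\<in>I. \<Sum>j\<in>I.
     of_real (q ^ card {x \<in> X. (x \<in> A i) \<noteq> (x \<in> A j)}) * (F i * cnj (G j)))"

text \<open>A single coordinate contributes the matrix with diagonal entries \<open>1\<close> and off-diagonal entries \<open>q\<close>.
  It is \<open>1 - \<bar>q\<bar>\<close> times the identity plus \<open>\<bar>q\<bar>\<close> times a matrix of rank one with entries \<open>\<plusminus>1\<close>. The first part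
  splits the index set according to \<open>x \<in> A i\<close>, the second part only changes signs.\<close>

lemma hamming_form_insert:
  fixes q :: real
  assumes "finite X" "x \<notin> X"
  shows "hamming_form q (insert x X) A I F F =
    of_real (1 - \<bar>q\<bar>) * (hamming_form q X A I (\<lambda>i. of_bool (x \<in> A i) * F i) (\<lambda>i. of_bool (x \<in> A i) * F i)
      + hamming_form q X A I (\<lambda>i. of_bool (x \<notin> A i) * F i) (\<lambda>i. of_bool (x \<notin> A i) * F i))
    + of_real \<bar>q\<bar> * hamming_form q X A I (\<lambda>i. (if q < 0 \<and> x \<in> A i then -1 else 1) * F i)
        (\<lambda>i. (if q < 0 \<and> x \<in> A i then -1 else 1) * F i)"
proof -
  have card: "card {y \<in> insert x X. (y \<in> A i) \<noteq> (y \<in> A j)} =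
      (if (x \<in> A i) \<noteq> (x \<in> A j) then Suc (card {y \<in> X. (y \<in> A i) \<noteq> (y \<in> A j)})
       else card {y \<in> X. (y \<in> A i) \<noteq> (y \<in> A j)})" for i j
  proof -
    have "{y \<in> insert x X. (y \<in> A i) \<noteq> (y \<in> A j)} =
        (if (x \<in> A i) \<noteq> (x \<in> A j) then insert x else id) {y \<in> X. (y \<in> A i) \<noteq> (y \<in> A j)}"
      by auto
    then show ?thesis using assms by auto
  qed
  show ?thesis
    unfolding hamming_form_def sum_distrib_left sum.distrib[symmetric]
    by (intro sum.cong refl, unfold card) (auto simp: algebra_simps)
qed

lemma hamming_form_nonneg:
  assumes "finite X" "\<bar>q\<bar> \<le> 1"
  shows "0 \<le> Re (hamming_form q X A I F F)"
  using assms(1)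
proof (induction X arbitrary: F rule: finite_induct)
  case empty
  have "hamming_form q {} A I F F = (\<Sum>i\<in>I. F i) * cnj (\<Sum>i\<in>I. F i)"
    by (simp add: hamming_form_def sum_product)
  then show ?case by (simp only: complex_mult_cnj) simp
next
  case (insert x X)
  let ?p = "\<lambda>i. of_bool (x \<in> A i) * F i" and ?p' = "\<lambda>i. of_bool (x \<notin> A i) * F i"
  let ?t = "\<lambda>i. (if q < 0 \<and> x \<in> A i then -1 else 1) * F i"
  have "0 \<le> (1 - \<bar>q\<bar>) * (Re (hamming_form q X A I ?p ?p) + Re (hamming_form q X A I ?p' ?p'))
      + \<bar>q\<bar> * Re (hamming_form q X A I ?t ?t)"
    using assms(2) by (intro add_nonneg_nonneg mult_nonneg_nonneg insert.IH) auto
  then show ?case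
    using insert.hyps by (simp add: hamming_form_insert)
qed

text \<open>The previous decomposition shows that each coordinate dominates \<open>1 - \<bar>q\<bar>\<close> times the
  identity. Since \<open>0 ^ 0 = 1\<close>, the form at \<open>0\<close> is the one of the kernel that tests whether \<open>A i\<close> and \<open>A j\<close>
  agree on \<open>X\<close>.\<close>

lemma hamming_form_ge:
  assumes "finite X" "\<bar>q\<bar> \<le> 1"
  shows "(1 - \<bar>q\<bar>) ^ card X * Re (hamming_form 0 X A I F F) \<le> Re (hamming_form q X A I F F)"
  using assms(1)
proof (induction X arbitrary: F rule: finite_induct)
  case empty
  show ?case by (simp add: hamming_form_def)
next
  case (insert x X)
  let ?p = "\<lambda>i. of_bool (x \<in> A i) * F i" and ?p' = "\<lambda>i. of_bool (x \<notin> A i) * F i"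
  let ?t = "\<lambda>i. (if q < 0 \<and> x \<in> A i then -1 else 1) * F i"
  have "(1 - \<bar>q\<bar>) ^ card (insert x X) * Re (hamming_form 0 (insert x X) A I F F)
      = (1 - \<bar>q\<bar>) * ((1 - \<bar>q\<bar>) ^ card X * Re (hamming_form 0 X A I ?p ?p)
          + (1 - \<bar>q\<bar>) ^ card X * Re (hamming_form 0 X A I ?p' ?p'))"
    using insert.hyps by (simp add: hamming_form_insert algebra_simps)
  also have "\<dots> \<le> (1 - \<bar>q\<bar>) * (Re (hamming_form q X A I ?p ?p) + Re (hamming_form q X A I ?p' ?p'))"
    using assms(2) by (intro mult_left_mono add_mono insert.IH) auto
  also have "\<dots> \<le> \<dots> + \<bar>q\<bar> * Re (hamming_form q X A I ?t ?t)"
    using mult_nonneg_nonneg[OF abs_ge_zero hamming_form_nonneg[OF insert.hyps(1) assms(2), of A I ?t], of q]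
    by linarith
  also have "\<dots> = Re (hamming_form q (insert x X) A I F F)"
    using insert.hyps by (simp add: hamming_form_insert)
  finally show ?case .
qed

lemma hamming_form_hermitian: "cnj (hamming_form q X A I F G) = hamming_form q X A I G F"
proof -
  have sym: "{x \<in> X. (x \<in> A i) \<noteq> (x \<in> A j)} = {x \<in> X. (x \<in> A j) \<noteq> (x \<in> A i)}" for i j
    by auto
  have "cnj (hamming_form q X A I F G) = (\<Sum>i\<in>I. \<Sum>j\<in>I.
     of_real (q ^ card {x \<in> X. (x \<in> A i) \<noteq> (x \<in> A j)}) * (cnj (F i) * G j))"
    by (simp add: hamming_form_def)
  also have "\<dots> = hamming_form q X A I G F"
    unfolding hamming_form_def
    by (subst sum.swap, intro sum.cong refl, subst sym) (simp only: ac_simps)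
  finally show ?thesis .
qed

definition pairs :: "nat \<Rightarrow> (nat \<times> nat) set" where
  "pairs k = {(a, b). a < b \<and> b < k}"

text \<open>The pairs \<open>(a, b)\<close> such that \<open>a\<close> occurs before \<open>b\<close> in the list of values of \<open>\<sigma>\<close>.\<close>

definition kept_pairs :: "(nat \<Rightarrow> nat) \<Rightarrow> (nat \<times> nat) set" where
  "kept_pairs \<sigma> = {(a, b). inv \<sigma> a < inv \<sigma> b}"

lemma finite_pairs: "finite (pairs k)"
  by (rule finite_subset[of _ "{..<k} \<times> {..<k}"]) (auto simp: pairs_def)

text \<open>An inversion of \<open>\<tau>\<^sup>-\<^sup>1 \<sigma>\<close> is a pair of positions whose two values under \<open>\<sigma>\<close> occur in the
  opposite order in \<open>\<tau>\<close>. So the number of inversions is a Hamming distance.\<close>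

lemma inversions_eq_disagreements:
  assumes s: "\<sigma> permutes {..<k}" and t: "\<tau> permutes {..<k}"
  shows "inversions k (inv \<tau> \<circ> \<sigma>) =
    card {x \<in> pairs k. (x \<in> kept_pairs \<sigma>) \<noteq> (x \<in> kept_pairs \<tau>)}"
proof -
  note lt = permutes_in_image[OF s, simplified] permutes_in_image[OF permutes_inv[OF s], simplified]
  note si = permutes_inverses[OF s] and ti = permutes_inverses[OF t]
  have inj: "inv \<sigma> a = inv \<sigma> b \<longleftrightarrow> a = b" "inv \<tau> a = inv \<tau> b \<longleftrightarrow> a = b" for a b
    by (metis si(1)) (metis ti(1))
  \<comment> \<open>\<open>up\<close> sorts a pair, which makes pairs of positions correspond to pairs of values.\<close>
  define up where "up = (\<lambda>(i, j). if i < j then (i, j) else (j, i :: nat))"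
  have up: "up (i, j) = (if i < j then (i, j) else (j, i))" for i j
    by (simp add: up_def)
  let ?f = "\<lambda>(i, j). up (\<sigma> i, \<sigma> j)"
  let ?g = "\<lambda>(a, b). up (inv \<sigma> a, inv \<sigma> b)"
  let ?P = "{(i, j). i < j \<and> j < k \<and> (inv \<tau> \<circ> \<sigma>) j < (inv \<tau> \<circ> \<sigma>) i}"
  let ?Q = "{x \<in> pairs k. (x \<in> kept_pairs \<sigma>) \<noteq> (x \<in> kept_pairs \<tau>)}"
  have P: "?g (?f (i, j)) = (i, j) \<and> ?f (i, j) \<in> ?Q" if "(i, j) \<in> ?P" for i j
  proof -
    have ij: "i < j" "j < k" "inv \<tau> (\<sigma> j) < inv \<tau> (\<sigma> i)" using that by auto
    then have "\<sigma> i < k" "\<sigma> j < k" "\<sigma> i \<noteq> \<sigma> j" using lt(1)[of i] lt(1)[of j] by auto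
    with ij show ?thesis
      by (cases "\<sigma> i < \<sigma> j") (simp_all add: up pairs_def kept_pairs_def si)
  qed
  have Q: "?f (?g (a, b)) = (a, b) \<and> ?g (a, b) \<in> ?P" if "(a, b) \<in> ?Q" for a b
  proof -
    have ab: "a < b" "b < k" "(inv \<sigma> a < inv \<sigma> b) \<noteq> (inv \<tau> a < inv \<tau> b)"
      using that by (simp_all add: pairs_def kept_pairs_def)
    then have "inv \<sigma> a < k" "inv \<sigma> b < k" "inv \<sigma> a \<noteq> inv \<sigma> b" "inv \<tau> a \<noteq> inv \<tau> b"
      using lt(2)[of a] lt(2)[of b] inj[of a b] by auto
    with ab show ?thesis
      by (cases "inv \<sigma> a < inv \<sigma> b") (simp_all add: up si)
  qed
  have "bij_betw ?f ?P ?Q"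
  proof (rule bij_betw_byWitness[where f' = ?g])
    show "\<forall>x\<in>?P. ?g (?f x) = x"
      by (rule ballI) (use P in \<open>simp only: split_paired_all\<close>)
    show "\<forall>x\<in>?Q. ?f (?g x) = x"
      by (rule ballI) (use Q in \<open>simp only: split_paired_all\<close>)
    show "?f ` ?P \<subseteq> ?Q"
      by (rule image_subsetI) (use P in \<open>simp only: split_paired_all\<close>)
    show "?g ` ?Q \<subseteq> ?P"
      by (rule image_subsetI) (use Q in \<open>simp only: split_paired_all\<close>)
  qed
  then show ?thesis unfolding inversions_def by (rule bij_betw_same_card)
qed

lemma level_ip_permute_list:
  "level_ip q k f g = (\<Sum>\<sigma> | \<sigma> permutes {..<k}. of_real (q ^ inversions k \<sigma>) *
     (\<Sum>w | length w = k. f (permute_list \<sigma> w) * cnj (g w)))"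
  unfolding level_ip_def permute_list_def by (intro sum.cong refl arg_cong2[where f = "(*)"]) auto

lemma sum_words_permute:
  assumes "\<tau> permutes {..<k}"
  shows "(\<Sum>w :: 'n::finite list | length w = k. F (permute_list \<tau> w)) = (\<Sum>w | length w = k. F w)"
proof (rule sum.reindex_bij_witness[where i = "permute_list (inv \<tau>)" and j = "permute_list \<tau>"])
  fix w :: "'n list" assume "w \<in> {w. length w = k}"
  then have w: "length w = k" by simp
  show "permute_list (inv \<tau>) (permute_list \<tau> w) = w"
    using permute_list_compose[of "inv \<tau>" w \<tau>] permutes_inv[OF assms] w permutes_inv_o[OF assms] by simp
  show "permute_list \<tau> (permute_list (inv \<tau>) w) = w"
    using permute_list_compose[of \<tau> w "inv \<tau>"] assms w permutes_inv_o[OF assms] by simp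
qed simp_all

text \<open>Relabelling the words by \<open>\<tau>\<close> replaces \<open>\<sigma>\<close> by \<open>\<tau>\<^sup>-\<^sup>1 \<sigma>\<close> in the weight; the sum over all \<open>\<tau>\<close> is symmetric in
  both permutations.\<close>

lemma level_ip_hamming_form:
  "of_nat (fact k) * level_ip q k f g = (\<Sum>w | length w = k.
     hamming_form q (pairs k) kept_pairs {\<sigma>. \<sigma> permutes {..<k}}
       (\<lambda>\<sigma>. f (permute_list \<sigma> w)) (\<lambda>\<sigma>. g (permute_list \<sigma> w)))"
proof -
  let ?S = "{\<sigma>. \<sigma> permutes {..<k}}" and ?W = "{w :: 'a list. length w = k}"
  have shift: "level_ip q k f g = (\<Sum>\<sigma>\<in>?S. \<Sum>w\<in>?W. of_real (q ^ inversions k (inv \<tau> \<circ> \<sigma>)) *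
     (f (permute_list \<sigma> w) * cnj (g (permute_list \<tau> w))))" if t: "\<tau> permutes {..<k}" for \<tau>
  proof -
    have "(\<Sum>\<sigma>\<in>?S. \<Sum>w\<in>?W. of_real (q ^ inversions k (inv \<tau> \<circ> \<sigma>)) *
        (f (permute_list \<sigma> w) * cnj (g (permute_list \<tau> w))))
      = (\<Sum>\<sigma>\<in>?S. \<Sum>w\<in>?W. of_real (q ^ inversions k (inv \<tau> \<circ> (\<tau> \<circ> \<sigma>))) *
        (f (permute_list (\<tau> \<circ> \<sigma>) w) * cnj (g (permute_list \<tau> w))))"
      by (rule setum_permutations_compose_left[OF t])
    also have "\<dots> = (\<Sum>\<sigma>\<in>?S. \<Sum>w\<in>?W. of_real (q ^ inversions k \<sigma>) *
        (f (permute_list \<sigma> (permute_list \<tau> w)) * cnj (g (permute_list \<tau> w))))"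
      using t by (intro sum.cong refl) (simp add: permute_list_compose o_assoc permutes_inv_o)
    also have "\<dots> = (\<Sum>\<sigma>\<in>?S. \<Sum>w\<in>?W. of_real (q ^ inversions k \<sigma>) * (f (permute_list \<sigma> w) * cnj (g w)))"
      by (intro sum.cong refl sum_words_permute[OF t, where
            F = "\<lambda>w. of_real (q ^ inversions k _) * (f (permute_list _ w) * cnj (g w))"])
    finally show ?thesis by (simp add: level_ip_permute_list sum_distrib_left)
  qed
  have "of_nat (fact k) * level_ip q k f g = (\<Sum>\<tau>\<in>?S. level_ip q k f g)"
    by (simp add: card_permutations[of "{..<k}" k])
  also have "\<dots> = (\<Sum>\<tau>\<in>?S. \<Sum>\<sigma>\<in>?S. \<Sum>w\<in>?W. of_real (q ^ inversions k (inv \<tau> \<circ> \<sigma>)) *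
     (f (permute_list \<sigma> w) * cnj (g (permute_list \<tau> w))))"
    by (intro sum.cong refl shift) simp
  also have "\<dots> = (\<Sum>\<sigma>\<in>?S. \<Sum>w\<in>?W. \<Sum>\<tau>\<in>?S. of_real (q ^ inversions k (inv \<tau> \<circ> \<sigma>)) *
     (f (permute_list \<sigma> w) * cnj (g (permute_list \<tau> w))))"
    by (subst sum.swap) (intro sum.cong refl sum.swap)
  also have "\<dots> = (\<Sum>w\<in>?W. \<Sum>\<sigma>\<in>?S. \<Sum>\<tau>\<in>?S. of_real (q ^ inversions k (inv \<tau> \<circ> \<sigma>)) *
     (f (permute_list \<sigma> w) * cnj (g (permute_list \<tau> w))))"
    by (rule sum.swap)
  also have "\<dots> = (\<Sum>w\<in>?W. hamming_form q (pairs k) kept_pairs ?S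
       (\<lambda>\<sigma>. f (permute_list \<sigma> w)) (\<lambda>\<sigma>. g (permute_list \<sigma> w)))"
    unfolding hamming_form_def by (intro sum.cong refl) (simp add: inversions_eq_disagreements)
  finally show ?thesis .
qed

lemma level_ip_hermitian: "cnj (level_ip q k f g) = level_ip q k g f"
proof -
  have "of_nat (fact k) * cnj (level_ip q k f g) = cnj (of_nat (fact k) * level_ip q k f g)"
    by simp
  also have "\<dots> = of_nat (fact k) * level_ip q k g f"
    unfolding level_ip_hamming_form by (simp add: hamming_form_hermitian)
  finally show ?thesis by simp
qed

lemma inversions_eq_0:
  assumes p: "\<sigma> permutes {..<k}" and inv: "inversions k \<sigma> = 0"
  shows "\<sigma> = id"
proof (rule permutes_natset_ge[OF p])
  have "finite {(i, j). i < j \<and> j < k \<and> \<sigma> j < \<sigma> i}"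
    by (rule finite_subset[of _ "{..<k} \<times> {..<k}"]) auto
  with inv have none: "{(i, j). i < j \<and> j < k \<and> \<sigma> j < \<sigma> i} = {}"
    by (simp add: inversions_def)
  have "\<sigma> i < \<sigma> j" if "i < j" "j < k" for i j
    using none that permutes_inj[OF p, THEN injD, of i j] by fastforce
  then have "i \<le> \<sigma> i" if "i < k" for i
    using that by (induction i) (simp, metis Suc_lessD Suc_leI lessI order.strict_trans1)
  then show "\<forall>i\<in>{..<k}. i \<le> \<sigma> i" by simp
qed

lemma level_ip_0: "level_ip 0 k f g = (\<Sum>w | length w = k. f w * cnj (g w))"
proof -
  have "level_ip 0 k f g = (\<Sum>\<sigma>\<in>{id}. of_real (0 ^ inversions k \<sigma>) *
     (\<Sum>w | length w = k. f (permute_list \<sigma> w) * cnj (g w)))"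
    unfolding level_ip_permute_list
  proof (rule sum.mono_neutral_right)
    show "\<forall>\<sigma>\<in>{\<sigma>. \<sigma> permutes {..<k}} - {id}. complex_of_real (0 ^ inversions k \<sigma>) *
      (\<Sum>w | length w = k. f (permute_list \<sigma> w) * cnj (g w)) = 0"
    proof
      fix \<sigma> assume "\<sigma> \<in> {\<sigma>. \<sigma> permutes {..<k}} - {id}"
      then have "inversions k \<sigma> \<noteq> 0" using inversions_eq_0 by blast
      then show "complex_of_real (0 ^ inversions k \<sigma>) *
          (\<Sum>w | length w = k. f (permute_list \<sigma> w) * cnj (g w)) = 0" by simp
    qed
  qed (auto simp: finite_permutations permutes_id)
  moreover have "inversions k id = 0"
    unfolding inversions_def by (subst card_eq_0_iff) auto
  ultimately show ?thesis by simp
qed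

text \<open>Strict positivity: the form dominates a multiple of its value at \<open>q = 0\<close>, where only
  the identity permutation survives.\<close>

lemma level_ip_lower_bound:
  assumes "\<bar>q\<bar> \<le> 1"
  shows "(1 - \<bar>q\<bar>) ^ card (pairs k) * (\<Sum>w | length w = k. (cmod (f w))\<^sup>2) \<le> Re (level_ip q k f f)"
proof -
  let ?h = "\<lambda>q w. hamming_form q (pairs k) kept_pairs {\<sigma>. \<sigma> permutes {..<k}}
       (\<lambda>\<sigma>. f (permute_list \<sigma> w)) (\<lambda>\<sigma>. f (permute_list \<sigma> w))"
  have sq: "(\<Sum>w | length w = k. (cmod (f w))\<^sup>2) = Re (level_ip 0 k f f)"
    by (simp add: level_ip_0 complex_mult_cnj cmod_power2)
  have h: "fact k * Re (level_ip q k f f) = (\<Sum>w | length w = k. Re (?h q w))" for q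
    using arg_cong[OF level_ip_hamming_form[of k q f f], of Re] by simp
  have "fact k * ((1 - \<bar>q\<bar>) ^ card (pairs k) * Re (level_ip 0 k f f))
      = (\<Sum>w | length w = k. (1 - \<bar>q\<bar>) ^ card (pairs k) * Re (?h 0 w))"
    using h[of 0] by (simp add: sum_distrib_left[symmetric])
  also have "\<dots> \<le> fact k * Re (level_ip q k f f)"
    unfolding h using assms finite_pairs by (intro sum_mono hamming_form_ge) auto
  finally show ?thesis by (simp add: sq)
qed

section \<open>Complex vector spaces\<close>

lemma scaleC_zero_left: "0 *\<^sub>C (x :: 'v::complex_vec) = 0"
  using scaleC_add_left[of 0 0 x] by simp

lemma scaleC_zero_right: "c *\<^sub>C (0 :: 'v::complex_vec) = 0"
  using scaleC_add_right[of c 0 "0 :: 'v"] by simp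

lemma scaleC_minus_left: "(- c) *\<^sub>C (x :: 'v::complex_vec) = - (c *\<^sub>C x)"
  using scaleC_add_left[of "- c" c x] by (simp add: scaleC_zero_left eq_neg_iff_add_eq_0)

lemma scaleC_minus_one: "(- 1) *\<^sub>C (x :: 'v::complex_vec) = - x"
  by (simp add: scaleC_minus_left scaleC_one)

lemma scaleC_sum_right: "c *\<^sub>C (sum f A :: 'v::complex_vec) = (\<Sum>i\<in>A. c *\<^sub>C f i)"
  by (induction A rule: infinite_finite_induct) (simp_all add: scaleC_zero_right scaleC_add_right)

lemma scaleC_fun_apply: "(c *\<^sub>C f) x = c *\<^sub>C f x"
  by (simp add: scaleC_fun_def)

lemma scaleC_complex: "c *\<^sub>C (z :: complex) = c * z"
  by (simp add: scaleC_complex_def)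

lemma sum_fun_apply: "(sum f A :: 'a \<Rightarrow> 'b::comm_monoid_add) x = (\<Sum>i\<in>A. f i x)"
  by (induction A rule: infinite_finite_induct) simp_all

section \<open>Bounded operators and commutants\<close>

text \<open>Continuity of operators only needs the triangle inequality up to a constant. In this form the
  results apply to the Hilbert--Schmidt operators as well, where the weak inequality follows at
  once from the one for the underlying space.\<close>

locale quasi_normed_space =
  fixes H :: "'v::complex_vec hilbert"
  assumes zero_mem: "0 \<in> vecs H"
    and add_mem: "u \<in> vecs H \<Longrightarrow> v \<in> vecs H \<Longrightarrow> u + v \<in> vecs H"
    and scale_mem: "v \<in> vecs H \<Longrightarrow> c *\<^sub>C v \<in> vecs H"
    and hnorm_nonneg: "v \<in> vecs H \<Longrightarrow> 0 \<le> hnorm H v"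
    and hnorm_add_le: "u \<in> vecs H \<Longrightarrow> v \<in> vecs H \<Longrightarrow> hnorm H (u + v) \<le> 2 * (hnorm H u + hnorm H v)"
    and hnorm_scale_le: "v \<in> vecs H \<Longrightarrow> hnorm H (c *\<^sub>C v) \<le> cmod c * hnorm H v"
begin

lemma minus_mem: "v \<in> vecs H \<Longrightarrow> - v \<in> vecs H"
  using scale_mem[of v "-1"] by (simp add: scaleC_minus_one)

lemma diff_mem: "u \<in> vecs H \<Longrightarrow> v \<in> vecs H \<Longrightarrow> u - v \<in> vecs H"
  using add_mem[of u "- v"] minus_mem by simp

lemma sum_mem: "(\<And>i. i \<in> A \<Longrightarrow> f i \<in> vecs H) \<Longrightarrow> sum f A \<in> vecs H"
  by (induction A rule: infinite_finite_induct) (auto simp: zero_mem add_mem)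

lemma bounded_opsI:
  assumes "\<And>v. v \<in> vecs H \<Longrightarrow> T v \<in> vecs H" "\<And>v. v \<notin> vecs H \<Longrightarrow> T v = 0"
    and "\<And>u v. u \<in> vecs H \<Longrightarrow> v \<in> vecs H \<Longrightarrow> T (u + v) = T u + T v"
    and "\<And>c v. v \<in> vecs H \<Longrightarrow> T (c *\<^sub>C v) = c *\<^sub>C T v"
    and "\<And>v. v \<in> vecs H \<Longrightarrow> hnorm H (T v) \<le> K * hnorm H v"
  shows "T \<in> bounded_ops H"
  using assms unfolding bounded_ops_def by blast

lemma bounded_opsD:
  assumes "T \<in> bounded_ops H"
  shows "v \<in> vecs H \<Longrightarrow> T v \<in> vecs H"
    and "v \<notin> vecs H \<Longrightarrow> T v = 0"
    and "u \<in> vecs H \<Longrightarrow> v \<in> vecs H \<Longrightarrow> T (u + v) = T u + T v"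
    and "v \<in> vecs H \<Longrightarrow> T (c *\<^sub>C v) = c *\<^sub>C T v"
  using assms unfolding bounded_ops_def by blast+

lemma bounded_ops_bound:
  assumes "T \<in> bounded_ops H"
  shows "\<exists>K\<ge>0. \<forall>v\<in>vecs H. hnorm H (T v) \<le> K * hnorm H v"
proof -
  obtain K where K: "hnorm H (T v) \<le> K * hnorm H v" if "v \<in> vecs H" for v
    using assms unfolding bounded_ops_def by blast
  have "hnorm H (T v) \<le> max K 0 * hnorm H v" if "v \<in> vecs H" for v
    using K[OF that] mult_right_mono[of K "max K 0" "hnorm H v"] hnorm_nonneg[OF that] by linarith
  then show ?thesis by (intro exI[of _ "max K 0"]) simp
qed

lemma bounded_ops_zero_vec: "T \<in> bounded_ops H \<Longrightarrow> T 0 = 0"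
  using bounded_opsD(4)[of T 0 0] zero_mem by (simp add: scaleC_zero_left)

lemma bounded_ops_add:
  assumes S: "S \<in> bounded_ops H" and T: "T \<in> bounded_ops H"
  shows "S + T \<in> bounded_ops H"
proof -
  obtain K where K: "\<And>v. v \<in> vecs H \<Longrightarrow> hnorm H (S v) \<le> K * hnorm H v"
    using bounded_ops_bound[OF S] by blast
  obtain L where L: "\<And>v. v \<in> vecs H \<Longrightarrow> hnorm H (T v) \<le> L * hnorm H v"
    using bounded_ops_bound[OF T] by blast
  show ?thesis
  proof (rule bounded_opsI[where K = "2 * (K + L)"])
    fix v assume v: "v \<in> vecs H"
    show "hnorm H ((S + T) v) \<le> 2 * (K + L) * hnorm H v"
      using hnorm_add_le[of "S v" "T v"] K[OF v] L[OF v] bounded_opsD(1)[OF S v] bounded_opsD(1)[OF T v]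
      by (simp add: algebra_simps)
  qed (use bounded_opsD[OF S] bounded_opsD[OF T] in
      \<open>simp_all add: add_mem scaleC_add_right algebra_simps\<close>)
qed

lemma bounded_ops_scale:
  assumes T: "T \<in> bounded_ops H"
  shows "c *\<^sub>C T \<in> bounded_ops H"
proof -
  obtain L where L: "\<And>v. v \<in> vecs H \<Longrightarrow> hnorm H (T v) \<le> L * hnorm H v"
    using bounded_ops_bound[OF T] by blast
  show ?thesis
  proof (rule bounded_opsI[where K = "cmod c * L"])
    fix v assume v: "v \<in> vecs H"
    have "hnorm H (c *\<^sub>C T v) \<le> cmod c * hnorm H (T v)"
      by (rule hnorm_scale_le[OF bounded_opsD(1)[OF T v]])
    also have "\<dots> \<le> cmod c * (L * hnorm H v)"
      by (intro mult_left_mono L[OF v]) simp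
    finally show "hnorm H ((c *\<^sub>C T) v) \<le> cmod c * L * hnorm H v"
      by (simp add: scaleC_fun_apply algebra_simps)
  qed (use bounded_opsD[OF T] in
      \<open>simp_all add: scaleC_fun_apply scale_mem scaleC_add_right scaleC_zero_right scaleC_scaleC mult.commute\<close>)
qed

lemma bounded_ops_comp:
  assumes S: "S \<in> bounded_ops H" and T: "T \<in> bounded_ops H"
  shows "S \<circ> T \<in> bounded_ops H"
proof -
  obtain K where K: "K \<ge> 0" "\<And>v. v \<in> vecs H \<Longrightarrow> hnorm H (S v) \<le> K * hnorm H v"
    using bounded_ops_bound[OF S] by blast
  obtain L where L: "\<And>v. v \<in> vecs H \<Longrightarrow> hnorm H (T v) \<le> L * hnorm H v"
    using bounded_ops_bound[OF T] by blast
  show ?thesis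
  proof (rule bounded_opsI[where K = "K * L"])
    fix v assume v: "v \<in> vecs H"
    have "hnorm H (S (T v)) \<le> K * hnorm H (T v)"
      using bounded_opsD(1)[OF T v] by (rule K)
    also have "\<dots> \<le> K * (L * hnorm H v)" by (intro mult_left_mono L v K)
    finally show "hnorm H ((S \<circ> T) v) \<le> K * L * hnorm H v" by (simp add: algebra_simps)
  qed (use bounded_opsD[OF S] bounded_opsD[OF T] bounded_ops_zero_vec[OF S] in simp_all)
qed

lemma bounded_ops_id: "id_op H \<in> bounded_ops H"
  by (rule bounded_opsI[where K = 1]) (auto simp: id_op_def add_mem scale_mem)

lemma bounded_ops_0: "0 \<in> bounded_ops H"
  using bounded_ops_scale[OF bounded_ops_id, of 0] by (simp add: scaleC_zero_left)

lemma commutant_add: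
  assumes "S \<subseteq> bounded_ops H" "Y \<in> commutant H S" "Z \<in> commutant H S"
  shows "Y + Z \<in> commutant H S"
proof -
  have "(Y + Z) \<circ> A = A \<circ> (Y + Z)" if A: "A \<in> S" for A
  proof
    fix v
    have Ab: "A \<in> bounded_ops H" using A assms(1) by auto
    have eq: "Y (A v) = A (Y v)" "Z (A v) = A (Z v)"
      using A assms(2,3) unfolding commutant_def by (auto simp: fun_eq_iff)
    show "((Y + Z) \<circ> A) v = (A \<circ> (Y + Z)) v"
    proof (cases "v \<in> vecs H")
      case True
      then have "Y v \<in> vecs H" "Z v \<in> vecs H"
        using assms(2,3) bounded_opsD(1) unfolding commutant_def by auto
      then show ?thesis using bounded_opsD(3)[OF Ab] by (simp add: eq)
    next
      case False
      then have "Y v = 0" "Z v = 0"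
        using assms(2,3) bounded_opsD(2) unfolding commutant_def by auto
      then show ?thesis using bounded_ops_zero_vec[OF Ab] by (simp add: eq)
    qed
  qed
  moreover have "Y + Z \<in> bounded_ops H"
    using assms bounded_ops_add unfolding commutant_def by blast
  ultimately show ?thesis unfolding commutant_def by blast
qed

lemma commutant_scale:
  assumes "S \<subseteq> bounded_ops H" "Y \<in> commutant H S"
  shows "c *\<^sub>C Y \<in> commutant H S"
proof -
  have "(c *\<^sub>C Y) \<circ> A = A \<circ> (c *\<^sub>C Y)" if A: "A \<in> S" for A
  proof
    fix v
    have Ab: "A \<in> bounded_ops H" using A assms(1) by auto
    have eq: "Y (A v) = A (Y v)"
      using A assms(2) unfolding commutant_def by (auto simp: fun_eq_iff)
    show "((c *\<^sub>C Y) \<circ> A) v = (A \<circ> (c *\<^sub>C Y)) v"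
    proof (cases "v \<in> vecs H")
      case True
      then have "Y v \<in> vecs H"
        using assms(2) bounded_opsD(1) unfolding commutant_def by auto
      then show ?thesis using bounded_opsD(4)[OF Ab] by (simp add: eq scaleC_fun_apply)
    next
      case False
      then have "Y v = 0"
        using assms(2) bounded_opsD(2) unfolding commutant_def by auto
      then show ?thesis using bounded_ops_zero_vec[OF Ab]
        by (simp add: eq scaleC_fun_apply scaleC_zero_right)
    qed
  qed
  moreover have "c *\<^sub>C Y \<in> bounded_ops H"
    using assms bounded_ops_scale unfolding commutant_def by blast
  ultimately show ?thesis unfolding commutant_def by blast
qed

lemma commutant_comp:
  assumes "Y \<in> commutant H S" "Z \<in> commutant H S"
  shows "Y \<circ> Z \<in> commutant H S"
  using assms bounded_ops_comp unfolding commutant_def by (auto simp: fun_eq_iff)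

lemma commutant_id:
  assumes "S \<subseteq> bounded_ops H"
  shows "id_op H \<in> commutant H S"
proof -
  have "id_op H \<circ> A = A \<circ> id_op H" if "A \<in> S" for A
  proof -
    have A: "A \<in> bounded_ops H" using that assms by auto
    show ?thesis
      using bounded_opsD(1,2)[OF A] bounded_ops_zero_vec[OF A] zero_mem
      by (auto simp: fun_eq_iff id_op_def)
  qed
  then show ?thesis using bounded_ops_id unfolding commutant_def by blast
qed

lemma commutant_subset: "commutant H S \<subseteq> bounded_ops H"
  by (auto simp: commutant_def)

lemma vN_generatedI:
  assumes "\<And>M. von_neumann_algebra H M \<Longrightarrow> S \<subseteq> M \<Longrightarrow> Y \<in> M"
  shows "Y \<in> vN_generated H S"
  using assms unfolding vN_generated_def by blast

lemma vN_generatedD: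
  assumes "Y \<in> vN_generated H S" "von_neumann_algebra H M" "S \<subseteq> M"
  shows "Y \<in> commutant H (commutant H M)"
  using assms unfolding vN_generated_def von_neumann_algebra_def by blast

lemma bicommutant_eq: "von_neumann_algebra H M \<Longrightarrow> commutant H (commutant H M) = M"
  by (simp add: von_neumann_algebra_def)

text \<open>A von Neumann algebra equals its bicommutant, and a commutant is closed under the algebraic
  operations. So are the von Neumann algebras containing \<open>S\<close>, and with them their intersection.\<close>

lemma vN_generated_add:
  assumes "Y \<in> vN_generated H S" "Z \<in> vN_generated H S"
  shows "Y + Z \<in> vN_generated H S"
proof (rule vN_generatedI)
  fix M assume "von_neumann_algebra H M" "S \<subseteq> M"
  then show "Y + Z \<in> M"
    using commutant_add[OF commutant_subset] vN_generatedD assms bicommutant_eq by metis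
qed

lemma vN_generated_scale:
  assumes "Y \<in> vN_generated H S"
  shows "c *\<^sub>C Y \<in> vN_generated H S"
proof (rule vN_generatedI)
  fix M assume "von_neumann_algebra H M" "S \<subseteq> M"
  then show "c *\<^sub>C Y \<in> M"
    using commutant_scale[OF commutant_subset] vN_generatedD assms bicommutant_eq by metis
qed

lemma vN_generated_comp:
  assumes "Y \<in> vN_generated H S" "Z \<in> vN_generated H S"
  shows "Y \<circ> Z \<in> vN_generated H S"
proof (rule vN_generatedI)
  fix M assume "von_neumann_algebra H M" "S \<subseteq> M"
  then show "Y \<circ> Z \<in> M"
    using commutant_comp vN_generatedD assms bicommutant_eq by metis
qed

lemma vN_generated_id: "id_op H \<in> vN_generated H S"
proof (rule vN_generatedI)
  fix M assume "von_neumann_algebra H M" "S \<subseteq> M"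
  then show "id_op H \<in> M"
    using commutant_id[OF commutant_subset] bicommutant_eq by metis
qed

lemma vN_generated_zero: "0 \<in> vN_generated H S"
  using vN_generated_scale[OF vN_generated_id, of 0] by (simp add: scaleC_zero_left)

lemma vN_generated_sum:
  "(\<And>i. i \<in> A \<Longrightarrow> Y i \<in> vN_generated H S) \<Longrightarrow> sum Y A \<in> vN_generated H S"
  by (induction A rule: infinite_finite_induct) (simp_all add: vN_generated_zero vN_generated_add)

lemma vN_generated_incl: "Y \<in> S \<Longrightarrow> Y \<in> vN_generated H S"
  unfolding vN_generated_def by auto

lemma vN_generated_adjoint: "Y \<in> vN_generated H S \<Longrightarrow> adjoint_op H Y \<in> vN_generated H S"
  unfolding vN_generated_def von_neumann_algebra_def by auto

end

section \<open>Spaces with a positive sesquilinear form\<close>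

text \<open>Definiteness is a separate assumption: the form of a single tensor power, viewed on all functions
  of words, vanishes on the other tensor powers.\<close>

locale semi_inner_space =
  fixes H :: "'v::complex_vec hilbert"
  assumes zero_mem': "0 \<in> vecs H"
    and add_mem': "u \<in> vecs H \<Longrightarrow> v \<in> vecs H \<Longrightarrow> u + v \<in> vecs H"
    and scale_mem': "v \<in> vecs H \<Longrightarrow> c *\<^sub>C v \<in> vecs H"
    and ip_add_left: "u \<in> vecs H \<Longrightarrow> v \<in> vecs H \<Longrightarrow> w \<in> vecs H \<Longrightarrow> ip H (u + v) w = ip H u w + ip H v w"
    and ip_scale_left: "u \<in> vecs H \<Longrightarrow> w \<in> vecs H \<Longrightarrow> ip H (c *\<^sub>C u) w = c * ip H u w"
    and ip_cnj: "u \<in> vecs H \<Longrightarrow> w \<in> vecs H \<Longrightarrow> cnj (ip H u w) = ip H w u"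
    and ip_nonneg: "u \<in> vecs H \<Longrightarrow> 0 \<le> Re (ip H u u)"
begin

lemma ip_add_right:
  assumes "u \<in> vecs H" "v \<in> vecs H" "w \<in> vecs H"
  shows "ip H w (u + v) = ip H w u + ip H w v"
  using arg_cong[OF ip_add_left[OF assms], of cnj] assms by (simp add: ip_cnj add_mem')

lemma ip_scale_right:
  assumes "u \<in> vecs H" "w \<in> vecs H"
  shows "ip H w (c *\<^sub>C u) = cnj c * ip H w u"
  using arg_cong[OF ip_scale_left[OF assms], of cnj] assms by (simp add: ip_cnj scale_mem')

lemma ip_self: "u \<in> vecs H \<Longrightarrow> ip H u u = of_real (Re (ip H u u))"
  using ip_cnj[of u u] by (simp add: complex_eq_iff)

lemma ip_zero_left: "w \<in> vecs H \<Longrightarrow> ip H 0 w = 0"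
  using ip_scale_left[of 0 w 0] by (simp add: scaleC_zero_left zero_mem')

lemma ip_zero_right: "w \<in> vecs H \<Longrightarrow> ip H w 0 = 0"
  using ip_scale_right[of 0 w 0] by (simp add: scaleC_zero_left zero_mem')

lemma ip_minus_left: "u \<in> vecs H \<Longrightarrow> w \<in> vecs H \<Longrightarrow> ip H (- u) w = - ip H u w"
  using ip_scale_left[of u w "-1"] by (simp add: scaleC_minus_one)

lemma ip_minus_right: "u \<in> vecs H \<Longrightarrow> w \<in> vecs H \<Longrightarrow> ip H w (- u) = - ip H w u"
  using ip_scale_right[of u w "-1"] by (simp add: scaleC_minus_one)

lemma minus_mem': "u \<in> vecs H \<Longrightarrow> - u \<in> vecs H"
  using scale_mem'[of u "-1"] by (simp add: scaleC_minus_one)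

lemma ip_diff_left:
  "u \<in> vecs H \<Longrightarrow> v \<in> vecs H \<Longrightarrow> w \<in> vecs H \<Longrightarrow> ip H (u - v) w = ip H u w - ip H v w"
  using ip_add_left[of u "- v" w] by (simp add: ip_minus_left minus_mem')

lemma ip_diff_right:
  "u \<in> vecs H \<Longrightarrow> v \<in> vecs H \<Longrightarrow> w \<in> vecs H \<Longrightarrow> ip H w (u - v) = ip H w u - ip H w v"
  using ip_add_right[of u "- v" w] by (simp add: ip_minus_right minus_mem')

lemma sum_mem': "(\<And>i. i \<in> A \<Longrightarrow> f i \<in> vecs H) \<Longrightarrow> sum f A \<in> vecs H"
  by (induction A rule: infinite_finite_induct) (auto simp: zero_mem' add_mem')

lemma ip_sum_left:
  assumes "\<And>i. i \<in> A \<Longrightarrow> f i \<in> vecs H" "w \<in> vecs H"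
  shows "ip H (sum f A) w = (\<Sum>i\<in>A. ip H (f i) w)"
  using assms(1)
  by (induction A rule: infinite_finite_induct) (simp_all add: ip_zero_left ip_add_left sum_mem' assms(2))

lemma ip_sum_right:
  assumes "\<And>i. i \<in> A \<Longrightarrow> f i \<in> vecs H" "w \<in> vecs H"
  shows "ip H w (sum f A) = (\<Sum>i\<in>A. ip H w (f i))"
  using assms(1)
  by (induction A rule: infinite_finite_induct) (simp_all add: ip_zero_right ip_add_right sum_mem' assms(2))

lemmas ip_linear = ip_add_left ip_add_right ip_scale_left ip_scale_right ip_diff_left ip_diff_right
  ip_minus_left ip_minus_right ip_zero_left ip_zero_right

lemma ip_diff_scale_self:
  assumes "u \<in> vecs H" "v \<in> vecs H"
  shows "Re (ip H (u - c *\<^sub>C v) (u - c *\<^sub>C v)) =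
    Re (ip H u u) - 2 * Re (cnj c * ip H u v) + (cmod c)\<^sup>2 * Re (ip H v v)"
proof -
  have m: "c *\<^sub>C v \<in> vecs H" "u - c *\<^sub>C v \<in> vecs H"
    using assms add_mem'[of u "- (c *\<^sub>C v)"] by (simp_all add: scale_mem' minus_mem')
  have "ip H (u - c *\<^sub>C v) (u - c *\<^sub>C v)
      = ip H u u - (cnj c * ip H u v + cnj (cnj c * ip H u v)) + (c * cnj c) * ip H v v"
    using assms m by (simp add: ip_linear ip_cnj algebra_simps)
  then have "Re (ip H (u - c *\<^sub>C v) (u - c *\<^sub>C v))
      = Re (ip H u u) - 2 * Re (cnj c * ip H u v) + Re ((c * cnj c) * ip H v v)"
    by simp
  moreover have "Re ((c * cnj c) * ip H v v) = (cmod c)\<^sup>2 * Re (ip H v v)"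
    by (simp add: complex_mult_cnj cmod_power2)
  ultimately show ?thesis by linarith
qed

lemma Cauchy_Schwarz:
  assumes u: "u \<in> vecs H" and v: "v \<in> vecs H"
  shows "(cmod (ip H u v))\<^sup>2 \<le> Re (ip H u u) * Re (ip H v v)"
proof -
  let ?b = "ip H u v"
  have re: "Re (cnj (of_real s * ?b) * ?b) = s * (cmod ?b)\<^sup>2" for s
    unfolding cmod_power2 by (simp add: power2_eq_square algebra_simps)
  have main: "0 \<le> Re (ip H u u) - 2 * s * (cmod ?b)\<^sup>2 + s\<^sup>2 * (cmod ?b)\<^sup>2 * Re (ip H v v)" for s
  proof -
    have "u - (of_real s * ?b) *\<^sub>C v \<in> vecs H"
      using add_mem'[OF u minus_mem'[OF scale_mem'[OF v]]] by simp
    from ip_nonneg[OF this] show ?thesis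
      unfolding ip_diff_scale_self[OF u v] re by (simp add: norm_mult power_mult_distrib)
  qed
  show ?thesis
  proof (cases "Re (ip H v v) = 0")
    case True
    have "(cmod ?b)\<^sup>2 = 0"
    proof (rule ccontr)
      \<comment> \<open>The quadratic inequality is linear in \<open>s\<close> here, so a large \<open>s\<close> violates it.\<close>
      assume "(cmod ?b)\<^sup>2 \<noteq> 0"
      with main[of "(Re (ip H u u) + 1) / (cmod ?b)\<^sup>2"] True ip_nonneg[OF u] show False by simp
    qed
    then show ?thesis using True by simp
  next
    case False
    then have pos: "0 < Re (ip H v v)" using ip_nonneg[OF v] by simp
    have "0 \<le> Re (ip H u u) - (cmod ?b)\<^sup>2 / Re (ip H v v)"
      using main[of "1 / Re (ip H v v)"] pos by (simp add: power2_eq_square field_simps)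
    then show ?thesis using pos by (simp add: field_simps)
  qed
qed

lemma hnorm_sq: "v \<in> vecs H \<Longrightarrow> (hnorm H v)\<^sup>2 = Re (ip H v v)"
  by (simp add: hnorm_def ip_nonneg)

lemma Cauchy_Schwarz_hnorm:
  assumes u: "u \<in> vecs H" and v: "v \<in> vecs H"
  shows "cmod (ip H u v) \<le> hnorm H u * hnorm H v"
proof (rule power2_le_imp_le)
  show "(cmod (ip H u v))\<^sup>2 \<le> (hnorm H u * hnorm H v)\<^sup>2"
    using Cauchy_Schwarz[OF u v] by (simp add: power_mult_distrib hnorm_sq u v)
qed (use ip_nonneg u v in \<open>simp add: hnorm_def\<close>)

lemma ip_add_self_le:
  assumes u: "u \<in> vecs H" and v: "v \<in> vecs H"
  shows "Re (ip H (u + v) (u + v)) \<le> 2 * Re (ip H u u) + 2 * Re (ip H v v)"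
proof -
  have m: "u + v \<in> vecs H" "u - v \<in> vecs H"
    using add_mem'[OF u v] add_mem'[OF u minus_mem'[OF v]] by simp_all
  have "ip H (u + v) (u + v) + ip H (u - v) (u - v) = 2 * ip H u u + 2 * ip H v v"
    using u v m by (simp add: ip_linear algebra_simps)
  from arg_cong[OF this, of Re] show ?thesis using ip_nonneg[OF m(2)] by simp
qed

lemma hnorm_scale:
  assumes v: "v \<in> vecs H"
  shows "hnorm H (c *\<^sub>C v) = cmod c * hnorm H v"
proof -
  have "ip H (c *\<^sub>C v) (c *\<^sub>C v) = (c * cnj c) * ip H v v"
    using v by (simp add: ip_linear scale_mem' algebra_simps)
  then have "Re (ip H (c *\<^sub>C v) (c *\<^sub>C v)) = (cmod c)\<^sup>2 * Re (ip H v v)"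
    by (simp add: complex_mult_cnj cmod_power2)
  then show ?thesis by (simp add: hnorm_def real_sqrt_mult)
qed

sublocale quasi_normed_space H
proof
  fix u v assume u: "u \<in> vecs H" and v: "v \<in> vecs H"
  have nn: "0 \<le> hnorm H u" "0 \<le> hnorm H v" using u v by (simp_all add: hnorm_def ip_nonneg)
  show "hnorm H (u + v) \<le> 2 * (hnorm H u + hnorm H v)"
  proof (rule power2_le_imp_le)
    have "(hnorm H (u + v))\<^sup>2 \<le> 2 * (hnorm H u)\<^sup>2 + 2 * (hnorm H v)\<^sup>2"
      using ip_add_self_le[OF u v] u v by (simp add: hnorm_sq add_mem')
    also have "\<dots> \<le> 4 * ((hnorm H u)\<^sup>2 + (hnorm H v)\<^sup>2 + 2 * (hnorm H u * hnorm H v))"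
      using nn by simp
    finally show "(hnorm H (u + v))\<^sup>2 \<le> (2 * (hnorm H u + hnorm H v))\<^sup>2"
      by (simp add: power2_eq_square algebra_simps)
  qed (use nn in simp)
qed (auto simp: zero_mem' add_mem' scale_mem' hnorm_def ip_nonneg hnorm_scale[unfolded hnorm_def])

definition orthonormal :: "'v set \<Rightarrow> bool" where
  "orthonormal E \<longleftrightarrow> E \<subseteq> vecs H \<and> (\<forall>u\<in>E. \<forall>v\<in>E. ip H u v = (if u = v then 1 else 0))"

lemma orthonormalD:
  assumes "orthonormal E"
  shows "u \<in> E \<Longrightarrow> u \<in> vecs H"
    and "u \<in> E \<Longrightarrow> v \<in> E \<Longrightarrow> ip H u v = (if u = v then 1 else 0)"
  using assms unfolding orthonormal_def by auto

definition proj_on :: "'v set \<Rightarrow> 'v \<Rightarrow> 'v" where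
  "proj_on F v = (\<Sum>u\<in>F. ip H v u *\<^sub>C u)"

lemma proj_on_mem: "orthonormal F \<Longrightarrow> proj_on F v \<in> vecs H"
  unfolding proj_on_def using orthonormalD(1) by (intro sum_mem' scale_mem')

lemma ip_proj_on_left:
  "orthonormal F \<Longrightarrow> w \<in> vecs H \<Longrightarrow> ip H (proj_on F v) w = (\<Sum>u\<in>F. ip H v u * ip H u w)"
  unfolding proj_on_def using orthonormalD(1) by (simp add: ip_sum_left scale_mem' ip_scale_left)

lemma ip_proj_on_basis:
  assumes "orthonormal F" "finite F" "u \<in> F"
  shows "ip H (proj_on F v) u = ip H v u"
proof -
  have "ip H (proj_on F v) u = (\<Sum>x\<in>F. ip H v x * ip H x u)"
    using assms orthonormalD(1)[OF assms(1)] by (simp add: ip_proj_on_left)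
  also have "\<dots> = (\<Sum>x\<in>F. if x = u then ip H v x else 0)"
    using assms orthonormalD(2)[OF assms(1)] by (intro sum.cong) auto
  finally show ?thesis using assms by simp
qed

lemma ip_proj_on_self:
  assumes "orthonormal F" "finite F" "v \<in> vecs H"
  shows "ip H (proj_on F v) v = of_real (\<Sum>u\<in>F. (cmod (ip H v u))\<^sup>2)"
    and "ip H (proj_on F v) (proj_on F v) = of_real (\<Sum>u\<in>F. (cmod (ip H v u))\<^sup>2)"
proof -
  have "ip H (proj_on F v) v = (\<Sum>u\<in>F. ip H v u * cnj (ip H v u))"
    using assms orthonormalD(1)[OF assms(1)] by (simp add: ip_proj_on_left ip_cnj)
  then show *: "ip H (proj_on F v) v = of_real (\<Sum>u\<in>F. (cmod (ip H v u))\<^sup>2)"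
    by (simp add: complex_mult_cnj cmod_power2)
  have "ip H (proj_on F v) (proj_on F v) = (\<Sum>u\<in>F. ip H v u * cnj (ip H (proj_on F v) u))"
    using assms orthonormalD(1)[OF assms(1)]
    by (subst ip_proj_on_left) (simp_all add: ip_cnj proj_on_mem)
  also have "\<dots> = (\<Sum>u\<in>F. ip H v u * cnj (ip H v u))"
    using assms by (intro sum.cong refl) (simp add: ip_proj_on_basis)
  finally show "ip H (proj_on F v) (proj_on F v) = of_real (\<Sum>u\<in>F. (cmod (ip H v u))\<^sup>2)"
    by (simp add: complex_mult_cnj cmod_power2)
qed

lemma Bessel:
  assumes "orthonormal F" "finite F" "v \<in> vecs H"
  shows "(\<Sum>u\<in>F. (cmod (ip H v u))\<^sup>2) \<le> Re (ip H v v)"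
proof -
  let ?p = "proj_on F v" and ?s = "\<Sum>u\<in>F. (cmod (ip H v u))\<^sup>2"
  have p: "?p \<in> vecs H" by (rule proj_on_mem[OF assms(1)])
  have "ip H v ?p = of_real ?s"
    using ip_cnj[OF p assms(3)] ip_proj_on_self(1)[OF assms] by (metis complex_cnj_complex_of_real)
  then have "ip H (v - ?p) (v - ?p) = ip H v v - of_real ?s"
    using p assms(3) ip_proj_on_self[OF assms] by (simp add: ip_linear diff_mem)
  then show ?thesis using ip_nonneg[OF diff_mem[OF assms(3) p]] by simp
qed

end

section \<open>Left and right creation and annihilation\<close>

definition insert_at :: "nat \<Rightarrow> 'a \<Rightarrow> 'a list \<Rightarrow> 'a list" where
  "insert_at j a v = take j v @ a # drop j v"

lemma insert_at_simps [simp]: "insert_at 0 a v = a # v" "insert_at (Suc j) a (b # v) = b # insert_at j a v"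
  by (simp_all add: insert_at_def)

lemma length_insert_at [simp]: "j \<le> length v \<Longrightarrow> length (insert_at j a v) = Suc (length v)"
  by (simp add: insert_at_def)

lemma insert_at_length: "insert_at (length v) a v = v @ [a]"
  by (simp add: insert_at_def)

lemma insert_at_snoc: "j \<le> length v \<Longrightarrow> insert_at j a (v @ [b]) = insert_at j a v @ [b]"
  by (simp add: insert_at_def)

lemma insert_at_insert_at:
  "i \<le> j \<Longrightarrow> j \<le> length v \<Longrightarrow> insert_at i b (insert_at j a v) = insert_at (Suc j) a (insert_at i b v)"
proof (induction i arbitrary: j v)
  case (Suc i)
  then obtain j' c v' where "j = Suc j'" "v = c # v'"
    by (cases j; cases v) auto
  with Suc show ?case by simp
qed simp

text \<open>These operators act on all functions of words, not only on the Fock space, so that identities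
  between them need no domain conditions.\<close>

definition cre :: "complex^'n::finite \<Rightarrow> 'n fock_vec \<Rightarrow> 'n fock_vec" where
  "cre h f = (\<lambda>w. case w of [] \<Rightarrow> 0 | i # v \<Rightarrow> h $ i * f v)"

text \<open>Annihilating the letter at position \<open>j\<close> moves it past \<open>j\<close> letters, each of which costs a factor \<open>q\<close>.\<close>

definition ann :: "real \<Rightarrow> complex^'n::finite \<Rightarrow> 'n fock_vec \<Rightarrow> 'n fock_vec" where
  "ann q h f = (\<lambda>v. \<Sum>j\<le>length v. of_real (q ^ j) * (\<Sum>a\<in>UNIV. cnj (h $ a) * f (insert_at j a v)))"

text \<open>The right versions act at the end of a word, so the weight counts the letters behind
  position \<open>j\<close>.\<close>

definition rcre :: "complex^'n::finite \<Rightarrow> 'n fock_vec \<Rightarrow> 'n fock_vec" where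
  "rcre h f = (\<lambda>w. if w = [] then 0 else h $ last w * f (butlast w))"

definition rann :: "real \<Rightarrow> complex^'n::finite \<Rightarrow> 'n fock_vec \<Rightarrow> 'n fock_vec" where
  "rann q h f = (\<lambda>v. \<Sum>j\<le>length v.
     of_real (q ^ (length v - j)) * (\<Sum>a\<in>UNIV. cnj (h $ a) * f (insert_at j a v)))"

text \<open>The operator \<open>\<Xi>\<^sub>q\<close> on coefficients.\<close>

definition numop :: "real \<Rightarrow> 'n fock_vec \<Rightarrow> 'n fock_vec" where
  "numop q f = (\<lambda>w. of_real (q ^ length w) * f w)"

lemma cre_simps [simp]: "cre h f [] = 0" "cre h f (i # v) = h $ i * f v"
  by (simp_all add: cre_def)

lemma rcre_simps [simp]: "rcre h f [] = 0" "rcre h f (v @ [i]) = h $ i * f v"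
  by (simp_all add: rcre_def)

lemma fock_op_add:
  "cre h (f + g) = cre h f + cre h g" "ann q h (f + g) = ann q h f + ann q h g"
  "rcre h (f + g) = rcre h f + rcre h g" "rann q h (f + g) = rann q h f + rann q h g"
  "numop q (f + g) = numop q f + numop q g"
  by (auto simp: fun_eq_iff cre_def ann_def rcre_def rann_def numop_def
      distrib_left sum.distrib split: list.split)

lemma fock_op_scale:
  "cre h (c *\<^sub>C f) = c *\<^sub>C cre h f" "ann q h (c *\<^sub>C f) = c *\<^sub>C ann q h f"
  "rcre h (c *\<^sub>C f) = c *\<^sub>C rcre h f" "rann q h (c *\<^sub>C f) = c *\<^sub>C rann q h f"
  "numop q (c *\<^sub>C f) = c *\<^sub>C numop q f"
  by (auto simp: fun_eq_iff cre_def ann_def rcre_def rann_def numop_def scaleC_fun_apply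
      scaleC_complex sum_distrib_left ac_simps split: list.split)

section \<open>Commutation relations\<close>

lemma cip_eq: "(\<Sum>a\<in>UNIV. cnj (h $ a) * (g $ a * c)) = cip g h * c"
  by (simp add: cip_def sum_distrib_left sum_distrib_right ac_simps)

text \<open>The \<open>q\<close>-commutation relation: the annihilated letter is either the new first letter or one
  of the others, whose position has moved by one.\<close>

lemma ann_cre: "ann q h (cre g f) = cip g h *\<^sub>C f + of_real q *\<^sub>C cre g (ann q h f)"
proof
  fix v
  show "ann q h (cre g f) v = (cip g h *\<^sub>C f + of_real q *\<^sub>C cre g (ann q h f)) v"
  proof (cases v)
    case Nil
    then show ?thesis by (simp add: ann_def scaleC_fun_apply scaleC_complex cip_eq)
  next
    case (Cons b u)
    then have "ann q h (cre g f) v = cip g h * f v + (\<Sum>j\<le>length u. of_real (q ^ Suc j) *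
        (\<Sum>a\<in>UNIV. cnj (h $ a) * (g $ b * f (insert_at j a u))))"
      by (simp add: ann_def sum.atMost_Suc_shift cip_eq del: sum.atMost_Suc)
    also have "(\<Sum>j\<le>length u. of_real (q ^ Suc j) * (\<Sum>a\<in>UNIV. cnj (h $ a) * (g $ b * f (insert_at j a u))))
        = q * (g $ b * ann q h f u)"
      by (simp add: ann_def sum_distrib_left ac_simps)
    finally show ?thesis using Cons by (simp add: scaleC_fun_apply scaleC_complex)
  qed
qed

text \<open>Only the weight of the first position differs from \<open>ann_cre\<close>: seen from the right, the new letter
  is behind all the others.\<close>

lemma rann_cre: "rann q h (cre g f) = cip g h *\<^sub>C numop q f + cre g (rann q h f)"
proof
  fix v
  show "rann q h (cre g f) v = (cip g h *\<^sub>C numop q f + cre g (rann q h f)) v"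
  proof (cases v)
    case Nil
    then show ?thesis by (simp add: rann_def scaleC_fun_apply scaleC_complex cip_eq numop_def)
  next
    case (Cons b u)
    then have "rann q h (cre g f) v = cip g h * numop q f v + (\<Sum>j\<le>length u. of_real (q ^ (length u - j)) *
        (\<Sum>a\<in>UNIV. cnj (h $ a) * (g $ b * f (insert_at j a u))))"
      by (simp add: rann_def sum.atMost_Suc_shift cip_eq numop_def del: sum.atMost_Suc)
    also have "(\<Sum>j\<le>length u. of_real (q ^ (length u - j)) *
        (\<Sum>a\<in>UNIV. cnj (h $ a) * (g $ b * f (insert_at j a u)))) = g $ b * rann q h f u"
      by (simp add: rann_def sum_distrib_left ac_simps)
    finally show ?thesis using Cons by (simp add: scaleC_fun_apply scaleC_complex)
  qed
qed

text \<open>The new last letter is annihilated at position \<open>length v\<close>; at the other positions the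
  weights do not change, because they count letters from the left.\<close>

lemma ann_rcre: "ann q h (rcre g f) = cip g h *\<^sub>C numop q f + rcre g (ann q h f)"
proof
  fix v
  show "ann q h (rcre g f) v = (cip g h *\<^sub>C numop q f + rcre g (ann q h f)) v"
  proof (cases v rule: rev_cases)
    case Nil
    have "rcre g f [a] = g $ a * f []" for a using rcre_simps(2)[of g f "[]" a] by simp
    then show ?thesis using Nil by (simp add: ann_def scaleC_fun_apply scaleC_complex cip_eq numop_def)
  next
    case (snoc u b)
    have len: "length v = Suc (length u)" using snoc by simp
    have r: "rcre g f (insert_at (Suc (length u)) a v) = g $ a * f v" for a
      using snoc rcre_simps(2)[of g f v a] insert_at_length[of v a] by simp
    have l: "rcre g f (insert_at j a v) = g $ b * f (insert_at j a u)" if "j \<le> length u" for j a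
      using snoc that by (simp add: insert_at_snoc)
    have "ann q h (rcre g f) v = (\<Sum>j\<le>length u. of_real (q ^ j) *
        (\<Sum>a\<in>UNIV. cnj (h $ a) * (g $ b * f (insert_at j a u)))) + cip g h * numop q f v"
      using len by (simp add: ann_def r l cip_eq numop_def)
    also have "(\<Sum>j\<le>length u. of_real (q ^ j) * (\<Sum>a\<in>UNIV. cnj (h $ a) * (g $ b * f (insert_at j a u))))
        = g $ b * ann q h f u"
      by (simp add: ann_def sum_distrib_left ac_simps)
    finally show ?thesis using snoc by (simp add: scaleC_fun_apply scaleC_complex)
  qed
qed

lemma cre_rcre: "cre g (rcre h f) = rcre h (cre g f)"
proof
  fix w :: "'a list"
  show "cre g (rcre h f) w = rcre h (cre g f) w"
  proof (cases w)
    case (Cons i v)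
    then show ?thesis
      by (cases v rule: rev_cases) (simp_all add: rcre_def)
  qed simp
qed

text \<open>The two annihilated letters occupy different positions, which can be chosen in either order.
  Removing one of them shifts the position of the other, and the weights compensate for this
  because one counts from the left and the other from the right.\<close>

lemma ann_rann: "ann q h (rann q g f) = rann q g (ann q h f)"
proof
  fix v :: "'a list"
  let ?n = "length v"
  let ?F = "\<lambda>j a i b. of_real q ^ j * of_real q ^ (Suc ?n - i) * (cnj (h $ a) * cnj (g $ b)) * f (insert_at i b (insert_at j a v))"
  let ?G = "\<lambda>i b j a. of_real q ^ (?n - i) * of_real q ^ j * (cnj (h $ a) * cnj (g $ b)) * f (insert_at j a (insert_at i b v))"
  have "ann q h (rann q g f) v = (\<Sum>j\<le>?n. \<Sum>a\<in>UNIV. \<Sum>i\<le>Suc ?n. \<Sum>b\<in>UNIV. ?F j a i b)"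
    unfolding ann_def rann_def sum_distrib_left
    by (intro sum.cong refl) (simp_all add: ac_simps)
  also have "\<dots> = (\<Sum>j\<le>?n. \<Sum>i\<le>Suc ?n. \<Sum>a\<in>UNIV. \<Sum>b\<in>UNIV. ?F j a i b)"
    by (intro sum.cong refl sum.swap)
  also have "\<dots> = (\<Sum>(j, i)\<in>{..?n} \<times> {..Suc ?n}. \<Sum>a\<in>UNIV. \<Sum>b\<in>UNIV. ?F j a i b)"
    by (rule sum.cartesian_product)
  also have "\<dots> = (\<Sum>(i, j)\<in>{..?n} \<times> {..Suc ?n}. \<Sum>b\<in>UNIV. \<Sum>a\<in>UNIV. ?G i b j a)"
  proof (rule sum.reindex_bij_witness[where j = "\<lambda>(j, i). if j < i then (i - 1, j) else (i, Suc j)"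
          and i = "\<lambda>(i, j). if j \<le> i then (j, Suc i) else (j - 1, i)"])
    fix x assume "x \<in> {..?n} \<times> {..Suc ?n}"
    then obtain j i where x: "x = (j, i)" "j \<le> ?n" "i \<le> Suc ?n" by auto
    show "(case case x of (j, i) \<Rightarrow> if j < i then (i - 1, j) else (i, Suc j) of
           (i, j) \<Rightarrow> \<Sum>b\<in>UNIV. \<Sum>a\<in>UNIV. ?G i b j a)
        = (case x of (j, i) \<Rightarrow> \<Sum>a\<in>UNIV. \<Sum>b\<in>UNIV. ?F j a i b)"
    proof (cases "j < i")
      case True
      then obtain i' where i': "i = Suc i'" "j \<le> i'" by (cases i) auto
      have eq: "?G i' b j a = ?F j a i b" for a b
        using i' x insert_at_insert_at[of j i' v a b] by simp
      have "(\<Sum>b\<in>UNIV. \<Sum>a\<in>UNIV. ?G i' b j a) = (\<Sum>a\<in>UNIV. \<Sum>b\<in>UNIV. ?F j a i b)"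
        unfolding eq by (rule sum.swap)
      then show ?thesis using True i'(1) x(1) by (simp only: prod.case if_True diff_Suc_1)
    next
      case False
      then have "Suc ?n - i = Suc (?n - i)" using x by (simp add: Suc_diff_le)
      then have eq: "?G i b (Suc j) a = ?F j a i b" for a b
        using False x insert_at_insert_at[of i j v b a] by simp
      have "(\<Sum>b\<in>UNIV. \<Sum>a\<in>UNIV. ?G i b (Suc j) a) = (\<Sum>a\<in>UNIV. \<Sum>b\<in>UNIV. ?F j a i b)"
        unfolding eq by (rule sum.swap)
      then show ?thesis using False x(1) by (simp only: prod.case if_False)
    qed
  qed (auto split: if_splits)
  also have "\<dots> = (\<Sum>i\<le>?n. \<Sum>j\<le>Suc ?n. \<Sum>b\<in>UNIV. \<Sum>a\<in>UNIV. ?G i b j a)"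
    by (rule sum.cartesian_product[symmetric])
  also have "\<dots> = (\<Sum>i\<le>?n. \<Sum>b\<in>UNIV. \<Sum>j\<le>Suc ?n. \<Sum>a\<in>UNIV. ?G i b j a)"
    by (intro sum.cong refl sum.swap)
  also have "\<dots> = rann q g (ann q h f) v"
    unfolding ann_def rann_def sum_distrib_left
    by (intro sum.cong refl) (simp_all add: ac_simps)
  finally show "ann q h (rann q g f) v = rann q g (ann q h f) v" .
qed

section \<open>Creation is adjoint to annihilation\<close>

text \<open>The increasing enumeration of the numbers different from \<open>j\<close>.\<close>

definition skip :: "nat \<Rightarrow> nat \<Rightarrow> nat" where
  "skip j m = (if m < j then m else Suc m)"

text \<open>The permutation that sends \<open>0\<close> to \<open>j\<close> and acts as \<open>\<sigma>\<close> on the remaining positions and values.\<close>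

definition lift_perm :: "nat \<Rightarrow> (nat \<Rightarrow> nat) \<Rightarrow> nat \<Rightarrow> nat" where
  "lift_perm j \<sigma> = case_nat j (\<lambda>m. skip j (\<sigma> m))"

lemma lift_perm_simps [simp]:
  "lift_perm j \<sigma> 0 = j" "lift_perm j \<sigma> (Suc m) = skip j (\<sigma> m)"
  by (simp_all add: lift_perm_def)

lemma skip_eq_iff: "skip j a = skip j b \<longleftrightarrow> a = b"
  and skip_less_iff: "skip j a < skip j b \<longleftrightarrow> a < b"
  and skip_neq: "skip j a \<noteq> j"
  and skip_less: "skip j a < j \<longleftrightarrow> a < j"
  by (auto simp: skip_def)

lemma lift_perm_permutes:
  assumes s: "\<sigma> permutes {..<k}" and j: "j \<le> k"
  shows "lift_perm j \<sigma> permutes {..<Suc k}"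
proof (rule bij_imp_permutes)
  have "inj_on (lift_perm j \<sigma>) {..<Suc k}"
  proof (rule inj_onI)
    fix a b assume "lift_perm j \<sigma> a = lift_perm j \<sigma> b"
    then show "a = b"
      using skip_neq[of j] permutes_inj[OF s, THEN injD]
      by (cases a; cases b) (auto simp: skip_eq_iff dest: sym)
  qed
  moreover have "lift_perm j \<sigma> ` {..<Suc k} \<subseteq> {..<Suc k}"
  proof
    fix x assume "x \<in> lift_perm j \<sigma> ` {..<Suc k}"
    then obtain a where a: "x = lift_perm j \<sigma> a" "a < Suc k" by auto
    then show "x \<in> {..<Suc k}"
      using j permutes_in_image[OF s] by (cases a) (auto simp: skip_def)
  qed
  ultimately show "bij_betw (lift_perm j \<sigma>) {..<Suc k} {..<Suc k}"
    by (simp add: bij_betw_def endo_inj_surj)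
next
  fix x assume "x \<notin> {..<Suc k}"
  then obtain m where "x = Suc m" "k \<le> m" by (cases x) auto
  then show "lift_perm j \<sigma> x = x"
    using j permutes_not_in[OF s, of m] by (simp add: skip_def)
qed

text \<open>Surjectivity is a count: \<open>(k + 1) k! = (k + 1)!\<close>.\<close>

lemma bij_betw_lift_perm:
  "bij_betw (\<lambda>(j, \<sigma>). lift_perm j \<sigma>) ({..k} \<times> {\<sigma>. \<sigma> permutes {..<k}}) {\<sigma>. \<sigma> permutes {..<Suc k}}"
proof -
  have inj: "inj_on (\<lambda>(j, \<sigma>). lift_perm j \<sigma>) ({..k} \<times> {\<sigma>. \<sigma> permutes {..<k}})"
  proof (rule inj_onI, clarify)
    fix j j' \<sigma> \<sigma>' assume eq: "lift_perm j \<sigma> = lift_perm j' \<sigma>'"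
    have "j = j'" using fun_cong[OF eq, of 0] by simp
    moreover have "\<sigma> m = \<sigma>' m" for m
      using fun_cong[OF eq, of "Suc m"] \<open>j = j'\<close> by (simp add: skip_eq_iff)
    ultimately show "j = j' \<and> \<sigma> = \<sigma>'" by auto
  qed
  have "(\<lambda>(j, \<sigma>). lift_perm j \<sigma>) ` ({..k} \<times> {\<sigma>. \<sigma> permutes {..<k}}) = {\<sigma>. \<sigma> permutes {..<Suc k}}"
  proof (rule card_subset_eq)
    show "(\<lambda>(j, \<sigma>). lift_perm j \<sigma>) ` ({..k} \<times> {\<sigma>. \<sigma> permutes {..<k}}) \<subseteq> {\<sigma>. \<sigma> permutes {..<Suc k}}"
      using lift_perm_permutes by auto
    show "card ((\<lambda>(j, \<sigma>). lift_perm j \<sigma>) ` ({..k} \<times> {\<sigma>. \<sigma> permutes {..<k}}))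
        = card {\<sigma>. \<sigma> permutes {..<Suc k}}"
      by (simp add: card_image[OF inj] card_cartesian_product card_permutations[OF card_lessThan])
  qed (simp add: finite_permutations)
  with inj show ?thesis by (simp add: bij_betw_def)
qed

text \<open>The value \<open>j\<close> at position \<open>0\<close> precedes all others and forms an inversion with the \<open>j\<close> smaller values.\<close>

lemma inversions_lift_perm:
  assumes s: "\<sigma> permutes {..<k}" and j: "j \<le> k"
  shows "inversions (Suc k) (lift_perm j \<sigma>) = j + inversions k \<sigma>"
proof -
  let ?A = "{b. b < k \<and> \<sigma> b < j}" and ?B = "{(i, j). i < j \<and> j < k \<and> \<sigma> j < \<sigma> i}"
  have set: "{(a, b). a < b \<and> b < Suc k \<and> lift_perm j \<sigma> b < lift_perm j \<sigma> a}
      = (\<lambda>b. (0, Suc b)) ` ?A \<union> map_prod Suc Suc ` ?B" (is "?L = ?R")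
  proof (rule set_eqI)
    fix x :: "nat \<times> nat"
    obtain a b where x: "x = (a, b)" by (cases x)
    show "x \<in> ?L \<longleftrightarrow> x \<in> ?R"
      unfolding x by (cases a; cases b) (auto simp: skip_less skip_less_iff image_iff)
  qed
  have fin: "finite ?A" "finite ?B"
    by (rule finite_subset[of _ "{..<k}"], auto)
      (rule finite_subset[of _ "{..<k} \<times> {..<k}"], auto)
  have "\<sigma> ` ?A = {..<j}"
  proof
    show "{..<j} \<subseteq> \<sigma> ` ?A"
    proof
      fix y assume y: "y \<in> {..<j}"
      then have "inv \<sigma> y < k" using permutes_in_image[OF permutes_inv[OF s], of y] j by auto
      with y show "y \<in> \<sigma> ` ?A" using permutes_inverses(1)[OF s, of y] by (intro image_eqI[of _ _ "inv \<sigma> y"]) auto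
    qed
  qed auto
  then have "card ?A = j"
    using card_image[of \<sigma> ?A] permutes_inj_on[OF s] by (metis card_lessThan)
  moreover have "card ((\<lambda>b. (0 :: nat, Suc b)) ` ?A) = card ?A" "card (map_prod Suc Suc ` ?B) = card ?B"
    by (auto intro!: card_image simp: inj_on_def)
  moreover have "(\<lambda>b. (0, Suc b)) ` ?A \<inter> map_prod Suc Suc ` ?B = {}" by auto
  ultimately show ?thesis
    using fin unfolding inversions_def set by (subst card_Un_disjoint) auto
qed

lemma permute_list_insert_at:
  assumes s: "\<sigma> permutes {..<length v}" and j: "j \<le> length v"
  shows "permute_list (lift_perm j \<sigma>) (insert_at j a v) = a # permute_list \<sigma> v"
proof (rule nth_equalityI)
  fix i assume "i < length (permute_list (lift_perm j \<sigma>) (insert_at j a v))"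
  then have i: "i < Suc (length v)" using j by simp
  have skip: "insert_at j a v ! skip j m = v ! m" if "m < length v" for m
    using j that by (auto simp: insert_at_def skip_def nth_append min_def)
  show "permute_list (lift_perm j \<sigma>) (insert_at j a v) ! i = (a # permute_list \<sigma> v) ! i"
  proof (cases i)
    case 0
    then show ?thesis using i j by (simp add: permute_list_def insert_at_def nth_append del: upt_Suc)
  next
    case (Suc m)
    then have "\<sigma> m < length v" using i permutes_in_image[OF s, of m] by auto
    then show ?thesis using i j Suc by (simp add: permute_list_def skip del: upt_Suc)
  qed
qed (use j in simp)

lemma sum_words_insert_at:
  assumes "j \<le> k"
  shows "(\<Sum>w :: 'n::finite list | length w = Suc k. F w) = (\<Sum>a\<in>UNIV. \<Sum>v | length v = k. F (insert_at j a v))"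
proof -
  have "(\<Sum>w :: 'n list | length w = Suc k. F w) = (\<Sum>(a, v)\<in>UNIV \<times> {v. length v = k}. F (insert_at j a v))"
  proof (rule sum.reindex_bij_witness[where i = "\<lambda>(a, v). insert_at j a v" and
          j = "\<lambda>w. (w ! j, take j w @ drop (Suc j) w)"])
    fix w :: "'n list" assume "w \<in> {w. length w = Suc k}"
    then show "(case (w ! j, take j w @ drop (Suc j) w) of (a, v) \<Rightarrow> insert_at j a v) = w"
      using assms by (simp add: insert_at_def min_def id_take_nth_drop[symmetric])
    then show "(case (w ! j, take j w @ drop (Suc j) w) of (a, v) \<Rightarrow> F (insert_at j a v)) = F w" by simp
  qed (use assms in \<open>auto simp: insert_at_def nth_append min_def\<close>)
  then show ?thesis by (simp add: sum.cartesian_product)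
qed

text \<open>The permutations are sorted by the image \<open>j\<close> of \<open>0\<close>. It pairs the created first letter
  with letter \<open>j\<close> of \<open>g\<close>, with the weight \<open>q ^ j\<close> of the corresponding term of the annihilation operator.\<close>

lemma level_ip_cre: "level_ip q (Suc k) (cre h f) g = level_ip q k f (ann q h g)"
proof -
  let ?S = "{\<sigma>. \<sigma> permutes {..<k}}" and ?W = "{v :: 'a list. length v = k}"
  have inner: "(\<Sum>w | length w = Suc k. cre h f (permute_list (lift_perm j \<sigma>) w) * cnj (g w))
      = (\<Sum>v\<in>?W. \<Sum>a\<in>UNIV. h $ a * (f (permute_list \<sigma> v) * cnj (g (insert_at j a v))))"
    if "j \<le> k" "\<sigma> \<in> ?S" for j \<sigma>
    unfolding sum_words_insert_at[OF that(1)] using that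
    by (subst sum.swap, intro sum.cong refl) (simp add: permute_list_insert_at)
  have "level_ip q (Suc k) (cre h f) g
      = (\<Sum>(j, \<sigma>)\<in>{..k} \<times> ?S. of_real (q ^ inversions (Suc k) (lift_perm j \<sigma>)) *
          (\<Sum>w | length w = Suc k. cre h f (permute_list (lift_perm j \<sigma>) w) * cnj (g w)))"
    unfolding level_ip_permute_list
    by (subst sum.reindex_bij_betw[OF bij_betw_lift_perm, symmetric]) (simp add: case_prod_unfold)
  also have "\<dots> = (\<Sum>(j, \<sigma>)\<in>{..k} \<times> ?S. of_real (q ^ j * q ^ inversions k \<sigma>) *
      (\<Sum>v\<in>?W. \<Sum>a\<in>UNIV. h $ a * (f (permute_list \<sigma> v) * cnj (g (insert_at j a v)))))"
    by (intro sum.cong refl) (auto simp: inversions_lift_perm inner power_add)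
  also have "\<dots> = (\<Sum>j\<le>k. \<Sum>\<sigma>\<in>?S. of_real (q ^ j * q ^ inversions k \<sigma>) *
      (\<Sum>v\<in>?W. \<Sum>a\<in>UNIV. h $ a * (f (permute_list \<sigma> v) * cnj (g (insert_at j a v)))))"
    by (simp only: sum.cartesian_product)
  also have "\<dots> = (\<Sum>\<sigma>\<in>?S. \<Sum>j\<le>k. \<Sum>v\<in>?W. of_real (q ^ j * q ^ inversions k \<sigma>) *
      (\<Sum>a\<in>UNIV. h $ a * (f (permute_list \<sigma> v) * cnj (g (insert_at j a v)))))"
    by (subst sum.swap) (simp only: sum_distrib_left)
  also have "\<dots> = (\<Sum>\<sigma>\<in>?S. \<Sum>v\<in>?W. \<Sum>j\<le>k. of_real (q ^ j * q ^ inversions k \<sigma>) *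
      (\<Sum>a\<in>UNIV. h $ a * (f (permute_list \<sigma> v) * cnj (g (insert_at j a v)))))"
    by (intro sum.cong refl sum.swap)
  also have "\<dots> = level_ip q k f (ann q h g)"
    unfolding level_ip_permute_list sum_distrib_left
    by (intro sum.cong refl) (simp add: ann_def sum_distrib_left ac_simps)
  finally show ?thesis .
qed

lemma level_ip_0_cre: "level_ip q 0 f (cre h g) = 0"
proof -
  have "{w :: 'a list. length w = 0} = {[]}" by auto
  then show ?thesis by (simp add: level_ip_permute_list)
qed

section \<open>Orthonormal bases\<close>

locale inner_space = semi_inner_space +
  assumes ip_definite: "v \<in> vecs H \<Longrightarrow> ip H v v = 0 \<Longrightarrow> v = 0"
begin

lemma eq_if_ip_eq:
  assumes "x \<in> vecs H" "y \<in> vecs H" "\<And>u. u \<in> vecs H \<Longrightarrow> ip H u x = ip H u y"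
  shows "x = y"
proof -
  have "ip H (x - y) (x - y) = 0"
    using assms by (simp add: ip_diff_right diff_mem)
  then show ?thesis using ip_definite[OF diff_mem[OF assms(1,2)]] by simp
qed

lemma is_onb_iff:
  "is_onb H E \<longleftrightarrow> orthonormal E \<and> (\<forall>v\<in>vecs H. (\<forall>u\<in>E. ip H v u = 0) \<longrightarrow> v = 0)"
  unfolding is_onb_def orthonormal_def by auto

lemma normalize:
  assumes "v \<in> vecs H" "v \<noteq> 0"
  obtains c where "c *\<^sub>C v \<in> vecs H" "ip H (c *\<^sub>C v) (c *\<^sub>C v) = 1"
    "c = of_real (1 / hnorm H v)" "hnorm H v > 0"
proof -
  have "Re (ip H v v) \<noteq> 0" using ip_definite[OF assms(1)] ip_self[OF assms(1)] assms(2) by auto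
  then have pos: "hnorm H v > 0" using ip_nonneg[OF assms(1)] by (simp add: hnorm_def)
  define c where "c = complex_of_real (1 / hnorm H v)"
  have m: "c *\<^sub>C v \<in> vecs H" using assms scale_mem by blast
  have "hnorm H (c *\<^sub>C v) = 1"
    using pos by (simp add: hnorm_scale[OF assms(1)] c_def norm_divide)
  then have "ip H (c *\<^sub>C v) (c *\<^sub>C v) = 1"
    using ip_self[OF m] hnorm_sq[OF m] by simp
  then show ?thesis using that[of c] m pos c_def by simp
qed

lemma orthonormal_insert:
  assumes "orthonormal E" "u \<in> vecs H" "ip H u u = 1" "\<And>e. e \<in> E \<Longrightarrow> ip H u e = 0"
  shows "orthonormal (insert u E)" "u \<notin> E"
proof -
  show "u \<notin> E" using assms(3,4) by force
  have "ip H e u = 0" if "e \<in> E" for e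
    using ip_cnj[OF assms(2) orthonormalD(1)[OF assms(1) that]] assms(4)[OF that] by simp
  then show "orthonormal (insert u E)"
    using assms \<open>u \<notin> E\<close> unfolding orthonormal_def by auto
qed

text \<open>An orthonormal basis is a maximal orthonormal set, so Zorn's lemma provides one.\<close>

lemma ex_onb: "\<exists>E. is_onb H E"
proof -
  have "\<exists>M\<in>Collect orthonormal. \<forall>X\<in>Collect orthonormal. M \<subseteq> X \<longrightarrow> X = M"
  proof (rule subset_Zorn')
    fix C assume C: "subset.chain (Collect orthonormal) C"
    show "\<Union>C \<in> Collect orthonormal"
      unfolding orthonormal_def mem_Collect_eq
    proof (intro conjI ballI)
      show "\<Union>C \<subseteq> vecs H"
        using C unfolding subset.chain_def orthonormal_def by blast
      fix u v assume "u \<in> \<Union>C" "v \<in> \<Union>C"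
      then obtain A B where AB: "u \<in> A" "v \<in> B" "A \<in> C" "B \<in> C" by blast
      then have "A \<subseteq> B \<or> B \<subseteq> A" using subset.chain_total[OF C] by blast
      then obtain D where "u \<in> D" "v \<in> D" "D \<in> C" using AB by blast
      moreover from this have "orthonormal D" using C unfolding subset.chain_def by blast
      ultimately show "ip H u v = (if u = v then 1 else 0)" using orthonormalD(2) by blast
    qed
  qed
  then obtain M where M: "orthonormal M" and max: "\<And>X. orthonormal X \<Longrightarrow> M \<subseteq> X \<Longrightarrow> X = M"
    by auto
  have "v = 0" if v: "v \<in> vecs H" and perp: "\<forall>u\<in>M. ip H v u = 0" for v
  proof (rule ccontr)
    assume "v \<noteq> 0"
    then obtain c where c: "c *\<^sub>C v \<in> vecs H" "ip H (c *\<^sub>C v) (c *\<^sub>C v) = 1"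
      using normalize[OF v] by metis
    have "ip H (c *\<^sub>C v) e = 0" if "e \<in> M" for e
      using perp that v orthonormalD(1)[OF M that] by (simp add: ip_scale_left)
    from orthonormal_insert[OF M c this] max show False by blast
  qed
  with M show ?thesis unfolding is_onb_iff by blast
qed

lemma some_onb: "is_onb H (some_onb H)"
  unfolding some_onb_def by (rule someI_ex[OF ex_onb])

section \<open>Adjoint operators\<close>

text \<open>The operator \<open>adjoint_op\<close> is a definite description, which is meaningful once an adjoint is
  known to exist. A pair carries the adjoint along explicitly.\<close>

definition adjoint_pair :: "('a \<Rightarrow> 'a) \<Rightarrow> ('a \<Rightarrow> 'a) \<Rightarrow> bool" where
  "adjoint_pair A B \<longleftrightarrow> A \<in> bounded_ops H \<and> B \<in> bounded_ops H \<and>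
     (\<forall>u\<in>vecs H. \<forall>v\<in>vecs H. ip H (A u) v = ip H u (B v))"

lemma adjoint_pairD:
  assumes "adjoint_pair A B"
  shows "A \<in> bounded_ops H" "B \<in> bounded_ops H"
    "u \<in> vecs H \<Longrightarrow> v \<in> vecs H \<Longrightarrow> ip H (A u) v = ip H u (B v)"
  using assms unfolding adjoint_pair_def by blast+

lemma adjoint_op_eq:
  assumes "adjoint_pair A B"
  shows "adjoint_op H A = B"
  unfolding adjoint_op_def
proof (rule the_equality)
  show "B \<in> bounded_ops H \<and> (\<forall>u\<in>vecs H. \<forall>v\<in>vecs H. ip H (A u) v = ip H u (B v))"
    using assms unfolding adjoint_pair_def by blast
  fix S assume S: "S \<in> bounded_ops H \<and> (\<forall>u\<in>vecs H. \<forall>v\<in>vecs H. ip H (A u) v = ip H u (S v))"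
  note B = adjoint_pairD[OF assms]
  show "S = B"
  proof
    fix v show "S v = B v"
    proof (cases "v \<in> vecs H")
      case True
      then show ?thesis
        using S B(3) bounded_opsD(1)[OF B(2)] bounded_opsD(1)[of S]
        by (intro eq_if_ip_eq) auto
    next
      case False
      then show ?thesis using S bounded_opsD(2)[OF B(2)] bounded_opsD(2)[of S] by simp
    qed
  qed
qed

lemma adjoint_pair_sym:
  assumes "adjoint_pair A B"
  shows "adjoint_pair B A"
proof -
  note AB = adjoint_pairD[OF assms]
  have "ip H (B u) v = ip H u (A v)" if "u \<in> vecs H" "v \<in> vecs H" for u v
    using AB(3)[OF that(2,1)] ip_cnj[OF that(2), of "B u"] ip_cnj[of "A v" u] that
      bounded_opsD(1)[OF AB(1)] bounded_opsD(1)[OF AB(2)] by simp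
  then show ?thesis using AB(1,2) unfolding adjoint_pair_def by blast
qed

lemma adjoint_pair_id: "adjoint_pair (id_op H) (id_op H)"
  unfolding adjoint_pair_def by (intro conjI bounded_ops_id) (simp add: id_op_def)

lemma adjoint_pair_comp:
  assumes A: "adjoint_pair A A'" and B: "adjoint_pair B B'"
  shows "adjoint_pair (A \<circ> B) (B' \<circ> A')"
  unfolding adjoint_pair_def
proof (intro conjI ballI)
  fix u v assume "u \<in> vecs H" "v \<in> vecs H"
  then show "ip H ((A \<circ> B) u) v = ip H u ((B' \<circ> A') v)"
    using adjoint_pairD(3)[OF A, of "B u" v] adjoint_pairD(3)[OF B, of u "A' v"]
      bounded_opsD(1)[OF adjoint_pairD(1)[OF B]] bounded_opsD(1)[OF adjoint_pairD(2)[OF A]] by simp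
qed (use A B adjoint_pairD(1,2) bounded_ops_comp in blast)+

lemma adjoint_pair_add:
  assumes A: "adjoint_pair A A'" and B: "adjoint_pair B B'"
  shows "adjoint_pair (A + B) (A' + B')"
  unfolding adjoint_pair_def
proof (intro conjI ballI)
  fix u v assume "u \<in> vecs H" "v \<in> vecs H"
  then show "ip H ((A + B) u) v = ip H u ((A' + B') v)"
    using adjoint_pairD(3)[OF A, of u v] adjoint_pairD(3)[OF B, of u v]
      bounded_opsD(1)[OF adjoint_pairD(1)[OF A]] bounded_opsD(1)[OF adjoint_pairD(2)[OF A]]
      bounded_opsD(1)[OF adjoint_pairD(1)[OF B]] bounded_opsD(1)[OF adjoint_pairD(2)[OF B]]
    by (simp add: ip_add_left ip_add_right)
qed (use A B adjoint_pairD(1,2) bounded_ops_add in blast)+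

lemma adjoint_pair_scale:
  assumes A: "adjoint_pair A A'"
  shows "adjoint_pair (c *\<^sub>C A) (cnj c *\<^sub>C A')"
  unfolding adjoint_pair_def
proof (intro conjI ballI)
  fix u v assume "u \<in> vecs H" "v \<in> vecs H"
  then show "ip H ((c *\<^sub>C A) u) v = ip H u ((cnj c *\<^sub>C A') v)"
    using adjoint_pairD(3)[OF A, of u v]
      bounded_opsD(1)[OF adjoint_pairD(1)[OF A]] bounded_opsD(1)[OF adjoint_pairD(2)[OF A]]
    by (simp add: ip_scale_left ip_scale_right scaleC_fun_apply)
qed (use A adjoint_pairD(1,2) bounded_ops_scale in blast)+

lemma adjoint_pair_sum:
  "(\<And>i. i \<in> I \<Longrightarrow> adjoint_pair (A i) (B i)) \<Longrightarrow> adjoint_pair (sum A I) (sum B I)"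
proof (induction I rule: infinite_finite_induct)
  case (insert i I)
  then show ?case
    unfolding sum.insert[OF insert.hyps(1,2)] by (intro adjoint_pair_add) simp_all
qed (use adjoint_pair_scale[OF adjoint_pair_id, of 0] in \<open>simp_all add: scaleC_zero_left\<close>)

end

section \<open>Hilbert--Schmidt operators\<close>

definition rank_one :: "('v::complex_vec) hilbert \<Rightarrow> 'v \<Rightarrow> 'v \<Rightarrow> 'v \<Rightarrow> 'v" where
  "rank_one H \<xi> \<eta> = (\<lambda>v. if v \<in> vecs H then ip H v \<xi> *\<^sub>C \<eta> else 0)"

text \<open>Completeness enters through the representation of bounded functionals.\<close>

locale hilbert_space = inner_space +
  assumes riesz: "\<lbrakk>\<And>u v. u \<in> vecs H \<Longrightarrow> v \<in> vecs H \<Longrightarrow> \<phi> (u + v) = \<phi> u + \<phi> v;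
      \<And>c v. v \<in> vecs H \<Longrightarrow> \<phi> (c *\<^sub>C v) = c * \<phi> v;
      \<And>v. v \<in> vecs H \<Longrightarrow> cmod (\<phi> v) \<le> K * hnorm H v\<rbrakk>
    \<Longrightarrow> \<exists>\<zeta>\<in>vecs H. \<forall>v\<in>vecs H. \<phi> v = ip H v \<zeta>"
begin

text \<open>By Bessel's inequality the series converges and defines a bounded functional of \<open>v\<close>. The vector \<open>\<zeta>\<close>
  that represents it satisfies \<open>\<langle>u, \<zeta>\<rangle> = \<langle>u, \<xi>\<rangle>\<close> for all \<open>u \<in> E\<close>, so \<open>\<zeta> = \<xi>\<close> by maximality of \<open>E\<close>.\<close>

lemma Parseval:
  assumes E: "is_onb H E" and v: "v \<in> vecs H" and \<xi>: "\<xi> \<in> vecs H"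
  shows "((\<lambda>u. ip H v u * ip H u \<xi>) has_sum ip H v \<xi>) E"
proof -
  have on: "orthonormal E" using E by (simp add: is_onb_iff)
  note Ev = orthonormalD(1)[OF on]
  have on_sub: "orthonormal F" if "F \<subseteq> E" for F
    using on that unfolding orthonormal_def by blast
  have bess: "(\<Sum>u\<in>F. (cmod (ip H x u))\<^sup>2) \<le> (hnorm H x)\<^sup>2"
    if "F \<subseteq> E" "finite F" "x \<in> vecs H" for F x
    using Bessel[OF on_sub[OF that(1)] that(2,3)] that(3) by (simp add: hnorm_sq)
  have summ: "(\<lambda>u. ip H x u * ip H u \<xi>) summable_on E" if x: "x \<in> vecs H" for x
  proof (rule abs_summable_summable)
    show "(\<lambda>u. norm (ip H x u * ip H u \<xi>)) summable_on E"
    proof (rule nonneg_bdd_above_summable_on[OF norm_ge_zero], rule bdd_aboveI2)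
      fix F assume "F \<in> {F. F \<subseteq> E \<and> finite F}"
      then have F: "F \<subseteq> E" "finite F" by auto
      have "(\<Sum>u\<in>F. norm (ip H x u * ip H u \<xi>)) \<le> (\<Sum>u\<in>F. (cmod (ip H x u))\<^sup>2 + (cmod (ip H \<xi> u))\<^sup>2)"
      proof (rule sum_mono)
        fix u assume "u \<in> F"
        then have eq: "cmod (ip H u \<xi>) = cmod (ip H \<xi> u)"
          using ip_cnj[OF \<xi>, of u] Ev F(1) by (metis complex_mod_cnj subsetD)
        with sum_squares_bound[of "cmod (ip H x u)" "cmod (ip H \<xi> u)"]
        show "norm (ip H x u * ip H u \<xi>) \<le> (cmod (ip H x u))\<^sup>2 + (cmod (ip H \<xi> u))\<^sup>2"
          using mult_nonneg_nonneg[OF norm_ge_zero norm_ge_zero, of "ip H x u" "ip H \<xi> u"]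
          unfolding norm_mult eq by linarith
      qed
      also have "\<dots> \<le> (hnorm H x)\<^sup>2 + (hnorm H \<xi>)\<^sup>2"
        unfolding sum.distrib by (intro add_mono bess F x \<xi>)
      finally show "(\<Sum>u\<in>F. norm (ip H x u * ip H u \<xi>)) \<le> (hnorm H x)\<^sup>2 + (hnorm H \<xi>)\<^sup>2" .
    qed
  qed
  define \<phi> where "\<phi> x = (\<Sum>\<^sub>\<infinity>u\<in>E. ip H x u * ip H u \<xi>)" for x
  have hs: "((\<lambda>u. ip H x u * ip H u \<xi>) has_sum \<phi> x) E" if "x \<in> vecs H" for x
    unfolding \<phi>_def using summ[OF that] by simp
  have "\<exists>\<zeta>\<in>vecs H. \<forall>x\<in>vecs H. \<phi> x = ip H x \<zeta>"
  proof (rule riesz[where K = "hnorm H \<xi>"])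
    fix x y assume xy: "x \<in> vecs H" "y \<in> vecs H"
    have "((\<lambda>u. ip H (x + y) u * ip H u \<xi>) has_sum (\<phi> x + \<phi> y)) E"
      using has_sum_add[OF hs[OF xy(1)] hs[OF xy(2)]]
      by (rule has_sum_cong[THEN iffD1, rotated]) (use Ev xy in \<open>simp add: ip_add_left algebra_simps\<close>)
    then show "\<phi> (x + y) = \<phi> x + \<phi> y" unfolding \<phi>_def[of "x + y"] by (rule infsumI)
  next
    fix c x assume x: "x \<in> vecs H"
    have "((\<lambda>u. ip H (c *\<^sub>C x) u * ip H u \<xi>) has_sum (c * \<phi> x)) E"
      using has_sum_cmult_right[OF hs[OF x], of c]
      by (rule has_sum_cong[THEN iffD1, rotated]) (use Ev x in \<open>simp add: ip_scale_left algebra_simps\<close>)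
    then show "\<phi> (c *\<^sub>C x) = c * \<phi> x" unfolding \<phi>_def[of "c *\<^sub>C x"] by (rule infsumI)
  next
    fix x assume x: "x \<in> vecs H"
    have "cmod (\<phi> x) \<le> hnorm H x * hnorm H \<xi>"
    proof (rule Lim_norm_ubound)
      show "(sum (\<lambda>u. ip H x u * ip H u \<xi>) \<longlongrightarrow> \<phi> x) (finite_subsets_at_top E)"
        using hs[OF x] by (simp add: has_sum_def)
      show "\<forall>\<^sub>F F in finite_subsets_at_top E. cmod (\<Sum>u\<in>F. ip H x u * ip H u \<xi>) \<le> hnorm H x * hnorm H \<xi>"
      proof (rule eventually_finite_subsets_at_top_weakI)
        fix F assume F: "finite F" "F \<subseteq> E"
        have p: "proj_on F x \<in> vecs H" by (rule proj_on_mem[OF on_sub[OF F(2)]])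
        have "hnorm H (proj_on F x) \<le> hnorm H x"
        proof (rule power2_le_imp_le)
          show "(hnorm H (proj_on F x))\<^sup>2 \<le> (hnorm H x)\<^sup>2"
            using ip_proj_on_self(2)[OF on_sub[OF F(2)] F(1) x] bess[OF F(2,1) x] by (simp add: hnorm_sq p)
        qed (simp add: hnorm_nonneg x)
        moreover have "(\<Sum>u\<in>F. ip H x u * ip H u \<xi>) = ip H (proj_on F x) \<xi>"
          using ip_proj_on_left[OF on_sub[OF F(2)] \<xi>] by simp
        ultimately show "cmod (\<Sum>u\<in>F. ip H x u * ip H u \<xi>) \<le> hnorm H x * hnorm H \<xi>"
          using order_trans[OF Cauchy_Schwarz_hnorm[OF p \<xi>] mult_right_mono] hnorm_nonneg[OF \<xi>]
          by simp
      qed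
    qed simp
    then show "cmod (\<phi> x) \<le> hnorm H \<xi> * hnorm H x" by (simp add: mult.commute)
  qed
  then obtain \<zeta> where \<zeta>: "\<zeta> \<in> vecs H" "\<And>x. x \<in> vecs H \<Longrightarrow> \<phi> x = ip H x \<zeta>" by blast
  have "ip H (\<zeta> - \<xi>) u = 0" if u: "u \<in> E" for u
  proof -
    have "((\<lambda>u'. ip H u u' * ip H u' \<xi>) has_sum (\<Sum>u'\<in>{u}. ip H u u' * ip H u' \<xi>)) E"
      using u orthonormalD(2)[OF on]
      by (intro has_sum_finite_neutralI[of "{u}"]) auto
    then have "\<phi> u = ip H u \<xi>"
      unfolding \<phi>_def using u orthonormalD(2)[OF on] by (simp add: infsumI)
    then have "ip H u (\<zeta> - \<xi>) = 0" using \<zeta> \<xi> Ev[OF u] by (simp add: ip_diff_right)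
    then show ?thesis using ip_cnj[of u "\<zeta> - \<xi>"] Ev[OF u] \<zeta>(1) \<xi> by (simp add: diff_mem)
  qed
  then have "\<zeta> - \<xi> = 0" using E diff_mem[OF \<zeta>(1) \<xi>] unfolding is_onb_iff by blast
  then have "\<zeta> = \<xi>" by simp
  then show ?thesis using hs[OF v] \<zeta>(2)[OF v] by simp
qed

abbreviation "onb \<equiv> some_onb H"

lemma orthonormal_onb: "orthonormal onb"
  using some_onb by (simp add: is_onb_iff)

lemma orthonormal_subset: "orthonormal E \<Longrightarrow> F \<subseteq> E \<Longrightarrow> orthonormal F"
  unfolding orthonormal_def by blast

lemma onb_mem: "u \<in> onb \<Longrightarrow> u \<in> vecs H"
  by (rule orthonormalD(1)[OF orthonormal_onb])

lemma hilbert_schmidt_bounded: "hilbert_schmidt H T \<Longrightarrow> T \<in> bounded_ops H"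
  by (simp add: hilbert_schmidt_def)

lemma hnorm_HS:
  assumes "hilbert_schmidt H T"
  shows "hnorm (HS H) T = sqrt (\<Sum>\<^sub>\<infinity>u\<in>onb. (hnorm H (T u))\<^sup>2)"
proof -
  have s: "(\<lambda>u. (hnorm H (T u))\<^sup>2) summable_on onb" and b: "T \<in> bounded_ops H"
    using assms by (auto simp: hilbert_schmidt_def)
  have re: "((\<lambda>u. complex_of_real ((hnorm H (T u))\<^sup>2)) has_sum of_real (\<Sum>\<^sub>\<infinity>u\<in>onb. (hnorm H (T u))\<^sup>2)) onb"
    unfolding has_sum_of_real_iff using s by (rule has_sum_infsum)
  have "((\<lambda>u. ip H (T u) (T u)) has_sum of_real (\<Sum>\<^sub>\<infinity>u\<in>onb. (hnorm H (T u))\<^sup>2)) onb"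
    using re
  proof (rule has_sum_cong[THEN iffD1, rotated])
    fix u assume "u \<in> onb"
    then have "T u \<in> vecs H" by (rule bounded_opsD(1)[OF b onb_mem])
    then show "of_real ((hnorm H (T u))\<^sup>2) = ip H (T u) (T u)"
      by (subst ip_self) (simp_all add: hnorm_sq)
  qed
  then have "ip (HS H) T T = of_real (\<Sum>\<^sub>\<infinity>u\<in>onb. (hnorm H (T u))\<^sup>2)"
    by (simp add: HS_def infsumI)
  then show ?thesis by (simp add: hnorm_def[of "HS H"])
qed

lemma hnorm_HS_sq:
  assumes "hilbert_schmidt H T"
  shows "(hnorm (HS H) T)\<^sup>2 = (\<Sum>\<^sub>\<infinity>u\<in>onb. (hnorm H (T u))\<^sup>2)" "0 \<le> hnorm (HS H) T"
  unfolding hnorm_HS[OF assms] by (simp_all add: infsum_nonneg)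

lemma HS_finite_sum_le:
  assumes "hilbert_schmidt H T" "finite F" "F \<subseteq> onb"
  shows "(\<Sum>u\<in>F. (hnorm H (T u))\<^sup>2) \<le> (hnorm (HS H) T)\<^sup>2"
  unfolding hnorm_HS_sq(1)[OF assms(1)]
  using assms by (intro finite_sum_le_infsum) (auto simp: hilbert_schmidt_def)

lemma hilbert_schmidtI:
  assumes "T \<in> bounded_ops H"
    and "\<And>F. finite F \<Longrightarrow> F \<subseteq> onb \<Longrightarrow> (\<Sum>u\<in>F. (hnorm H (T u))\<^sup>2) \<le> M\<^sup>2" and "0 \<le> M"
  shows "hilbert_schmidt H T" "hnorm (HS H) T \<le> M"
proof -
  have s: "(\<lambda>u. (hnorm H (T u))\<^sup>2) summable_on onb"
    using assms(2) by (intro nonneg_bdd_above_summable_on bdd_aboveI2) auto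
  then show hs: "hilbert_schmidt H T" using assms(1) by (simp add: hilbert_schmidt_def)
  have "(hnorm (HS H) T)\<^sup>2 \<le> M\<^sup>2"
    unfolding hnorm_HS_sq(1)[OF hs] using s assms(2) by (rule infsum_le_finite_sums)
  then show "hnorm (HS H) T \<le> M" using assms(3) by (rule power2_le_imp_le)
qed

lemma vecs_HS: "T \<in> vecs (HS H) \<longleftrightarrow> hilbert_schmidt H T"
  by (simp add: HS_def)

lemma quasi_normed_HS: "quasi_normed_space (HS H)"
proof
  show "0 \<in> vecs (HS H)"
    unfolding vecs_HS by (rule hilbert_schmidtI(1)[where M = 0])
      (use bounded_ops_0 zero_mem in \<open>simp_all add: hnorm_def ip_zero_left\<close>)
next
  fix S T assume "S \<in> vecs (HS H)" "T \<in> vecs (HS H)"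
  then have S: "hilbert_schmidt H S" and T: "hilbert_schmidt H T" by (simp_all add: vecs_HS)
  let ?s = "hnorm (HS H) S" and ?t = "hnorm (HS H) T"
  have nn: "0 \<le> ?s" "0 \<le> ?t" using hnorm_HS_sq(2) S T by auto
  have "(\<Sum>u\<in>F. (hnorm H ((S + T) u))\<^sup>2) \<le> (2 * (?s + ?t))\<^sup>2" if F: "finite F" "F \<subseteq> onb" for F
  proof -
    have "(\<Sum>u\<in>F. (hnorm H ((S + T) u))\<^sup>2) \<le> (\<Sum>u\<in>F. 2 * (hnorm H (S u))\<^sup>2 + 2 * (hnorm H (T u))\<^sup>2)"
    proof (rule sum_mono)
      fix u assume "u \<in> F"
      then have "S u \<in> vecs H" "T u \<in> vecs H"
        using F(2) onb_mem bounded_opsD(1) hilbert_schmidt_bounded S T by blast+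
      then show "(hnorm H ((S + T) u))\<^sup>2 \<le> 2 * (hnorm H (S u))\<^sup>2 + 2 * (hnorm H (T u))\<^sup>2"
        using ip_add_self_le[of "S u" "T u"] by (simp add: hnorm_sq add_mem)
    qed
    also have "\<dots> \<le> 2 * ?s\<^sup>2 + 2 * ?t\<^sup>2"
      using HS_finite_sum_le[OF S F] HS_finite_sum_le[OF T F]
      by (simp add: sum.distrib sum_distrib_left[symmetric])
    also have "\<dots> \<le> (2 * (?s + ?t))\<^sup>2"
      using nn by (simp add: power2_eq_square algebra_simps)
    finally show ?thesis .
  qed
  note le = this
  have b: "S + T \<in> bounded_ops H"
    by (intro bounded_ops_add hilbert_schmidt_bounded S T)
  have pos: "0 \<le> 2 * (?s + ?t)" using nn by simp
  show "S + T \<in> vecs (HS H)"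
    unfolding vecs_HS by (rule hilbert_schmidtI(1)[OF b le pos])
  show "hnorm (HS H) (S + T) \<le> 2 * (?s + ?t)"
    by (rule hilbert_schmidtI(2)[OF b le pos])
next
  fix c T assume "T \<in> vecs (HS H)"
  then have T: "hilbert_schmidt H T" by (simp add: vecs_HS)
  let ?t = "hnorm (HS H) T"
  have "(\<Sum>u\<in>F. (hnorm H ((c *\<^sub>C T) u))\<^sup>2) \<le> (cmod c * ?t)\<^sup>2" if F: "finite F" "F \<subseteq> onb" for F
  proof -
    have "(hnorm H ((c *\<^sub>C T) u))\<^sup>2 = (cmod c)\<^sup>2 * (hnorm H (T u))\<^sup>2" if "u \<in> F" for u
    proof -
      have "T u \<in> vecs H" using that F(2) onb_mem bounded_opsD(1) hilbert_schmidt_bounded T by blast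
      then show ?thesis by (simp add: scaleC_fun_apply hnorm_scale power_mult_distrib)
    qed
    then have "(\<Sum>u\<in>F. (hnorm H ((c *\<^sub>C T) u))\<^sup>2) = (cmod c)\<^sup>2 * (\<Sum>u\<in>F. (hnorm H (T u))\<^sup>2)"
      by (simp add: sum_distrib_left)
    also have "\<dots> \<le> (cmod c)\<^sup>2 * ?t\<^sup>2"
      by (intro mult_left_mono HS_finite_sum_le T F) simp
    finally show ?thesis by (simp add: power_mult_distrib)
  qed
  from hilbert_schmidtI[OF bounded_ops_scale[OF hilbert_schmidt_bounded[OF T]] this]
  show "c *\<^sub>C T \<in> vecs (HS H)" "hnorm (HS H) (c *\<^sub>C T) \<le> cmod c * ?t"
    using hnorm_HS_sq(2)[OF T] by (simp_all add: vecs_HS)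
qed (simp add: vecs_HS hnorm_HS_sq(2))

lemma rank_one_apply: "v \<in> vecs H \<Longrightarrow> rank_one H \<xi> \<eta> v = ip H v \<xi> *\<^sub>C \<eta>"
  by (simp add: rank_one_def)

lemma rank_one_bounded:
  assumes "\<xi> \<in> vecs H" "\<eta> \<in> vecs H"
  shows "rank_one H \<xi> \<eta> \<in> bounded_ops H"
proof (rule bounded_opsI[where K = "hnorm H \<xi> * hnorm H \<eta>"])
  fix v assume v: "v \<in> vecs H"
  show "hnorm H (rank_one H \<xi> \<eta> v) \<le> hnorm H \<xi> * hnorm H \<eta> * hnorm H v"
    using mult_right_mono[OF Cauchy_Schwarz_hnorm[OF v assms(1)] hnorm_nonneg[OF assms(2)]] v assms
    by (simp add: rank_one_apply hnorm_scale ac_simps)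
qed (use assms in \<open>auto simp: rank_one_def scale_mem add_mem ip_linear scaleC_add_left scaleC_scaleC\<close>)

lemma rank_one_HS:
  assumes \<xi>: "\<xi> \<in> vecs H" and \<eta>: "\<eta> \<in> vecs H"
  shows "hilbert_schmidt H (rank_one H \<xi> \<eta>)"
proof (rule hilbert_schmidtI(1)[OF rank_one_bounded[OF assms], where M = "hnorm H \<xi> * hnorm H \<eta>"])
  fix F assume F: "finite F" "F \<subseteq> onb"
  have "(hnorm H (rank_one H \<xi> \<eta> u))\<^sup>2 = (cmod (ip H \<xi> u))\<^sup>2 * (hnorm H \<eta>)\<^sup>2" if "u \<in> F" for u
  proof -
    have u: "u \<in> vecs H" using that F onb_mem by blast
    then have "cmod (ip H u \<xi>) = cmod (ip H \<xi> u)" using ip_cnj[OF \<xi> u] by (metis complex_mod_cnj)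
    then show ?thesis using \<eta> u by (simp add: rank_one_apply hnorm_scale power_mult_distrib)
  qed
  then have "(\<Sum>u\<in>F. (hnorm H (rank_one H \<xi> \<eta> u))\<^sup>2) = (\<Sum>u\<in>F. (cmod (ip H \<xi> u))\<^sup>2) * (hnorm H \<eta>)\<^sup>2"
    by (simp add: sum_distrib_right)
  also have "\<dots> \<le> (hnorm H \<xi>)\<^sup>2 * (hnorm H \<eta>)\<^sup>2"
    using Bessel[OF orthonormal_subset[OF orthonormal_onb F(2)] F(1) \<xi>] \<xi> by (intro mult_right_mono) (simp_all add: hnorm_sq)
  finally show "(\<Sum>u\<in>F. (hnorm H (rank_one H \<xi> \<eta> u))\<^sup>2) \<le> (hnorm H \<xi> * hnorm H \<eta>)\<^sup>2"
    by (simp add: power_mult_distrib)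
qed (use assms hnorm_nonneg in simp)

text \<open>The representation of \<open>a \<otimes> b\<^sup>o\<^sup>p\<close> on \<open>HS H\<close>, applied to an operator of rank one.\<close>

lemma left_right_mult_rank_one:
  assumes "\<xi> \<in> vecs H" "\<eta> \<in> vecs H" "a \<in> bounded_ops H" "adjoint_pair b b'"
  shows "(left_mult H a \<circ> right_mult H b) (rank_one H \<xi> \<eta>) = rank_one H (b' \<xi>) (a \<eta>)"
proof -
  note b = adjoint_pairD[OF assms(4)]
  have "rank_one H \<xi> \<eta> \<circ> b = rank_one H (b' \<xi>) \<eta>"
  proof
    fix v show "(rank_one H \<xi> \<eta> \<circ> b) v = rank_one H (b' \<xi>) \<eta> v"
      using assms(1) b(3)[of v \<xi>] bounded_opsD(1,2)[OF b(1), of v]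
      by (auto simp: rank_one_def ip_zero_left scaleC_zero_left)
  qed
  moreover have "a \<circ> rank_one H (b' \<xi>) \<eta> = rank_one H (b' \<xi>) (a \<eta>)"
    using bounded_opsD(4)[OF assms(3,2)] bounded_ops_zero_vec[OF assms(3)]
    by (auto simp: fun_eq_iff rank_one_def)
  ultimately show ?thesis
    using rank_one_HS[OF assms(1,2)] rank_one_HS[OF bounded_opsD(1)[OF b(2) assms(1)] assms(2)]
    by (simp add: left_mult_def right_mult_def)
qed

text \<open>Moving \<open>S\<close> to the other side turns the sum over the basis into \<open>\<Sum> \<langle>S \<eta>, u\<rangle> \<langle>u, \<xi>\<rangle>\<close>, which
  Parseval's identity evaluates.\<close>

lemma ip_HS_rank_one_sum:
  assumes "finite X" "adjoint_pair S S"
    and "\<And>x. x \<in> X \<Longrightarrow> \<xi> x \<in> vecs H" "\<And>x. x \<in> X \<Longrightarrow> \<eta> x \<in> vecs H"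
  shows "ip (HS H) (\<Sum>x\<in>X. c x *\<^sub>C rank_one H (\<xi> x) (\<eta> x)) S = (\<Sum>x\<in>X. c x * ip H (S (\<eta> x)) (\<xi> x))"
proof -
  note S = adjoint_pairD[OF assms(2)]
  have "((\<lambda>u. \<Sum>x\<in>X. c x * (ip H (S (\<eta> x)) u * ip H u (\<xi> x))) has_sum
      (\<Sum>x\<in>X. c x * ip H (S (\<eta> x)) (\<xi> x))) onb"
    using assms(1,3,4)
  proof (induction X rule: finite_induct)
    case (insert x X)
    then show ?case
      using bounded_opsD(1)[OF S(1)] some_onb
      by (simp add: has_sum_add has_sum_cmult_right Parseval)
  qed simp
  then have "((\<lambda>u. ip H ((\<Sum>x\<in>X. c x *\<^sub>C rank_one H (\<xi> x) (\<eta> x)) u) (S u)) has_sum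
      (\<Sum>x\<in>X. c x * ip H (S (\<eta> x)) (\<xi> x))) onb"
  proof (rule has_sum_cong[THEN iffD1, rotated])
    fix u assume "u \<in> onb"
    then have u: "u \<in> vecs H" "S u \<in> vecs H" using onb_mem bounded_opsD(1)[OF S(1)] by auto
    show "(\<Sum>x\<in>X. c x * (ip H (S (\<eta> x)) u * ip H u (\<xi> x)))
        = ip H ((\<Sum>x\<in>X. c x *\<^sub>C rank_one H (\<xi> x) (\<eta> x)) u) (S u)"
      using u assms(3,4) S(3)
      by (simp add: sum_fun_apply scaleC_fun_apply rank_one_apply ip_sum_left scale_mem ip_scale_left ac_simps)
  qed
  then show ?thesis by (simp add: HS_def infsumI)
qed

end

section \<open>Norm estimates on the tensor powers\<close>

lemma level_ip_cong:
  assumes "\<And>w. length w = k \<Longrightarrow> f w = f' w" "\<And>w. length w = k \<Longrightarrow> g w = g' w"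
  shows "level_ip q k f g = level_ip q k f' g'"
  unfolding level_ip_permute_list using assms by (intro sum.cong arg_cong2[where f = "(*)"] refl) simp_all

lemma level_ip_add_left: "level_ip q k (f + f') g = level_ip q k f g + level_ip q k f' g"
  unfolding level_ip_permute_list by (simp add: sum.distrib distrib_left distrib_right)

lemma level_ip_scale_left: "level_ip q k (c *\<^sub>C f) g = c * level_ip q k f g"
  unfolding level_ip_permute_list
  by (simp add: scaleC_fun_apply scaleC_complex sum_distrib_left ac_simps)

lemma level_ip_self_nonneg: "\<bar>q\<bar> \<le> 1 \<Longrightarrow> 0 \<le> Re (level_ip q k f f)"
  using level_ip_lower_bound[of q k f]
  by (rule order_trans[rotated]) (auto intro!: mult_nonneg_nonneg sum_nonneg)

lemma level_ip_definite:
  assumes "\<bar>q\<bar> < 1" "Re (level_ip q k f f) = 0" "length w = k"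
  shows "f w = 0"
proof -
  have "(1 - \<bar>q\<bar>) ^ card (pairs k) * (\<Sum>w | length w = k. (cmod (f w))\<^sup>2) \<le> 0"
    using level_ip_lower_bound[of q k f] assms by simp
  moreover have "0 < (1 - \<bar>q\<bar>) ^ card (pairs k)" using assms(1) by simp
  ultimately have "(\<Sum>w | length w = k. (cmod (f w))\<^sup>2) \<le> 0"
    by (simp add: mult_le_0_iff)
  moreover have "(cmod (f w))\<^sup>2 \<le> (\<Sum>w | length w = k. (cmod (f w))\<^sup>2)"
    using finite_words assms(3) by (intro member_le_sum) auto
  ultimately have "(cmod (f w))\<^sup>2 \<le> 0" by linarith
  then show ?thesis by simp
qed

definition level_space :: "real \<Rightarrow> nat \<Rightarrow> 'n::finite fock_vec hilbert" where
  "level_space q k = \<lparr>vecs = UNIV, ip = level_ip q k\<rparr>"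

lemma level_semi_inner_space: "\<bar>q\<bar> \<le> 1 \<Longrightarrow> semi_inner_space (level_space q k)"
  by standard
    (simp_all add: level_space_def level_ip_add_left level_ip_scale_left level_ip_hermitian level_ip_self_nonneg)

lemma level_ip_Cauchy_Schwarz:
  "\<bar>q\<bar> \<le> 1 \<Longrightarrow> (cmod (level_ip q k f g))\<^sup>2 \<le> Re (level_ip q k f f) * Re (level_ip q k g g)"
  using semi_inner_space.Cauchy_Schwarz[OF level_semi_inner_space, of q f k g] by (simp add: level_space_def)

lemma level_ip_add_self_le:
  "\<bar>q\<bar> \<le> 1 \<Longrightarrow> Re (level_ip q k (f + g) (f + g)) \<le> 2 * Re (level_ip q k f f) + 2 * Re (level_ip q k g g)"
  using semi_inner_space.ip_add_self_le[OF level_semi_inner_space, of q f k g] by (simp add: level_space_def)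

lemma level_ip_add_right: "level_ip q k g (f + f') = level_ip q k g f + level_ip q k g f'"
  using arg_cong[OF level_ip_add_left[of q k f f' g], of cnj] by (simp add: level_ip_hermitian)

lemma level_ip_scale_right: "level_ip q k g (c *\<^sub>C f) = cnj c * level_ip q k g f"
  using arg_cong[OF level_ip_scale_left[of q k c f g], of cnj] by (simp add: level_ip_hermitian)

lemma level_ip_le_sum:
  assumes "\<bar>q\<bar> \<le> 1"
  shows "cmod (level_ip q k f g) \<le> Re (level_ip q k f f) + Re (level_ip q k g g)"
proof (rule power2_le_imp_le)
  let ?x = "Re (level_ip q k f f)" and ?y = "Re (level_ip q k g g)"
  have nn: "0 \<le> ?x" "0 \<le> ?y" using level_ip_self_nonneg[OF assms] by auto
  have "?x * ?y \<le> (?x + ?y)\<^sup>2" using nn by (simp add: power2_eq_square algebra_simps)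
  then show "(cmod (level_ip q k f g))\<^sup>2 \<le> (?x + ?y)\<^sup>2"
    using level_ip_Cauchy_Schwarz[OF assms, of k f g] by linarith
  show "0 \<le> ?x + ?y" using nn by simp
qed

lemma cip_self: "cip h h = of_real (Re (cip h h))" "0 \<le> Re (cip h h)"
proof -
  have "cip h h = of_real (\<Sum>i\<in>UNIV. (cmod (h $ i))\<^sup>2)"
    by (simp add: cip_def complex_mult_cnj cmod_power2)
  then show "cip h h = of_real (Re (cip h h))" "0 \<le> Re (cip h h)"
    by (simp_all add: sum_nonneg)
qed

text \<open>An operator and its adjoint have the same norm. Here the argument is carried out on a pair of
  consecutive tensor powers, where it serves as a step of the next induction.\<close>

lemma level_ann_bound_if_cre_bound:
  assumes q: "\<bar>q\<bar> \<le> 1" and c: "0 \<le> c"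
    and bd: "\<And>f. Re (level_ip q (Suc k) (cre h f) (cre h f)) \<le> c * Re (level_ip q k f f)"
  shows "Re (level_ip q k (ann q h g) (ann q h g)) \<le> c * Re (level_ip q (Suc k) g g)"
proof -
  let ?a = "ann q h g"
  let ?x = "Re (level_ip q k ?a ?a)" and ?y = "Re (level_ip q (Suc k) g g)"
  have nn: "0 \<le> ?x" "0 \<le> ?y" using level_ip_self_nonneg[OF q] by auto
  have "?x \<le> cmod (level_ip q (Suc k) (cre h ?a) g)"
    unfolding level_ip_cre by (rule complex_Re_le_cmod)
  then have "?x\<^sup>2 \<le> (cmod (level_ip q (Suc k) (cre h ?a) g))\<^sup>2"
    using nn by (intro power_mono)
  also have "\<dots> \<le> Re (level_ip q (Suc k) (cre h ?a) (cre h ?a)) * ?y"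
    by (rule level_ip_Cauchy_Schwarz[OF q])
  also have "\<dots> \<le> (c * ?x) * ?y" by (intro mult_right_mono bd nn)
  finally have "?x * ?x \<le> ?x * (c * ?y)" by (simp add: power2_eq_square ac_simps)
  then show ?thesis using nn c by (cases "?x = 0") auto
qed

text \<open>By \<open>ann_cre\<close>, \<open>\<parallel>l(h) f\<parallel>\<^sup>2 = \<parallel>h\<parallel>\<^sup>2 \<parallel>f\<parallel>\<^sup>2 + q \<parallel>l\<^sup>*(h) f\<parallel>\<^sup>2\<close>, and the last term is bounded by the induction
  hypothesis one rank below. The constant \<open>c = 1 / (1 - \<bar>q\<bar>)\<close> is the solution of \<open>c = 1 + \<bar>q\<bar> c\<close>.\<close>

lemma level_cre_bound:
  assumes q: "\<bar>q\<bar> < 1"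
  shows "Re (level_ip q (Suc k) (cre h f) (cre h f)) \<le> Re (cip h h) / (1 - \<bar>q\<bar>) * Re (level_ip q k f f)"
proof (induction k arbitrary: f)
  case 0
  let ?c = "Re (cip h h) / (1 - \<bar>q\<bar>)"
  have "level_ip q (Suc 0) (cre h f) (cre h f) = of_real (Re (cip h h)) * level_ip q 0 f f"
    unfolding level_ip_cre ann_cre level_ip_add_right level_ip_scale_right level_ip_0_cre
    by (subst cip_self(1)) simp
  moreover have "Re (cip h h) \<le> ?c"
    using q cip_self(2)[of h] mult_left_mono[of "1 - \<bar>q\<bar>" 1 "Re (cip h h)"] by (simp add: field_simps)
  ultimately show ?case
    using level_ip_self_nonneg[of q 0 f] q mult_right_mono[of "Re (cip h h)" ?c "Re (level_ip q 0 f f)"]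
    by simp
next
  case (Suc k)
  let ?c = "Re (cip h h) / (1 - \<bar>q\<bar>)"
  have c: "0 \<le> ?c" using q cip_self(2)[of h] by simp
  have nn: "0 \<le> Re (level_ip q (Suc k) f f)" "0 \<le> Re (level_ip q k (ann q h f) (ann q h f))"
    using level_ip_self_nonneg q by (metis order_less_imp_le)+
  have ann: "Re (level_ip q k (ann q h f) (ann q h f)) \<le> ?c * Re (level_ip q (Suc k) f f)"
    using q c Suc.IH by (intro level_ann_bound_if_cre_bound) simp_all
  have "level_ip q (Suc (Suc k)) (cre h f) (cre h f)
      = of_real (Re (cip h h)) * level_ip q (Suc k) f f + of_real q * level_ip q (Suc k) f (cre h (ann q h f))"
    unfolding level_ip_cre ann_cre level_ip_add_right level_ip_scale_right
    by (subst cip_self(1)) simp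
  also have "level_ip q (Suc k) f (cre h (ann q h f)) = level_ip q k (ann q h f) (ann q h f)"
    by (metis level_ip_cre level_ip_hermitian)
  finally have "Re (level_ip q (Suc (Suc k)) (cre h f) (cre h f))
      = Re (cip h h) * Re (level_ip q (Suc k) f f) + q * Re (level_ip q k (ann q h f) (ann q h f))"
    by simp
  also have "\<dots> \<le> Re (cip h h) * Re (level_ip q (Suc k) f f) + \<bar>q\<bar> * (?c * Re (level_ip q (Suc k) f f))"
    using nn by (intro add_left_mono mult_mono ann) auto
  also have "\<dots> = (Re (cip h h) + \<bar>q\<bar> * ?c) * Re (level_ip q (Suc k) f f)"
    by (simp add: algebra_simps)
  also have "Re (cip h h) + \<bar>q\<bar> * ?c = ?c"
    using q by (simp add: field_simps)
  finally show ?case .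
qed

lemma level_ann_bound:
  assumes q: "\<bar>q\<bar> < 1"
  shows "Re (level_ip q k (ann q h g) (ann q h g)) \<le> Re (cip h h) / (1 - \<bar>q\<bar>) * Re (level_ip q (Suc k) g g)"
  using q cip_self(2)[of h] by (intro level_ann_bound_if_cre_bound level_cre_bound) simp_all

section \<open>The Fock space as a Hilbert space\<close>

lemma fock_mem: "f \<in> vecs (fock q) \<longleftrightarrow> summable (\<lambda>k. Re (level_ip q k f f))"
  by (simp add: fock_def)

lemma ip_fock_sums:
  assumes q: "\<bar>q\<bar> \<le> 1" and "f \<in> vecs (fock q)" "g \<in> vecs (fock q)"
  shows "(\<lambda>k. level_ip q k f g) sums ip (fock q) f g"
proof -
  have "summable (\<lambda>k. level_ip q k f g)"
  proof (rule summable_comparison_test)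
    show "\<exists>N. \<forall>k\<ge>N. norm (level_ip q k f g) \<le> Re (level_ip q k f f) + Re (level_ip q k g g)"
      using level_ip_le_sum[OF q] by blast
    show "summable (\<lambda>k. Re (level_ip q k f f) + Re (level_ip q k g g))"
      using assms(2,3) by (intro summable_add) (simp_all add: fock_mem)
  qed
  then show ?thesis by (simp add: fock_def summable_sums)
qed

lemma fock_self_sums:
  assumes q: "\<bar>q\<bar> \<le> 1" and "f \<in> vecs (fock q)"
  shows "(\<lambda>k. Re (level_ip q k f f)) sums Re (ip (fock q) f f)"
  by (rule sums_Re[OF ip_fock_sums[OF q assms(2,2)]])

lemma fock_inner_space:
  assumes q: "\<bar>q\<bar> < 1"
  shows "inner_space (fock q :: 'n::finite fock_vec hilbert)"
proof -
  let ?H = "fock q :: 'n fock_vec hilbert"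
  have q1: "\<bar>q\<bar> \<le> 1" using q by simp
  note sums = ip_fock_sums[OF q1]
  have add: "f + g \<in> vecs ?H" if "f \<in> vecs ?H" "g \<in> vecs ?H" for f g
    unfolding fock_mem
  proof (rule summable_comparison_test)
    show "\<exists>N. \<forall>k\<ge>N. norm (Re (level_ip q k (f + g) (f + g)))
        \<le> 2 * Re (level_ip q k f f) + 2 * Re (level_ip q k g g)"
      using level_ip_add_self_le[OF q1, of _ f g] by (simp add: abs_of_nonneg[OF level_ip_self_nonneg[OF q1]])
    show "summable (\<lambda>k. 2 * Re (level_ip q k f f) + 2 * Re (level_ip q k g g))"
      using that by (intro summable_add summable_mult) (simp_all add: fock_mem)
  qed
  have scale: "c *\<^sub>C f \<in> vecs ?H" if "f \<in> vecs ?H" for f c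
  proof -
    have "level_ip q k (c *\<^sub>C f) (c *\<^sub>C f) = of_real ((cmod c)\<^sup>2) * level_ip q k f f" for k
      unfolding complex_norm_square by (simp add: level_ip_scale_left level_ip_scale_right ac_simps)
    then show ?thesis using that by (simp add: fock_mem summable_mult)
  qed
  show ?thesis
  proof
    show "0 \<in> vecs ?H"
      using level_ip_scale_left[of q _ 0 "0 :: 'n fock_vec" 0] by (simp add: fock_mem scaleC_zero_left)
    fix u v w :: "'n fock_vec" and c
    assume u: "u \<in> vecs ?H"
    show "0 \<le> Re (ip ?H u u)"
      using sums_le[OF level_ip_self_nonneg[OF q1] sums_zero fock_self_sums[OF q1 u]] .
    show "c *\<^sub>C u \<in> vecs ?H" by (rule scale[OF u])
    show "u = 0" if z: "ip ?H u u = 0"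
    proof
      fix w :: "'n list"
      have "Re (level_ip q (length w) u u) \<le> Re (ip ?H u u)"
        using sum_le_suminf[of "\<lambda>k. Re (level_ip q k u u)" "{length w}"] u
          level_ip_self_nonneg[OF q1, of _ u] sums_unique[OF fock_self_sums[OF q1 u]]
        by (simp add: fock_mem)
      then have "Re (level_ip q (length w) u u) = 0"
        using z level_ip_self_nonneg[OF q1, of "length w" u] by simp
      then show "u w = 0 w" using level_ip_definite[OF q, of "length w" u w] by simp
    qed
    assume w: "w \<in> vecs ?H"
    show "ip ?H (c *\<^sub>C u) w = c * ip ?H u w"
      by (rule sums_unique2[OF sums[OF scale[OF u] w]])
        (use sums_mult[OF sums[OF u w], of c] in \<open>simp add: level_ip_scale_left\<close>)
    show "cnj (ip ?H u w) = ip ?H w u"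
      using sums_cnj[THEN iffD2, OF sums[OF u w]] sums[OF w u]
      unfolding level_ip_hermitian by (rule sums_unique2)
    assume v: "v \<in> vecs ?H"
    show "ip ?H (u + v) w = ip ?H u w + ip ?H v w"
      by (rule sums_unique2[OF sums[OF add[OF u v] w]])
        (use sums_add[OF sums[OF u w] sums[OF v w]] in \<open>simp add: level_ip_add_left\<close>)
  next
    fix u v assume "u \<in> vecs ?H" "v \<in> vecs ?H"
    then show "u + v \<in> vecs ?H" by (rule add)
  qed
qed

definition supported :: "'n list set \<Rightarrow> 'n fock_vec \<Rightarrow> bool" where
  "supported W f \<longleftrightarrow> (\<forall>w. w \<notin> W \<longrightarrow> f w = 0)"

abbreviation level_words :: "nat \<Rightarrow> 'n list set" where
  "level_words k \<equiv> {w. length w = k}"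

definition level_part :: "nat \<Rightarrow> 'n fock_vec \<Rightarrow> 'n fock_vec" where
  "level_part k f = (\<lambda>w. if length w = k then f w else 0)"

lemma level_ip_zero_left:
  assumes "\<And>w. length w = k \<Longrightarrow> f w = 0"
  shows "level_ip q k f g = 0"
proof -
  have "level_ip q k f g = level_ip q k (0 *\<^sub>C f) g"
    using assms by (intro level_ip_cong) (simp_all add: scaleC_zero_left)
  then show ?thesis by (simp add: level_ip_scale_left)
qed

lemma supported_mem:
  fixes f :: "'n::finite fock_vec"
  assumes "finite W" "supported W f"
  shows "f \<in> vecs (fock q)"
  unfolding fock_mem
proof (rule summable_finite[of "length ` W"])
  fix k assume "k \<notin> length ` W"
  then show "Re (level_ip q k f f) = 0"
    using assms(2) by (subst level_ip_zero_left) (auto simp: supported_def)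
qed (use assms(1) in simp)

lemma supported_diff: "supported W f \<Longrightarrow> supported W g \<Longrightarrow> supported W (f - g)"
  by (simp add: supported_def)

lemma supported_scale: "supported W f \<Longrightarrow> supported W (c *\<^sub>C f)"
  by (simp add: supported_def scaleC_fun_apply scaleC_complex)

lemma supported_sum: "(\<And>i. i \<in> A \<Longrightarrow> supported W (f i)) \<Longrightarrow> supported W (sum f A)"
  by (induction A rule: infinite_finite_induct) (auto simp: supported_def)

lemma supported_mono: "supported W f \<Longrightarrow> W \<subseteq> W' \<Longrightarrow> supported W' f"
  by (auto simp: supported_def)

lemma supported_level_part: "supported (level_words k) (level_part k f)"
  by (simp add: supported_def level_part_def)

lemma level_part_mem: "level_part k (f :: 'n::finite fock_vec) \<in> vecs (fock q)"
  by (rule supported_mem[OF finite_words supported_level_part])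

lemma ip_fock_level:
  fixes f :: "'n::finite fock_vec"
  assumes "\<bar>q\<bar> < 1" "f \<in> vecs (fock q)" "supported (level_words k) b"
  shows "ip (fock q) f b = level_ip q k f b"
proof -
  have b: "b \<in> vecs (fock q)" by (rule supported_mem[OF finite_words assms(3)])
  have "level_ip q m f b = 0" if "m \<noteq> k" for m
    using level_ip_zero_left[of m b q f] assms(3) that level_ip_hermitian[of q m b f]
    by (simp add: supported_def)
  then have "(\<lambda>m. level_ip q m f b) sums (\<Sum>m\<in>{k}. level_ip q m f b)"
    by (intro sums_finite) auto
  then show ?thesis using sums_unique2 ip_fock_sums[OF _ assms(2) b] assms(1) by fastforce
qed

text \<open>Gram--Schmidt orthogonalization of the vectors of the words in \<open>W\<close>. The bound on the cardinality
  is what makes \<open>\<Xi>\<^sub>q\<close> Hilbert--Schmidt.\<close>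

lemma ex_basis:
  fixes W :: "'n::finite list set"
  assumes q: "\<bar>q\<bar> < 1" and "finite W"
  shows "\<exists>B. finite B \<and> card B \<le> card W \<and> semi_inner_space.orthonormal (fock q) B \<and>
    (\<forall>b\<in>B. supported W b) \<and> (\<forall>f. supported W f \<longrightarrow> f = semi_inner_space.proj_on (fock q) B f)"
proof -
  interpret inner_space "fock q :: 'n fock_vec hilbert" by (rule fock_inner_space[OF q])
  show ?thesis using assms(2)
  proof (induction W rule: finite_induct)
    case empty
    show ?case
      by (rule exI[of _ "{}"]) (auto simp: orthonormal_def proj_on_def supported_def)
  next
    case (insert w W)
    then obtain B where B: "finite B" "card B \<le> card W" "orthonormal B"
      "\<And>b. b \<in> B \<Longrightarrow> supported W b" "\<And>f. supported W f \<Longrightarrow> f = proj_on B f"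
      by blast
    have finW: "finite (insert w W)" using insert.hyps by simp
    let ?\<delta> = "(\<lambda>u. if u = w then 1 else 0) :: 'n fock_vec"
    define d where "d = ?\<delta> - proj_on B ?\<delta>"
    have p: "supported W (proj_on B f)" for f
      unfolding proj_on_def by (intro supported_sum supported_scale B)
    have dw: "d w = 1"
      using p[of ?\<delta>] insert.hyps(2) by (simp add: d_def supported_def)
    have dsup: "supported (insert w W) d"
      unfolding d_def
      by (intro supported_diff supported_mono[OF p]) (auto simp: supported_def)
    have dm: "d \<in> vecs (fock q)" by (rule supported_mem[OF finW dsup])
    have \<delta>m: "?\<delta> \<in> vecs (fock q)" by (rule supported_mem[of "{w}"]) (auto simp: supported_def)
    have db: "ip (fock q) d b = 0" if "b \<in> B" for b
      using that ip_proj_on_basis[OF B(3,1) that] orthonormalD(1)[OF B(3) that] proj_on_mem[OF B(3)] \<delta>m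
      by (simp add: d_def ip_diff_left)
    have "d \<noteq> 0" using dw by auto
    then obtain c where c: "c *\<^sub>C d \<in> vecs (fock q)" "ip (fock q) (c *\<^sub>C d) (c *\<^sub>C d) = 1"
      "c = of_real (1 / hnorm (fock q) d)" "hnorm (fock q) d > 0"
      using normalize[OF dm] by blast
    let ?u = "c *\<^sub>C d"
    have ub: "ip (fock q) ?u b = 0" if "b \<in> B" for b
      using db[OF that] dm orthonormalD(1)[OF B(3) that] by (simp add: ip_scale_left)
    note insert_at = orthonormal_insert[OF B(3) c(1,2) ub]
    have finI: "finite (insert ?u B)" using B(1) by simp
    have usup: "supported (insert w W) b" if "b \<in> insert ?u B" for b
      using that supported_scale[OF dsup] B(4) supported_mono by blast
    have rep: "f = proj_on (insert ?u B) f" if f: "supported (insert w W) f" for f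
    proof -
      define r where "r = f - proj_on (insert ?u B) f"
      have fm: "f \<in> vecs (fock q)" by (rule supported_mem[OF finW f])
      have rsup: "supported (insert w W) r"
        unfolding r_def proj_on_def by (intro supported_diff f supported_sum supported_scale usup)
      have rm: "r \<in> vecs (fock q)" by (rule supported_mem[OF finW rsup])
      have rb: "ip (fock q) r b = 0" if "b \<in> insert ?u B" for b
        using ip_proj_on_basis[OF insert_at(1) finI that] orthonormalD(1)[OF insert_at(1) that]
          proj_on_mem[OF insert_at(1)] fm by (simp add: r_def ip_diff_left)
      \<comment> \<open>Both \<open>r\<close> and \<open>d\<close> are orthogonal to \<open>B\<close>, and \<open>d\<close> has coefficient \<open>1\<close> at \<open>w\<close>; so \<open>s\<close> has support in \<open>W\<close>
        and vanishes.\<close>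
      define s where "s = r - r w *\<^sub>C d"
      have ssup: "supported W s"
        unfolding supported_def
      proof (intro allI impI)
        fix x assume "x \<notin> W"
        then show "s x = 0"
          using rsup dsup dw
          by (cases "x = w") (simp_all add: s_def supported_def scaleC_fun_apply scaleC_complex)
      qed
      have sb: "ip (fock q) s b = 0" if "b \<in> B" for b
        using rb[of b] db[OF that] that orthonormalD(1)[OF B(3) that] rm dm
        by (simp add: s_def ip_diff_left ip_scale_left scale_mem)
      have "s = 0"
        using B(5)[OF ssup] sb by (simp add: proj_on_def scaleC_zero_left)
      then have rd: "r = r w *\<^sub>C d" by (simp add: s_def)
      have "ip (fock q) r ?u = 0" using rb by simp
      then have "ip (fock q) r d = 0" using c(3,4) rm dm by (simp add: ip_scale_right)
      then have "ip (fock q) r r = 0"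
        using rd rm dm ip_scale_right[OF dm rm, of "r w"] by simp
      then have "r = 0" by (rule ip_definite[OF rm])
      then show ?thesis by (simp add: r_def)
    qed
    show ?case
      using insert_at usup rep finI B(1,2) insert.hyps by (intro exI[of _ "insert ?u B"]) auto
  qed
qed

definition level_basis :: "real \<Rightarrow> nat \<Rightarrow> 'n::finite fock_vec set" where
  "level_basis q k = (SOME B. finite B \<and> card B \<le> card (level_words k :: 'n list set) \<and>
    semi_inner_space.orthonormal (fock q) B \<and> (\<forall>b\<in>B. supported (level_words k) b) \<and>
    (\<forall>f. supported (level_words k) f \<longrightarrow> f = semi_inner_space.proj_on (fock q) B f))"

lemma level_basis:
  fixes q :: real and k :: nat
  defines "B \<equiv> level_basis q k :: 'n::finite fock_vec set"
  assumes q: "\<bar>q\<bar> < 1"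
  shows "finite B" "card B \<le> card (level_words k :: 'n list set)"
    "semi_inner_space.orthonormal (fock q) B" "\<And>b. b \<in> B \<Longrightarrow> supported (level_words k) b"
    "\<And>f. f \<in> vecs (fock q) \<Longrightarrow> semi_inner_space.proj_on (fock q) B f = level_part k f"
    "\<And>f. f \<in> vecs (fock q) \<Longrightarrow> Re (level_ip q k f f) = (\<Sum>b\<in>B. (cmod (ip (fock q) f b))\<^sup>2)"
proof -
  interpret inner_space "fock q :: 'n fock_vec hilbert" by (rule fock_inner_space[OF q])
  note * = someI_ex[OF ex_basis[OF q finite_words[of k, where 'n = 'n]], folded level_basis_def B_def]
  from * show fin: "finite B" and "card B \<le> card (level_words k :: 'n list set)" and on: "orthonormal B"
    and sup: "\<And>b. b \<in> B \<Longrightarrow> supported (level_words k) b"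
    by blast+
  fix f :: "'n fock_vec" assume f: "f \<in> vecs (fock q)"
  have "ip (fock q) (level_part k f) b = ip (fock q) f b" if "b \<in> B" for b
    unfolding ip_fock_level[OF q f sup[OF that]] ip_fock_level[OF q level_part_mem sup[OF that]]
    by (rule level_ip_cong) (simp_all add: level_part_def)
  then have "proj_on B f = proj_on B (level_part k f)" by (simp add: proj_on_def)
  also have "\<dots> = level_part k f" using * supported_level_part by metis
  finally show pr: "proj_on B f = level_part k f" .
  have "Re (level_ip q k f f) = Re (level_ip q k (level_part k f) (level_part k f))"
    by (intro arg_cong[where f = Re] level_ip_cong) (simp_all add: level_part_def)
  also have "\<dots> = Re (ip (fock q) (proj_on B f) (proj_on B f))"
    unfolding pr by (simp add: ip_fock_level[OF q level_part_mem supported_level_part])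
  also have "\<dots> = (\<Sum>b\<in>B. (cmod (ip (fock q) f b))\<^sup>2)"
    by (simp add: ip_proj_on_self(2)[OF on fin f])
  finally show "Re (level_ip q k f f) = (\<Sum>b\<in>B. (cmod (ip (fock q) f b))\<^sup>2)" .
qed

definition below :: "nat \<Rightarrow> 'n fock_vec \<Rightarrow> 'n fock_vec" where
  "below m f = (\<Sum>k<m. level_part k f)"

lemma below_apply: "below m f w = (if length w < m then f w else 0)"
  by (simp add: below_def sum_fun_apply level_part_def if_distrib sum.delta cong: if_cong)

lemma below_mem: "below m (f :: 'n::finite fock_vec) \<in> vecs (fock q)"
proof (rule supported_mem)
  show "finite (\<Union>k<m. level_words k :: 'n list set)" using finite_words by blast
qed (auto simp: supported_def below_apply)

lemma hnorm_above_tendsto: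
  fixes f :: "'n::finite fock_vec"
  assumes q: "\<bar>q\<bar> < 1" and f: "f \<in> vecs (fock q)"
  shows "(\<lambda>m. hnorm (fock q) (f - below m f)) \<longlonglongrightarrow> 0"
proof -
  interpret inner_space "fock q :: 'n fock_vec hilbert" by (rule fock_inner_space[OF q])
  have q1: "\<bar>q\<bar> \<le> 1" using q by simp
  let ?L = "\<lambda>k. Re (level_ip q k f f)"
  have "Re (ip (fock q) (f - below m f) (f - below m f)) = Re (ip (fock q) f f) - (\<Sum>k<m. ?L k)" for m
  proof -
    have mem: "f - below m f \<in> vecs (fock q)" by (rule diff_mem[OF f below_mem])
    have level: "Re (level_ip q k (f - below m f) (f - below m f)) = (if k < m then 0 else ?L k)" for k
    proof (cases "k < m")
      case True
      then show ?thesis by (simp add: below_apply level_ip_zero_left)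
    next
      case False
      then have "level_ip q k (f - below m f) (f - below m f) = level_ip q k f f"
        by (intro level_ip_cong) (simp_all add: below_apply)
      then show ?thesis using False by simp
    qed
    have "(\<lambda>k. ?L k - (if k < m then ?L k else 0)) sums (Re (ip (fock q) f f) - (\<Sum>k<m. ?L k))"
      using sums_If_finite[of "\<lambda>k. k < m" ?L]
      by (intro sums_diff fock_self_sums[OF q1 f]) (simp add: lessThan_def)
    moreover have "(\<lambda>k. ?L k - (if k < m then ?L k else 0)) = (\<lambda>k. if k < m then 0 else ?L k)"
      by auto
    ultimately show ?thesis
      using sums_unique2[OF fock_self_sums[OF q1 mem]] by (simp add: level)
  qed
  moreover have "(\<lambda>m. sqrt (Re (ip (fock q) f f) - (\<Sum>k<m. ?L k))) \<longlonglongrightarrow> sqrt (Re (ip (fock q) f f) - Re (ip (fock q) f f))"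
    using fock_self_sums[OF q1 f] by (intro tendsto_intros) (simp add: sums_def)
  ultimately show ?thesis by (simp add: hnorm_def)
qed

text \<open>On each tensor power the functional is represented through a finite basis, which yields the
  candidate \<open>\<zeta>\<close>. Applying the functional to the truncations of \<open>\<zeta>\<close> itself bounds their norms by
  \<open>K\<close>, so \<open>\<zeta>\<close> belongs to the space; the truncations of \<open>v\<close> converge to \<open>v\<close>, so \<open>\<zeta>\<close> represents the functional.\<close>

lemma fock_hilbert_space:
  assumes q: "\<bar>q\<bar> < 1"
  shows "hilbert_space (fock q :: 'n::finite fock_vec hilbert)"
proof -
  interpret inner_space "fock q :: 'n fock_vec hilbert" by (rule fock_inner_space[OF q])
  have q1: "\<bar>q\<bar> \<le> 1" using q by simp
  show ?thesis
  proof
    fix \<phi> :: "'n fock_vec \<Rightarrow> complex" and K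
    assume add: "\<And>u v. u \<in> vecs (fock q) \<Longrightarrow> v \<in> vecs (fock q) \<Longrightarrow> \<phi> (u + v) = \<phi> u + \<phi> v"
      and scale: "\<And>c v. v \<in> vecs (fock q) \<Longrightarrow> \<phi> (c *\<^sub>C v) = c * \<phi> v"
      and bd: "\<And>v. v \<in> vecs (fock q) \<Longrightarrow> cmod (\<phi> v) \<le> K * hnorm (fock q) v"
    have zero: "\<phi> 0 = 0" using scale[OF zero_mem, of 0] by (simp add: scaleC_zero_left)
    have sum: "\<phi> (sum f A) = (\<Sum>i\<in>A. \<phi> (f i))" if "\<And>i. i \<in> A \<Longrightarrow> f i \<in> vecs (fock q)" for f and A :: "'i set"
      using that by (induction A rule: infinite_finite_induct) (simp_all add: zero add sum_mem)
    let ?B = "level_basis q :: nat \<Rightarrow> 'n fock_vec set"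
    note B = level_basis[OF q, where 'n = 'n]
    have Bm: "b \<in> vecs (fock q)" if "b \<in> ?B k" for b k
      by (rule orthonormalD(1)[OF B(3) that])
    define z where "z k = (\<Sum>b\<in>?B k. cnj (\<phi> b) *\<^sub>C b)" for k
    define \<zeta> where "\<zeta> w = z (length w) w" for w
    have zsup: "supported (level_words k) (z k)" for k
      unfolding z_def by (intro supported_sum supported_scale B)
    have level: "level_ip q k v \<zeta> = \<phi> (level_part k v)" if v: "v \<in> vecs (fock q)" for k v
    proof -
      have "level_ip q k v \<zeta> = level_ip q k v (z k)"
        by (rule level_ip_cong) (simp_all add: \<zeta>_def)
      also have "\<dots> = ip (fock q) v (z k)" by (rule ip_fock_level[OF q v zsup, symmetric])
      also have "\<dots> = (\<Sum>b\<in>?B k. \<phi> b * ip (fock q) v b)"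
        unfolding z_def by (simp add: ip_sum_right[OF _ v] scale_mem Bm ip_scale_right[OF _ v])
      also have "\<dots> = \<phi> (proj_on (?B k) v)"
        unfolding proj_on_def by (simp add: sum scale scale_mem Bm mult.commute)
      finally show ?thesis by (simp add: B(5)[OF v])
    qed
    have below: "\<phi> (below m v) = (\<Sum>k<m. level_ip q k v \<zeta>)" if "v \<in> vecs (fock q)" for m v
      unfolding below_def by (simp add: sum level_part_mem level[OF that])
    have \<zeta>: "\<zeta> \<in> vecs (fock q)"
      unfolding fock_mem
    proof (rule summableI_nonneg_bounded)
      show "0 \<le> Re (level_ip q k \<zeta> \<zeta>)" for k by (rule level_ip_self_nonneg[OF q1])
      fix m
      let ?s = "\<Sum>k<m. Re (level_ip q k \<zeta> \<zeta>)" and ?z = "below m \<zeta>"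
      have s: "0 \<le> ?s" by (intro sum_nonneg level_ip_self_nonneg[OF q1])
      have lev: "level_ip q k ?z ?z = (if k < m then level_ip q k \<zeta> \<zeta> else 0)" 
        "k < m \<Longrightarrow> level_ip q k ?z \<zeta> = level_ip q k \<zeta> \<zeta>" for k
        by (auto intro!: level_ip_cong level_ip_zero_left simp: below_apply)
      have "(\<lambda>k. Re (level_ip q k ?z ?z)) sums ?s"
        using sums_If_finite[of "\<lambda>k. k < m" "\<lambda>k. Re (level_ip q k \<zeta> \<zeta>)"]
        by (simp add: lev if_distrib[of Re] lessThan_def cong: if_cong)
      then have "Re (ip (fock q) ?z ?z) = ?s"
        using sums_unique2[OF fock_self_sums[OF q1 below_mem]] by blast
      then have n: "hnorm (fock q) ?z = sqrt ?s" by (simp add: hnorm_def)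
      have "below m ?z = ?z" by (auto simp: fun_eq_iff below_apply)
      then have "\<phi> ?z = (\<Sum>k<m. level_ip q k ?z \<zeta>)"
        using below[OF below_mem, of m m \<zeta>] by simp
      also have "\<dots> = (\<Sum>k<m. level_ip q k \<zeta> \<zeta>)"
        by (intro sum.cong refl lev(2)) simp
      finally have "?s \<le> cmod (\<phi> ?z)" using complex_Re_le_cmod[of "\<phi> ?z"] by simp
      also have "\<dots> \<le> K * sqrt ?s" using bd[OF below_mem, of m \<zeta>] by (simp add: n)
      finally have "?s\<^sup>2 \<le> (K * sqrt ?s)\<^sup>2" using s by (intro power_mono)
      moreover have "(K * sqrt ?s)\<^sup>2 = K\<^sup>2 * ?s" using s by (simp add: power_mult_distrib)
      ultimately have "?s * ?s \<le> K\<^sup>2 * ?s" by (simp add: power2_eq_square[of ?s])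
      then show "?s \<le> K\<^sup>2" using s by (cases "?s = 0") auto
    qed
    have "\<phi> v = ip (fock q) v \<zeta>" if v: "v \<in> vecs (fock q)" for v
    proof (rule LIMSEQ_unique)
      show "(\<lambda>m. \<phi> (below m v)) \<longlonglongrightarrow> ip (fock q) v \<zeta>"
        unfolding below[OF v] using ip_fock_sums[OF q1 v \<zeta>] by (simp add: sums_def)
      show "(\<lambda>m. \<phi> (below m v)) \<longlonglongrightarrow> \<phi> v"
      proof (rule LIM_zero_cancel, rule Lim_null_comparison)
        have "cmod (\<phi> (below m v) - \<phi> v) \<le> K * hnorm (fock q) (v - below m v)" for m
        proof -
          have "\<phi> v = \<phi> (below m v) + \<phi> (v - below m v)"
            using add[OF below_mem diff_mem[OF v below_mem], of m v m v] by simp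
          then have "cmod (\<phi> (below m v) - \<phi> v) = cmod (\<phi> (v - below m v))" by simp
          then show ?thesis using bd[OF diff_mem[OF v below_mem], of m v] by simp
        qed
        then show "\<forall>\<^sub>F m in sequentially. cmod (\<phi> (below m v) - \<phi> v) \<le> K * hnorm (fock q) (v - below m v)"
          by simp
        show "(\<lambda>m. K * hnorm (fock q) (v - below m v)) \<longlonglongrightarrow> 0"
          using tendsto_mult_left[OF hnorm_above_tendsto[OF q v], of K] by simp
      qed
    qed
    then show "\<exists>\<zeta>\<in>vecs (fock q). \<forall>v\<in>vecs (fock q). \<phi> v = ip (fock q) v \<zeta>"
      using \<zeta> by blast
  qed
qed

section \<open>Words in the left and right field operators\<close>

definition field :: "real \<Rightarrow> real^'n::finite \<Rightarrow> 'n fock_vec \<Rightarrow> 'n fock_vec" where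
  "field q x f = cre (complexify x) f + ann q (complexify x) f"

definition rfield :: "real \<Rightarrow> real^'n::finite \<Rightarrow> 'n fock_vec \<Rightarrow> 'n fock_vec" where
  "rfield q x f = rcre (complexify x) f + rann q (complexify x) f"

lemma cip_complexify: "cip (complexify x) (complexify y) = of_real (x \<bullet> y)"
  by (simp add: cip_def complexify_def inner_vec_def)

lemma rfield_add: "rfield q x (f + g) = rfield q x f + rfield q x g"
  and rfield_scale: "rfield q x (c *\<^sub>C f) = c *\<^sub>C rfield q x f"
  by (simp_all only: rfield_def fock_op_add fock_op_scale scaleC_add_right add_ac)

lemma rfield_zero: "rfield q x 0 = 0"
  using rfield_scale[of q x 0 0] by (simp add: scaleC_zero_left)

lemma rfield_sum: "rfield q x (sum f A) = (\<Sum>i\<in>A. rfield q x (f i))"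
proof (induction A rule: infinite_finite_induct)
  case (insert a A)
  then show ?case unfolding sum.insert[OF insert.hyps] rfield_add by (simp only:)
next
  case (infinite A)
  show ?case unfolding sum.infinite[OF infinite.hyps] by (rule rfield_zero)
qed (simp only: sum.empty rfield_zero)

text \<open>The two multiples of \<open>\<Xi>\<^sub>q\<close> that arise from \<open>ann_rcre\<close> and \<open>rann_cre\<close> are equal, because the inner product
  of real vectors is symmetric.\<close>

lemma field_rfield: "field q x (rfield q y f) = rfield q y (field q x f)"
  unfolding field_def rfield_def fock_op_add ann_rcre rann_cre cre_rcre ann_rann cip_complexify
  by (simp only: inner_commute[of y x] add_ac)

lemma ann_rfield:
  "ann q (complexify x) (rfield q y f) = of_real (x \<bullet> y) *\<^sub>C numop q f + rfield q y (ann q (complexify x) f)"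
  unfolding rfield_def fock_op_add ann_rcre ann_rann cip_complexify
  by (simp only: inner_commute[of y x] add_ac)

lemma vacuum_apply: "vacuum w = (if w = [] then 1 else 0)"
  by (simp add: vacuum_def tensor_def)

lemma ann_vacuum: "ann q h vacuum = 0" and rann_vacuum: "rann q h vacuum = 0"
proof -
  have "vacuum (insert_at j a v) = 0" for j a and v :: "'a list"
    by (simp add: vacuum_apply insert_at_def)
  then show "ann q h vacuum = 0" "rann q h vacuum = 0"
    by (simp_all add: ann_def rann_def zero_fun_def)
qed

lemma cre_vacuum: "cre h vacuum = rcre h vacuum"
proof
  fix w show "cre h vacuum w = rcre h vacuum w"
  proof (cases w)
    case (Cons i v)
    then show ?thesis by (cases v rule: rev_cases) (simp_all add: rcre_def vacuum_apply)
  qed simp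
qed

lemma field_vacuum: "field q x vacuum = rfield q x vacuum"
  by (simp add: field_def rfield_def ann_vacuum rann_vacuum cre_vacuum)

lemma field_at_Nil: "field q x f [] = ann q (complexify x) f []"
  and rfield_at_Nil: "rfield q x f [] = ann q (complexify x) f []"
  by (simp_all add: field_def rfield_def ann_def rann_def)

definition field_word :: "real \<Rightarrow> ('k \<Rightarrow> real^'n::finite) \<Rightarrow> 'k list \<Rightarrow> 'n fock_vec \<Rightarrow> 'n fock_vec" where
  "field_word q e w f = foldr (\<lambda>i. field q (e i)) w f"

definition rfield_word :: "real \<Rightarrow> ('k \<Rightarrow> real^'n::finite) \<Rightarrow> 'k list \<Rightarrow> 'n fock_vec \<Rightarrow> 'n fock_vec" where
  "rfield_word q e w f = foldr (\<lambda>i. rfield q (e i)) w f"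

lemma field_word_simps [simp]:
  "field_word q e [] f = f" "field_word q e (i # w) f = field q (e i) (field_word q e w f)"
  and rfield_word_simps [simp]:
  "rfield_word q e [] f = f" "rfield_word q e (i # w) f = rfield q (e i) (rfield_word q e w f)"
  by (simp_all add: field_word_def rfield_word_def)

lemma rfield_word_snoc: "rfield_word q e (w @ [i]) f = rfield_word q e w (rfield q (e i) f)"
  by (simp add: rfield_word_def)

lemma field_rfield_word: "field q x (rfield_word q e w f) = rfield_word q e w (field q x f)"
  by (induction w) (simp_all add: field_rfield)

lemma rfield_word_zero: "rfield_word q e w 0 = 0"
  by (induction w) (simp_all only: rfield_word_simps rfield_zero)

text \<open>The first letter, applied last, commutes with the right fields of the others and so reaches the
  vacuum, where it may be replaced by a right field.\<close>

lemma field_word_vacuum: "field_word q e w vacuum = rfield_word q e (rev w) vacuum"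
  by (induction w) (simp_all add: field_rfield_word rfield_word_snoc field_vacuum)

text \<open>A Leibniz rule: by \<open>ann_rfield\<close>, annihilation on the left acts on a word in the right fields as a
  derivation with values in multiples of \<open>\<Xi>\<^sub>q\<close>.\<close>

lemma ann_rfield_word:
  "ann q (complexify x) (rfield_word q e u f) =
    (\<Sum>k<length u. of_real (x \<bullet> e (u ! k)) *\<^sub>C
       rfield_word q e (take k u) (numop q (rfield_word q e (drop (Suc k) u) f)))
    + rfield_word q e u (ann q (complexify x) f)"
proof (induction u)
  case (Cons i u)
  show ?case
    unfolding rfield_word_simps ann_rfield Cons.IH rfield_add rfield_sum rfield_scale
    by (simp add: sum.lessThan_Suc_shift add.assoc del: sum.lessThan_Suc)
qed simp

section \<open>Field operators on the completion\<close>

lemma cre_adjoint_bound: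
  fixes h :: "complex^'n::finite"
  assumes q: "\<bar>q\<bar> < 1" and f: "f \<in> vecs (fock q)"
  shows "cre h f \<in> vecs (fock q)"
    and "Re (ip (fock q) (cre h f) (cre h f)) \<le> Re (cip h h) / (1 - \<bar>q\<bar>) * Re (ip (fock q) f f)"
proof -
  have q1: "\<bar>q\<bar> \<le> 1" using q by simp
  let ?c = "Re (cip h h) / (1 - \<bar>q\<bar>)"
  have s: "summable (\<lambda>k. ?c * Re (level_ip q k f f))"
    using f by (intro summable_mult) (simp add: fock_mem)
  have "summable (\<lambda>k. Re (level_ip q (Suc k) (cre h f) (cre h f)))"
  proof (rule summable_comparison_test[OF _ s], intro exI allI impI)
    fix k
    show "norm (Re (level_ip q (Suc k) (cre h f) (cre h f))) \<le> ?c * Re (level_ip q k f f)"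
      using level_cre_bound[OF q, of k h f] by (simp add: abs_of_nonneg[OF level_ip_self_nonneg[OF q1]])
  qed
  then show m: "cre h f \<in> vecs (fock q)"
    unfolding fock_mem by (subst summable_Suc_iff[symmetric])
  have "(\<lambda>k. Re (level_ip q (Suc k) (cre h f) (cre h f))) sums Re (ip (fock q) (cre h f) (cre h f))"
    using fock_self_sums[OF q1 m] by (subst sums_Suc_iff) (simp add: level_ip_0_cre)
  moreover have "(\<lambda>k. ?c * Re (level_ip q k f f)) sums (?c * Re (ip (fock q) f f))"
    by (intro sums_mult fock_self_sums[OF q1 f])
  ultimately show "Re (ip (fock q) (cre h f) (cre h f)) \<le> ?c * Re (ip (fock q) f f)"
    using level_cre_bound[OF q, of _ h f] by (rule sums_le[rotated])
qed

lemma ann_bound: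
  fixes h :: "complex^'n::finite"
  assumes q: "\<bar>q\<bar> < 1" and f: "f \<in> vecs (fock q)"
  shows "ann q h f \<in> vecs (fock q)"
    and "Re (ip (fock q) (ann q h f) (ann q h f)) \<le> Re (cip h h) / (1 - \<bar>q\<bar>) * Re (ip (fock q) f f)"
proof -
  have q1: "\<bar>q\<bar> \<le> 1" using q by simp
  let ?c = "Re (cip h h) / (1 - \<bar>q\<bar>)"
  have c: "0 \<le> ?c" using q cip_self(2)[of h] by simp
  have s: "summable (\<lambda>k. ?c * Re (level_ip q (Suc k) f f))"
    using f by (intro summable_mult) (simp add: fock_mem summable_Suc_iff[of "\<lambda>k. Re (level_ip q k f f)"])
  have "summable (\<lambda>k. Re (level_ip q k (ann q h f) (ann q h f)))"
  proof (rule summable_comparison_test[OF _ s], intro exI allI impI)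
    fix k
    show "norm (Re (level_ip q k (ann q h f) (ann q h f))) \<le> ?c * Re (level_ip q (Suc k) f f)"
      using level_ann_bound[OF q, of k h f] by (simp add: abs_of_nonneg[OF level_ip_self_nonneg[OF q1]])
  qed
  then show m: "ann q h f \<in> vecs (fock q)" unfolding fock_mem .
  have "(\<lambda>k. Re (level_ip q (Suc k) f f)) sums (Re (ip (fock q) f f) - Re (level_ip q 0 f f))"
    using fock_self_sums[OF q1 f] by (subst sums_Suc_iff) simp
  then have "(\<lambda>k. ?c * Re (level_ip q (Suc k) f f)) sums (?c * (Re (ip (fock q) f f) - Re (level_ip q 0 f f)))"
    by (rule sums_mult)
  then have "Re (ip (fock q) (ann q h f) (ann q h f)) \<le> ?c * (Re (ip (fock q) f f) - Re (level_ip q 0 f f))"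
    using level_ann_bound[OF q, of _ h f] fock_self_sums[OF q1 m] by (rule sums_le[rotated 2])
  also have "\<dots> \<le> ?c * Re (ip (fock q) f f)"
    using c level_ip_self_nonneg[OF q1, of 0 f] by (intro mult_left_mono) simp_all
  finally show "Re (ip (fock q) (ann q h f) (ann q h f)) \<le> ?c * Re (ip (fock q) f f)" .
qed

lemma ip_cre:
  fixes h :: "complex^'n::finite"
  assumes q: "\<bar>q\<bar> < 1" and f: "f \<in> vecs (fock q)" and g: "g \<in> vecs (fock q)"
  shows "ip (fock q) (cre h f) g = ip (fock q) f (ann q h g)"
proof -
  have q1: "\<bar>q\<bar> \<le> 1" using q by simp
  have "level_ip q 0 (cre h f) g = 0" by (rule level_ip_zero_left) simp
  then have "(\<lambda>k. level_ip q (Suc k) (cre h f) g) sums ip (fock q) (cre h f) g"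
    using ip_fock_sums[OF q1 cre_adjoint_bound(1)[OF q f] g, of h] by (subst sums_Suc_iff) simp
  then show ?thesis
    unfolding level_ip_cre using ip_fock_sums[OF q1 f ann_bound(1)[OF q g]] by (rule sums_unique2)
qed

text \<open>The vectors \<open>e i\<close> are part of the context because the algebra generated by their field operators is.\<close>

locale q_fock =
  fixes q :: real and e :: "'n::finite \<Rightarrow> real^'n"
  assumes q_bound: "\<bar>q\<bar> < 1"
begin

sublocale hilbert_space "fock q :: 'n fock_vec hilbert"
  by (rule fock_hilbert_space[OF q_bound])

abbreviation H :: "'n fock_vec hilbert" where "H \<equiv> fock q"

lemma q_le_1: "\<bar>q\<bar> \<le> 1" using q_bound by simp

lemma hnorm_bound:
  assumes "u \<in> vecs H" "v \<in> vecs H" "Re (ip H u u) \<le> c * Re (ip H v v)" "0 \<le> c"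
  shows "hnorm H u \<le> sqrt c * hnorm H v"
  using assms by (simp add: hnorm_def real_sqrt_mult[symmetric])

lemma creation_adjoint_pair:
  "adjoint_pair (creation q h) (\<lambda>f. if f \<in> vecs H then ann q h f else 0)"
proof -
  have cr: "creation q h f = (if f \<in> vecs H then cre h f else 0)" for f
    by (simp add: creation_def cre_def)
  have c: "0 \<le> Re (cip h h) / (1 - \<bar>q\<bar>)" using q_bound cip_self(2)[of h] by simp
  show ?thesis
    unfolding adjoint_pair_def
  proof (intro conjI ballI)
    show "creation q h \<in> bounded_ops H"
    proof (rule bounded_opsI)
      fix v assume "v \<in> vecs H"
      then show "hnorm H (creation q h v) \<le> sqrt (Re (cip h h) / (1 - \<bar>q\<bar>)) * hnorm H v"
        using cre_adjoint_bound[OF q_bound, of v h] hnorm_bound c by (simp add: cr)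
    qed (simp_all add: cr cre_adjoint_bound q_bound add_mem scale_mem fock_op_add fock_op_scale)
    show "(\<lambda>f. if f \<in> vecs H then ann q h f else 0) \<in> bounded_ops H"
    proof (rule bounded_opsI)
      fix v assume "v \<in> vecs H"
      then show "hnorm H (if v \<in> vecs H then ann q h v else 0)
          \<le> sqrt (Re (cip h h) / (1 - \<bar>q\<bar>)) * hnorm H v"
        using ann_bound[OF q_bound, of v h] hnorm_bound c by simp
    qed (simp_all add: ann_bound q_bound add_mem scale_mem fock_op_add fock_op_scale)
    fix u v assume "u \<in> vecs H" "v \<in> vecs H"
    then show "ip H (creation q h u) v = ip H u (if v \<in> vecs H then ann q h v else 0)"
      by (simp add: cr ip_cre[OF q_bound])
  qed
qed

lemma q_semicircular_apply: "f \<in> vecs H \<Longrightarrow> q_semicircular q x f = field q x f"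
  unfolding q_semicircular_def adjoint_op_eq[OF creation_adjoint_pair] field_def
  by (simp add: creation_def cre_def)

lemma q_semicircular_selfadjoint: "adjoint_pair (q_semicircular q x) (q_semicircular q x)"
proof -
  note p = creation_adjoint_pair[of "complexify x"]
  from adjoint_pair_add[OF p adjoint_pair_sym[OF p]] show ?thesis
    unfolding q_semicircular_def adjoint_op_eq[OF p] by (simp add: add.commute)
qed

lemma field_mem: "f \<in> vecs H \<Longrightarrow> field q x f \<in> vecs H"
  unfolding field_def by (intro add_mem cre_adjoint_bound ann_bound q_bound)

lemma ip_field:
  "f \<in> vecs H \<Longrightarrow> g \<in> vecs H \<Longrightarrow> ip H (field q x f) g = ip H f (field q x g)"
  using adjoint_pairD(3)[OF q_semicircular_selfadjoint, of f g x] by (simp add: q_semicircular_apply)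

lemma vacuum_mem: "vacuum \<in> vecs H"
  by (simp add: vacuum_def tensor_in_fock)

lemma ip_vacuum:
  assumes "f \<in> vecs H"
  shows "ip H f vacuum = f []"
proof -
  have words: "{w :: 'n list. w = []} = {[]}" by auto
  have "ip H f vacuum = level_ip q 0 f vacuum"
    by (rule ip_fock_level[OF q_bound assms]) (auto simp: supported_def vacuum_apply)
  also have "\<dots> = f []"
    by (simp add: level_ip_permute_list words vacuum_apply inversions_def)
  finally show ?thesis .
qed

abbreviation X :: "'n \<Rightarrow> 'n fock_op" where "X \<equiv> \<lambda>i. q_semicircular q (e i)"

lemma field_word_mem: "f \<in> vecs H \<Longrightarrow> field_word q e w f \<in> vecs H"
  by (induction w) (simp_all add: field_mem)

lemma eval_word_simps:
  "eval_word H X [] = id_op H" "eval_word H X (i # w) = X i \<circ> eval_word H X w"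
  by (simp_all add: eval_word_def)

lemma eval_word_apply: "f \<in> vecs H \<Longrightarrow> eval_word H X w f = field_word q e w f"
  by (induction w) (simp_all add: eval_word_simps id_op_def q_semicircular_apply field_word_mem)

lemma eval_word_snoc: "eval_word H X (w @ [i]) = eval_word H X w \<circ> X i"
proof (induction w)
  case Nil
  have b: "X i \<in> bounded_ops H" by (rule adjoint_pairD(1)[OF q_semicircular_selfadjoint])
  have "(X i \<circ> id_op H) v = (id_op H \<circ> X i) v" for v
    using bounded_opsD(1,2)[OF b, of v] bounded_ops_zero_vec[OF b] zero_mem
    by (cases "v \<in> vecs H") (simp_all add: id_op_def)
  then have "X i \<circ> id_op H = id_op H \<circ> X i" by (rule ext)
  then show ?case by (simp only: eval_word_simps append_Nil)
qed (simp add: eval_word_simps comp_assoc)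

lemma eval_word_adjoint: "adjoint_pair (eval_word H X w) (eval_word H X (rev w))"
proof (induction w)
  case Nil
  show ?case by (simp add: eval_word_simps adjoint_pair_id)
next
  case (Cons i w)
  show ?case
    unfolding eval_word_simps rev.simps eval_word_snoc
    by (intro adjoint_pair_comp q_semicircular_selfadjoint Cons.IH)
qed

text \<open>The coefficient of the empty word is the inner product with the vacuum, where left and right
  fields agree. Each right field can thus be exchanged for a left one, moved to the inside by
  commutation, and taken to the other side of the inner product.\<close>

lemma rfield_word_at_Nil:
  "g \<in> vecs H \<Longrightarrow> rfield_word q e w g [] = ip H g (field_word q e w vacuum)"
proof (induction w arbitrary: g)
  case Nil
  then show ?case by (simp add: ip_vacuum)
next
  case (Cons i w)
  have "rfield_word q e (i # w) g [] = field q (e i) (rfield_word q e w g) []"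
    by (simp add: field_at_Nil rfield_at_Nil)
  also have "\<dots> = ip H (field q (e i) g) (field_word q e w vacuum)"
    unfolding field_rfield_word by (rule Cons.IH[OF field_mem[OF Cons.prems]])
  finally show ?case
    using Cons.prems by (simp add: ip_field field_word_mem vacuum_mem)
qed

lemma level_ip_numop: "level_ip q k (numop q f) g = of_real (q ^ k) * level_ip q k f g"
proof -
  have "level_ip q k (numop q f) g = level_ip q k (of_real (q ^ k) *\<^sub>C f) g"
    by (rule level_ip_cong) (simp_all add: numop_def scaleC_fun_apply scaleC_complex)
  then show ?thesis by (simp add: level_ip_scale_left)
qed

lemma level_ip_numop_right: "level_ip q k f (numop q g) = of_real (q ^ k) * level_ip q k f g"
  using arg_cong[OF level_ip_numop[of k g f], of cnj] by (simp add: level_ip_hermitian)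

lemma level_ip_numop_self_le:
  "Re (level_ip q k (numop q f) (numop q f)) \<le> Re (level_ip q k f f)"
proof -
  have "\<bar>q\<bar> ^ k * \<bar>q\<bar> ^ k \<le> 1" using q_le_1 by (intro mult_le_one power_le_one) auto
  then have "q ^ k * q ^ k \<le> 1" by (metis abs_le_D1 abs_mult power_abs)
  then show ?thesis
    using mult_right_mono[of "q ^ k * q ^ k" 1 "Re (level_ip q k f f)"] level_ip_self_nonneg[OF q_le_1, of k f]
    by (simp add: level_ip_numop level_ip_numop_right mult.assoc flip: of_real_mult)
qed

lemma numop_mem:
  assumes "f \<in> vecs H"
  shows "numop q f \<in> vecs H"
  unfolding fock_mem
proof (rule summable_comparison_test)
  show "\<exists>N. \<forall>k\<ge>N. norm (Re (level_ip q k (numop q f) (numop q f))) \<le> Re (level_ip q k f f)"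
    using level_ip_numop_self_le[of _ f] by (simp add: abs_of_nonneg[OF level_ip_self_nonneg[OF q_le_1]])
qed (use assms in \<open>simp add: fock_mem\<close>)

lemma numop_adjoint_pair:
  "adjoint_pair (\<lambda>f. if f \<in> vecs H then numop q f else 0) (\<lambda>f. if f \<in> vecs H then numop q f else 0)"
  unfolding adjoint_pair_def
proof (intro conjI ballI)
  show "(\<lambda>f. if f \<in> vecs H then numop q f else 0) \<in> bounded_ops H"
  proof (rule bounded_opsI)
    fix v assume v: "v \<in> vecs H"
    have "Re (ip H (numop q v) (numop q v)) \<le> Re (ip H v v)"
      by (rule sums_le[OF level_ip_numop_self_le fock_self_sums fock_self_sums])
        (use v numop_mem q_le_1 in auto)
    then show "hnorm H (if v \<in> vecs H then numop q v else 0) \<le> 1 * hnorm H v"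
      using v by (simp add: hnorm_def)
  qed (simp_all add: numop_mem add_mem scale_mem fock_op_add fock_op_scale)
  then show "(\<lambda>f. if f \<in> vecs H then numop q f else 0) \<in> bounded_ops H" .
  fix u v assume uv: "u \<in> vecs H" "v \<in> vecs H"
  have "(\<lambda>k. level_ip q k (numop q u) v) sums ip H (numop q u) v"
    by (intro ip_fock_sums q_le_1 numop_mem uv)
  moreover have "(\<lambda>k. level_ip q k u (numop q v)) sums ip H u (numop q v)"
    by (intro ip_fock_sums q_le_1 numop_mem uv)
  ultimately show "ip H (if u \<in> vecs H then numop q u else 0) v = ip H u (if v \<in> vecs H then numop q v else 0)"
    unfolding level_ip_numop level_ip_numop_right using uv sums_unique2 by auto
qed

text \<open>The Stein identity for a monomial: the word is rewritten in the right fields, left annihilation is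
  passed through it, and the fields to the left of the removed letter return to the second argument.\<close>

lemma ip_field_word_vacuum:
  "ip H (field_word q e w vacuum) (field q x vacuum) =
    (\<Sum>m<length w. of_real (x \<bullet> e (w ! m)) *
       ip H (numop q (field_word q e (take m w) vacuum)) (field_word q e (rev (drop (Suc m) w)) vacuum))"
proof -
  let ?n = "length w"
  have "ip H (field_word q e w vacuum) (field q x vacuum) = ip H (field q x (field_word q e w vacuum)) vacuum"
    by (simp add: ip_field field_word_mem vacuum_mem)
  also have "\<dots> = ann q (complexify x) (rfield_word q e (rev w) vacuum) []"
    by (simp add: ip_vacuum field_mem field_word_mem vacuum_mem field_at_Nil flip: field_word_vacuum)
  also have "\<dots> = (\<Sum>k<?n. of_real (x \<bullet> e (rev w ! k)) *
      rfield_word q e (take k (rev w)) (numop q (field_word q e (rev (drop (Suc k) (rev w))) vacuum)) [])"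
    unfolding ann_rfield_word ann_vacuum rfield_word_zero
    by (simp add: sum_fun_apply scaleC_fun_apply scaleC_complex field_word_vacuum)
  also have "\<dots> = (\<Sum>k<?n. of_real (x \<bullet> e (rev w ! k)) *
      ip H (numop q (field_word q e (rev (drop (Suc k) (rev w))) vacuum)) (field_word q e (take k (rev w)) vacuum))"
    by (simp add: rfield_word_at_Nil numop_mem field_word_mem vacuum_mem)
  also have "\<dots> = (\<Sum>k<?n. of_real (x \<bullet> e (w ! (?n - Suc k))) *
       ip H (numop q (field_word q e (take (?n - Suc k) w) vacuum))
         (field_word q e (rev (drop (Suc (?n - Suc k)) w)) vacuum))"
    by (intro sum.cong refl) (simp add: rev_nth take_rev drop_rev Suc_diff_Suc)
  also have "\<dots> = (\<Sum>m<?n. of_real (x \<bullet> e (w ! m)) *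
       ip H (numop q (field_word q e (take m w) vacuum)) (field_word q e (rev (drop (Suc m) w)) vacuum))"
    by (rule sum.nat_diff_reindex)
  finally show ?thesis .
qed

end

section \<open>The operator \<open>\<Xi>\<^sub>q\<close>\<close>

lemma card_level_words: "card (level_words k :: 'n::finite list set) = CARD('n) ^ k"
  using card_lists_length_eq[of "UNIV :: 'n set" k] by simp

lemma rank_tensors_eq: "f \<in> rank_tensors N \<longleftrightarrow> supported (level_words N) f"
  by (auto simp: rank_tensors_def supported_def)

lemma below_add: "below m (f + g) = below m f + below m g"
  by (simp add: fun_eq_iff below_apply)

lemma below_scale: "below m (c *\<^sub>C f) = c *\<^sub>C below m f"
  by (simp add: fun_eq_iff below_apply scaleC_fun_apply scaleC_complex)

lemma scaleC_diff_right: "c *\<^sub>C (x - y :: 'v::complex_vec) = c *\<^sub>C x - c *\<^sub>C y"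
  using scaleC_add_right[of c "x - y" y] by (simp add: algebra_simps)

context q_fock
begin

lemma orth_proj_rank_tensors:
  assumes f: "f \<in> vecs H"
  shows "orth_proj H (rank_tensors N) f = level_part N f"
proof -
  have perp: "ip H (f - level_part N f) s = 0" if "supported (level_words N) s" for s
    unfolding ip_fock_level[OF q_bound diff_mem[OF f level_part_mem] that]
    by (rule level_ip_zero_left) (simp add: level_part_def)
  have "(THE u. u \<in> rank_tensors N \<inter> vecs H \<and> (\<forall>s\<in>rank_tensors N \<inter> vecs H. ip H (f - u) s = 0))
      = level_part N f"
  proof (rule the_equality)
    show "level_part N f \<in> rank_tensors N \<inter> vecs H \<and>
        (\<forall>s\<in>rank_tensors N \<inter> vecs H. ip H (f - level_part N f) s = 0)"
      using perp by (simp add: rank_tensors_eq supported_level_part level_part_mem)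
    fix u assume u: "u \<in> rank_tensors N \<inter> vecs H \<and> (\<forall>s\<in>rank_tensors N \<inter> vecs H. ip H (f - u) s = 0)"
    define s where "s = u - level_part N f"
    have s: "supported (level_words N) s" "s \<in> vecs H"
      using u unfolding s_def
      by (auto simp: rank_tensors_eq supported_level_part level_part_mem intro: supported_diff diff_mem)
    have "ip H s s = ip H (f - level_part N f) s - ip H (f - u) s"
      using u f s(2) level_part_mem[of N f q]
      by (simp add: s_def ip_diff_left diff_mem)
    also have "\<dots> = 0" using u s perp[OF s(1)] by (simp add: rank_tensors_eq)
    finally have "s = 0" by (rule ip_definite[OF s(2)])
    then show "u = level_part N f" by (simp add: s_def)
  qed
  then show ?thesis using f by (simp add: orth_proj_def)
qed

lemma Xi_eq: "Xi q = (\<lambda>f. if f \<in> vecs H then numop q f else 0)"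
proof (intro ext)
  fix f :: "'n fock_vec" and w
  show "Xi q f w = (if f \<in> vecs H then numop q f else 0) w"
  proof (cases "f \<in> vecs H")
    case True
    have "Xi q f w = suminf (\<lambda>N. of_real (q ^ N) * level_part N f w)"
      by (simp add: Xi_def orth_proj_rank_tensors[OF True])
    also have "\<dots> = (\<Sum>N\<in>{length w}. of_real (q ^ N) * level_part N f w)"
      by (rule suminf_finite) (auto simp: level_part_def)
    finally show ?thesis using True by (simp add: level_part_def numop_def)
  next
    case False
    then show ?thesis by (simp add: Xi_def orth_proj_def)
  qed
qed

text \<open>The difference between \<open>\<Xi>\<^sub>q\<close> and its truncation to rank below \<open>m\<close>.\<close>

definition Xi_tail :: "nat \<Rightarrow> 'n fock_op" where
  "Xi_tail m = (\<lambda>f. if f \<in> vecs H then numop q (f - below m f) else 0)"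

lemma Xi_tail_0: "Xi_tail 0 = Xi q"
proof -
  have below_0: "below 0 f = 0" for f :: "'n fock_vec" by (simp add: below_def)
  show ?thesis unfolding Xi_tail_def Xi_eq below_0 by (simp only: diff_zero)
qed

lemma level_ip_Xi_tail:
  assumes "f \<in> vecs H"
  shows "Re (level_ip q k (Xi_tail m f) (Xi_tail m f)) = (if k < m then 0 else (q\<^sup>2) ^ k * Re (level_ip q k f f))"
proof -
  have "level_ip q k (f - below m f) (f - below m f) = (if k < m then 0 else level_ip q k f f)"
    by (auto intro!: level_ip_zero_left level_ip_cong simp: below_apply)
  then show ?thesis
    using assms by (simp add: Xi_tail_def level_ip_numop level_ip_numop_right power2_eq_square
        power_mult_distrib mult.assoc flip: of_real_mult)
qed

lemma Xi_tail_mem: "f \<in> vecs H \<Longrightarrow> Xi_tail m f \<in> vecs H"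
  by (simp add: Xi_tail_def numop_mem diff_mem below_mem)

lemma Xi_tail_bounded: "Xi_tail m \<in> bounded_ops H"
proof (rule bounded_opsI)
  fix v assume v: "v \<in> vecs H"
  have "q\<^sup>2 \<le> 1" using q_le_1 by (simp add: abs_square_le_1)
  then have "(q\<^sup>2) ^ k \<le> 1" for k by (rule power_le_one[OF zero_le_power2])
  then have "Re (level_ip q k (Xi_tail m v) (Xi_tail m v)) \<le> Re (level_ip q k v v)" for k
    using mult_right_mono[of "(q\<^sup>2) ^ k" 1 "Re (level_ip q k v v)"] level_ip_self_nonneg[OF q_le_1, of k v]
    by (simp add: level_ip_Xi_tail[OF v])
  then have "Re (ip H (Xi_tail m v) (Xi_tail m v)) \<le> Re (ip H v v)"
    by (rule sums_le[OF _ fock_self_sums fock_self_sums]) (simp_all add: q_le_1 v Xi_tail_mem)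
  then show "hnorm H (Xi_tail m v) \<le> 1 * hnorm H v" by (simp add: hnorm_def)
next
  fix u v assume uv: "u \<in> vecs H" "v \<in> vecs H"
  have "u + v - below m (u + v) = (u - below m u) + (v - below m v)"
    unfolding below_add by (rule add_diff_add)
  then show "Xi_tail m (u + v) = Xi_tail m u + Xi_tail m v"
    using uv unfolding Xi_tail_def by (simp only: add_mem if_True fock_op_add)
next
  fix c v assume v: "v \<in> vecs H"
  then show "Xi_tail m (c *\<^sub>C v) = c *\<^sub>C Xi_tail m v"
    unfolding Xi_tail_def below_scale scaleC_diff_right[symmetric]
    by (simp only: scale_mem if_True fock_op_scale)
qed (rule Xi_tail_mem | simp add: Xi_tail_def)+

text \<open>The trace of the projection on the tensors of rank \<open>k\<close>, compressed to an arbitrary orthonormal set: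
  Bessel's inequality for \<open>F\<close> bounds the contribution of each basis vector by \<open>1\<close>.\<close>

lemma sum_level_orthonormal_le:
  assumes F: "orthonormal F" "finite F"
  shows "(\<Sum>u\<in>F. Re (level_ip q k u u)) \<le> real CARD('n) ^ k"
proof -
  let ?B = "level_basis q k :: 'n fock_vec set"
  note B = level_basis[OF q_bound, where k = k and 'n = 'n]
  have Bm: "b \<in> vecs H" if "b \<in> ?B" for b by (rule orthonormalD(1)[OF B(3) that])
  have Fm: "u \<in> vecs H" if "u \<in> F" for u by (rule orthonormalD(1)[OF F(1) that])
  have "(\<Sum>u\<in>F. Re (level_ip q k u u)) = (\<Sum>u\<in>F. \<Sum>b\<in>?B. (cmod (ip H u b))\<^sup>2)"
    by (intro sum.cong refl B(6) Fm)
  also have "\<dots> = (\<Sum>b\<in>?B. \<Sum>u\<in>F. (cmod (ip H u b))\<^sup>2)" by (rule sum.swap)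
  also have "\<dots> = (\<Sum>b\<in>?B. \<Sum>u\<in>F. (cmod (ip H b u))\<^sup>2)"
    using ip_cnj Bm Fm by (intro sum.cong refl) (metis complex_mod_cnj)
  also have "\<dots> \<le> (\<Sum>b\<in>?B. Re (ip H b b))"
    by (intro sum_mono Bessel F Bm)
  also have "\<dots> = real (card ?B)"
    using orthonormalD(2)[OF B(3)] by simp
  also have "\<dots> \<le> real CARD('n) ^ k"
    using B(2) by (simp add: card_level_words flip: of_nat_power)
  finally show ?thesis .
qed

text \<open>The orbit of the vacuum. An adjoint is part of the definition since right multiplication acts on
  operators of rank one through the adjoint.\<close>

definition cyclic :: "'n fock_vec \<Rightarrow> bool" where
  "cyclic f \<longleftrightarrow> (\<exists>a a'. a \<in> vN_generated H (range X) \<and> adjoint_pair a a' \<and> a vacuum = f)"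

lemma cyclicI: "a \<in> vN_generated H (range X) \<Longrightarrow> adjoint_pair a a' \<Longrightarrow> a vacuum = f \<Longrightarrow> cyclic f"
  unfolding cyclic_def by blast

lemma cyclic_vacuum: "cyclic vacuum"
  by (rule cyclicI[OF vN_generated_id adjoint_pair_id]) (simp add: id_op_def vacuum_mem)

lemma cyclic_add:
  assumes "cyclic f" "cyclic g"
  shows "cyclic (f + g)"
proof -
  obtain a a' where a: "a \<in> vN_generated H (range X)" "adjoint_pair a a'" "a vacuum = f"
    using assms(1) unfolding cyclic_def by blast
  obtain b b' where b: "b \<in> vN_generated H (range X)" "adjoint_pair b b'" "b vacuum = g"
    using assms(2) unfolding cyclic_def by blast
  show ?thesis
    by (rule cyclicI[OF vN_generated_add[OF a(1) b(1)] adjoint_pair_add[OF a(2) b(2)]])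
      (simp only: plus_fun_apply a b)
qed

lemma cyclic_scale:
  assumes "cyclic f"
  shows "cyclic (c *\<^sub>C f)"
proof -
  obtain a a' where a: "a \<in> vN_generated H (range X)" "adjoint_pair a a'" "a vacuum = f"
    using assms(1) unfolding cyclic_def by blast
  show ?thesis
    by (rule cyclicI[OF vN_generated_scale[OF a(1)] adjoint_pair_scale[OF a(2)]])
      (simp only: scaleC_fun_apply a)
qed

lemma cyclic_sum: "(\<And>i. i \<in> A \<Longrightarrow> cyclic (f i)) \<Longrightarrow> cyclic (sum f A)"
proof (induction A rule: infinite_finite_induct)
  case (insert i A)
  then show ?case unfolding sum.insert[OF insert.hyps] by (intro cyclic_add) simp_all
qed (use cyclic_scale[OF cyclic_vacuum, of 0] in \<open>simp_all add: scaleC_zero_left\<close>)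

lemma cyclic_mem: "cyclic f \<Longrightarrow> f \<in> vecs H"
  unfolding cyclic_def using adjoint_pairD(1) bounded_opsD(1) vacuum_mem by blast

lemma cyclic_field:
  assumes "cyclic f"
  shows "cyclic (field q (e j) f)"
proof -
  obtain a a' where a: "a \<in> vN_generated H (range X)" "adjoint_pair a a'" "a vacuum = f"
    using assms(1) unfolding cyclic_def by blast
  have "X j \<in> vN_generated H (range X)" by (rule vN_generated_incl) (rule rangeI)
  from cyclicI[OF vN_generated_comp[OF this a(1)] adjoint_pair_comp[OF q_semicircular_selfadjoint a(2)] refl]
  show ?thesis using cyclic_mem[OF assms] by (simp add: a(3) q_semicircular_apply)
qed

end

lemma field_add_vec: "field q (x + y) f = field q x f + field q y f"
  by (auto simp: fun_eq_iff field_def cre_def ann_def complexify_def distrib_left distrib_right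
      sum.distrib split: list.split)

lemma field_scale_vec: "field q (c *\<^sub>R x) f = of_real c *\<^sub>C field q x f"
  by (auto simp: fun_eq_iff field_def cre_def ann_def complexify_def distrib_left
      scaleC_fun_apply scaleC_complex sum_distrib_left ac_simps split: list.split)

lemma field_sum_vec:
  "finite A \<Longrightarrow> field q (\<Sum>j\<in>A. c j *\<^sub>R x j) f = (\<Sum>j\<in>A. of_real (c j) *\<^sub>C field q (x j) f)"
proof (induction A rule: finite_induct)
  case empty
  show ?case using field_scale_vec[of q 0 0 f] by (simp add: scaleC_zero_left)
next
  case (insert j A)
  then show ?case unfolding sum.insert[OF insert.hyps] field_add_vec field_scale_vec by (simp only:)
qed

definition word_vec :: "'n list \<Rightarrow> 'n fock_vec" where
  "word_vec w = (\<lambda>u. if u = w then 1 else 0)"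

lemma word_vec_Nil: "word_vec [] = vacuum"
  by (simp add: word_vec_def fun_eq_iff vacuum_apply)

lemma word_vec_Cons: "word_vec ((i :: 'n::finite) # v) = cre (complexify (axis i 1)) (word_vec v)"
  by (auto simp: word_vec_def fun_eq_iff cre_def complexify_def axis_def split: list.split)

lemma supported_expand:
  assumes "finite W" "supported W f"
  shows "f = (\<Sum>w\<in>W. f w *\<^sub>C word_vec w)"
proof
  fix u
  show "f u = (\<Sum>w\<in>W. f w *\<^sub>C word_vec w) u"
    using assms by (cases "u \<in> W")
      (auto simp: sum_fun_apply scaleC_fun_apply scaleC_complex word_vec_def supported_def if_distrib
        sum.delta cong: if_cong)
qed

locale q_semicircular_family = q_fock q e
  for q :: real and e :: "'n::finite \<Rightarrow> real^'n" +
  assumes small: "q\<^sup>2 * real CARD('n) < 1"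
    and spanning: "\<exists>c. axis i 1 = (\<Sum>j\<in>UNIV. c j *\<^sub>R e j)"
begin

text \<open>Creation of a first letter is the field operator minus annihilation; the latter produces shorter
  words, which are covered by induction.\<close>

lemma cyclic_word_vec: "cyclic (word_vec w)"
proof (induction w rule: length_induct)
  case (1 w)
  show ?case
  proof (cases w)
    case Nil
    then show ?thesis by (simp add: word_vec_Nil cyclic_vacuum)
  next
    case (Cons i v)
    let ?x = "axis i 1 :: real^'n"
    let ?g = "ann q (complexify ?x) (word_vec v)"
    let ?W = "{u :: 'n list. length u \<le> length v}"
    obtain c where c: "?x = (\<Sum>j\<in>UNIV. c j *\<^sub>R e j)" using spanning by blast
    have v: "cyclic (word_vec v)" using 1 Cons by simp
    have F: "cyclic (field q ?x (word_vec v))"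
      unfolding c field_sum_vec[OF finite_class.finite_UNIV]
      by (intro cyclic_sum cyclic_scale cyclic_field v)
    have finW: "finite ?W"
      using finite_lists_length_le[of "UNIV :: 'n set" "length v"] by simp
    have sup: "supported ?W ?g"
      unfolding supported_def
    proof (intro allI impI)
      fix u :: "'n list" assume "u \<notin> ?W"
      then have "insert_at j a u \<noteq> v" if "j \<le> length u" for j a
        using length_insert_at[OF that, of a] by auto
      then show "?g u = 0" by (simp add: ann_def word_vec_def)
    qed
    have G: "cyclic ?g"
      by (subst supported_expand[OF finW sup]) (use 1 Cons in \<open>auto intro!: cyclic_sum cyclic_scale\<close>)
    have "word_vec w = field q ?x (word_vec v) + (- 1) *\<^sub>C ?g"
      unfolding Cons word_vec_Cons field_def scaleC_minus_one by (simp only: add_diff_cancel_right' diff_conv_add_uminus[symmetric])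
    then show ?thesis using cyclic_add[OF F cyclic_scale[OF G, of "- 1"]] by (simp only:)
  qed
qed

lemma cyclic_supported:
  assumes "finite W" "supported W f"
  shows "cyclic f"
  by (subst supported_expand[OF assms]) (intro cyclic_sum cyclic_scale cyclic_word_vec)

text \<open>The squared norm is at most \<open>\<Sum> q\<^sup>2\<^sup>k n\<^sup>k\<close> over \<open>k \<ge> m\<close>, a geometric series.\<close>

lemma Xi_tail_HS:
  defines "r \<equiv> q\<^sup>2 * real CARD('n)"
  shows "hilbert_schmidt H (Xi_tail m)" "hnorm (HS H) (Xi_tail m) \<le> sqrt (r ^ m / (1 - r))"
proof -
  have r: "0 \<le> r" "r < 1" using small by (simp_all add: r_def)
  have bound: "(\<Sum>u\<in>F. (hnorm H (Xi_tail m u))\<^sup>2) \<le> (sqrt (r ^ m / (1 - r)))\<^sup>2"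
    if F: "finite F" "F \<subseteq> onb" for F
  proof -
    have Fm: "u \<in> vecs H" if "u \<in> F" for u using that F onb_mem by blast
    have on: "orthonormal F" by (rule orthonormal_subset[OF orthonormal_onb F(2)])
    have "(\<lambda>k. \<Sum>u\<in>F. Re (level_ip q k (Xi_tail m u) (Xi_tail m u))) sums
        (\<Sum>u\<in>F. Re (ip H (Xi_tail m u) (Xi_tail m u)))"
      by (intro sums_sum fock_self_sums q_le_1 Xi_tail_mem Fm)
    moreover have "(\<lambda>k. if k < m then 0 else r ^ k) sums (r ^ m / (1 - r))"
    proof -
      have "(\<lambda>k. r ^ m * r ^ k) sums (r ^ m * (1 / (1 - r)))"
        using r by (intro sums_mult geometric_sums) simp
      moreover have "(\<lambda>k. if k + m < m then 0 else r ^ (k + m)) = (\<lambda>k. r ^ m * r ^ k)"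
        by (simp add: fun_eq_iff power_add)
      ultimately have "(\<lambda>k. if k + m < m then 0 else r ^ (k + m)) sums (r ^ m / (1 - r))"
        by simp
      then show ?thesis
        using sums_iff_shift[of "\<lambda>k. if k < m then 0 else r ^ k" m "r ^ m / (1 - r)"] by simp
    qed
    moreover have "(\<Sum>u\<in>F. Re (level_ip q k (Xi_tail m u) (Xi_tail m u))) \<le> (if k < m then 0 else r ^ k)" for k
    proof -
      have "(\<Sum>u\<in>F. (q\<^sup>2) ^ k * Re (level_ip q k u u)) \<le> (q\<^sup>2) ^ k * real CARD('n) ^ k"
        unfolding sum_distrib_left[symmetric]
        by (intro mult_left_mono sum_level_orthonormal_le on F) simp
      then show ?thesis by (simp add: level_ip_Xi_tail Fm r_def power_mult_distrib)
    qed
    ultimately have "(\<Sum>u\<in>F. Re (ip H (Xi_tail m u) (Xi_tail m u))) \<le> r ^ m / (1 - r)"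
      by (rule sums_le[rotated])
    then show ?thesis using r Fm by (simp add: hnorm_sq Xi_tail_mem)
  qed
  have pos: "0 \<le> sqrt (r ^ m / (1 - r))" using r by simp
  show "hilbert_schmidt H (Xi_tail m)" by (rule hilbert_schmidtI(1)[OF Xi_tail_bounded bound pos])
  show "hnorm (HS H) (Xi_tail m) \<le> sqrt (r ^ m / (1 - r))"
    by (rule hilbert_schmidtI(2)[OF Xi_tail_bounded bound pos])
qed

lemma Xi_eq_tail_plus:
  "Xi q = Xi_tail m + (\<Sum>k<m. \<Sum>b\<in>level_basis q k. of_real (q ^ k) *\<^sub>C rank_one H b b)"
proof
  fix f :: "'n fock_vec"
  show "Xi q f = (Xi_tail m + (\<Sum>k<m. \<Sum>b\<in>level_basis q k. of_real (q ^ k) *\<^sub>C rank_one H b b)) f"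
  proof (cases "f \<in> vecs H")
    case True
    have "(\<Sum>k<m. \<Sum>b\<in>level_basis q k. of_real (q ^ k) *\<^sub>C rank_one H b b) f
        = (\<Sum>k<m. of_real (q ^ k) *\<^sub>C proj_on (level_basis q k) f)"
      unfolding sum_fun_apply scaleC_fun_apply rank_one_apply[OF True] proj_on_def scaleC_sum_right ..
    also have "\<dots> = (\<Sum>k<m. of_real (q ^ k) *\<^sub>C level_part k f)"
      by (simp only: level_basis(5)[OF q_bound True])
    also have "\<dots> = numop q (below m f)"
    proof
      fix w
      have "(\<Sum>k<m. of_real (q ^ k) *\<^sub>C level_part k f) w = (\<Sum>k<m. if length w = k then of_real (q ^ k) * f w else 0)"
        by (intro trans[OF sum_fun_apply] sum.cong refl)
          (simp add: scaleC_fun_apply scaleC_complex level_part_def)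
      then show "(\<Sum>k<m. of_real (q ^ k) *\<^sub>C level_part k f) w = numop q (below m f) w"
        by (simp add: numop_def below_apply)
    qed
    finally have "(Xi_tail m + (\<Sum>k<m. \<Sum>b\<in>level_basis q k. of_real (q ^ k) *\<^sub>C rank_one H b b)) f
        = numop q ((f - below m f) + below m f)"
      unfolding plus_fun_apply fock_op_add using True by (simp only: Xi_tail_def if_True)
    then show ?thesis using True by (simp only: Xi_eq if_True diff_add_cancel)
  next
    case False
    then show ?thesis
      by (simp add: Xi_eq Xi_tail_def sum_fun_apply scaleC_fun_apply rank_one_def scaleC_zero_right)
  qed
qed

lemma tensor_op_eq: "tensor_op q a b = rank_one H (adjoint_op H b vacuum) (a vacuum)"
  by (simp add: tensor_op_def rank_one_def)

lemma tensor_op_id: "tensor_op q (id_op H) (id_op H) = rank_one H vacuum vacuum"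
  unfolding tensor_op_eq adjoint_op_eq[OF adjoint_pair_id] by (simp add: id_op_def vacuum_mem)

sublocale HS: quasi_normed_space "HS H"
  by (rule quasi_normed_HS)

text \<open>For \<open>b = a \<Omega>\<close> the operator \<open>Y\<close> is \<open>a \<otimes> (a\<^sup>*)\<^sup>o\<^sup>p\<close>.\<close>

lemma rank_one_cyclic:
  assumes "cyclic b"
  shows "\<exists>Y\<in>vN_tensor_op H (vN_generated H (range X)). Y (rank_one H vacuum vacuum) = rank_one H b b"
proof -
  obtain a a' where a: "a \<in> vN_generated H (range X)" "adjoint_pair a a'" "a vacuum = b"
    using assms unfolding cyclic_def by blast
  have a': "a' \<in> vN_generated H (range X)"
    using vN_generated_adjoint[OF a(1)] unfolding adjoint_op_eq[OF a(2)] .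
  have "left_mult H a \<circ> right_mult H a' \<in> vN_tensor_op H (vN_generated H (range X))"
    unfolding vN_tensor_op_def using a(1) a'
    by (intro HS.vN_generated_comp HS.vN_generated_incl) auto
  moreover have "(left_mult H a \<circ> right_mult H a') (rank_one H vacuum vacuum) = rank_one H b b"
    using left_right_mult_rank_one[OF vacuum_mem vacuum_mem adjoint_pairD(1)[OF a(2)] adjoint_pair_sym[OF a(2)]]
    by (simp only: a(3))
  ultimately show ?thesis by blast
qed

lemma zero_in_L2_tensor: "0 \<in> L2_tensor q X"
proof -
  have "hnorm (HS H) 0 \<le> 0"
    using HS.hnorm_scale_le[OF HS.zero_mem, of 0] by (simp add: scaleC_zero_left)
  then have "hnorm (HS H) (0 - 0 T) < \<epsilon>" if "0 < \<epsilon>" for \<epsilon> and T :: "'n fock_op"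
    using that by (simp only: zero_fun_apply diff_zero)
  then show ?thesis
    unfolding L2_tensor_def L2_space_def vN_tensor_op_def
    by (intro CollectI conjI HS.zero_mem allI impI bexI[OF _ HS.vN_generated_zero])
qed

lemma Xi_in_L2_tensor: "Xi q \<in> L2_tensor q X"
  unfolding L2_tensor_def L2_space_def mem_Collect_eq tensor_op_id
proof (intro conjI allI impI)
  let ?N = "vN_tensor_op H (vN_generated H (range X))" and ?T = "rank_one H vacuum vacuum"
  show "Xi q \<in> vecs (HS H)"
    using Xi_tail_HS(1)[of 0] unfolding Xi_tail_0 vecs_HS .
  fix \<epsilon> :: real assume \<epsilon>: "0 < \<epsilon>"
  let ?r = "q\<^sup>2 * real CARD('n)"
  have "(\<lambda>m. sqrt (?r ^ m / (1 - ?r))) \<longlonglongrightarrow> sqrt (0 / (1 - ?r))"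
    using small by (intro tendsto_intros LIMSEQ_power_zero) auto
  then have "\<forall>\<^sub>F m in sequentially. sqrt (?r ^ m / (1 - ?r)) < \<epsilon>"
    using \<epsilon> by (intro order_tendstoD(2)) auto
  then obtain m where m: "sqrt (?r ^ m / (1 - ?r)) < \<epsilon>"
    by (auto simp: eventually_sequentially)
  have "\<exists>Y\<in>?N. Y ?T = rank_one H b b" if "b \<in> level_basis q k" for b k
    by (rule rank_one_cyclic[OF cyclic_supported[OF finite_words level_basis(4)[OF q_bound that]]])
  then obtain Y where Y: "\<And>b k. b \<in> level_basis q k \<Longrightarrow> Y b \<in> ?N \<and> Y b ?T = rank_one H b b"
    by metis
  let ?Z = "\<Sum>k<m. \<Sum>b\<in>level_basis q k. of_real (q ^ k) *\<^sub>C Y b"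
  have Z: "?Z \<in> ?N"
    unfolding vN_tensor_op_def
    by (intro HS.vN_generated_sum HS.vN_generated_scale) (use Y in \<open>simp add: vN_tensor_op_def\<close>)
  have "?Z ?T = (\<Sum>k<m. \<Sum>b\<in>level_basis q k. of_real (q ^ k) *\<^sub>C Y b ?T)"
    unfolding sum_fun_apply scaleC_fun_apply ..
  also have "\<dots> = (\<Sum>k<m. \<Sum>b\<in>level_basis q k. of_real (q ^ k) *\<^sub>C rank_one H b b)"
    using Y by (intro sum.cong refl) simp
  finally have "Xi q - ?Z ?T = Xi_tail m"
    unfolding Xi_eq_tail_plus[of m] by (simp only: add_diff_cancel_right')
  then have "hnorm (HS H) (Xi q - ?Z ?T) < \<epsilon>"
    using Xi_tail_HS(2)[of m] m by (simp only:)
  with Z show "\<exists>Y\<in>?N. hnorm (HS H) (Xi q - Y ?T) < \<epsilon>" by blast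
qed

end

section \<open>Polynomials as linear combinations of words\<close>

text \<open>The polynomials are finitely supported coefficient functions. Expressing both sides of the Stein
  identity through \<open>lin_ext\<close> reduces it to monomials.\<close>

definition lin_ext :: "('a \<Rightarrow> 'v::complex_vec) \<Rightarrow> ('a \<Rightarrow>\<^sub>0 complex) \<Rightarrow> 'v" where
  "lin_ext \<phi> p = (\<Sum>w\<in>Poly_Mapping.keys p. Poly_Mapping.lookup p w *\<^sub>C \<phi> w)"

lemma lin_ext_superset:
  assumes "finite A" "Poly_Mapping.keys p \<subseteq> A"
  shows "lin_ext \<phi> p = (\<Sum>w\<in>A. Poly_Mapping.lookup p w *\<^sub>C \<phi> w)"
  unfolding lin_ext_def
  by (rule sum.mono_neutral_left) (use assms in \<open>auto simp: in_keys_iff scaleC_zero_left\<close>)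

lemma lin_ext_add: "lin_ext \<phi> (p + r) = lin_ext \<phi> p + lin_ext \<phi> r"
proof -
  let ?A = "Poly_Mapping.keys p \<union> Poly_Mapping.keys r"
  have "lin_ext \<phi> (p + r) = (\<Sum>w\<in>?A. Poly_Mapping.lookup (p + r) w *\<^sub>C \<phi> w)"
    by (rule lin_ext_superset) (simp_all add: Poly_Mapping.keys_add)
  also have "\<dots> = (\<Sum>w\<in>?A. Poly_Mapping.lookup p w *\<^sub>C \<phi> w) + (\<Sum>w\<in>?A. Poly_Mapping.lookup r w *\<^sub>C \<phi> w)"
    by (simp add: lookup_add scaleC_add_left sum.distrib)
  also have "\<dots> = lin_ext \<phi> p + lin_ext \<phi> r"
    by (simp add: lin_ext_superset[of ?A])
  finally show ?thesis .
qed

lemma lin_ext_sum: "lin_ext \<phi> (sum f A) = (\<Sum>i\<in>A. lin_ext \<phi> (f i))"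
  by (induction A rule: infinite_finite_induct) (simp_all add: lin_ext_add, simp_all add: lin_ext_def)

lemma lin_ext_single: "lin_ext \<phi> (Poly_Mapping.single w c) = c *\<^sub>C \<phi> w"
  by (subst lin_ext_superset[of "{w}"]) auto

lemma lin_ext_free_diff:
  "lin_ext \<phi> (free_diff j p) =
    lin_ext (\<lambda>w. \<Sum>k | k < length w \<and> w ! k = j. \<phi> (take k w, drop (Suc k) w)) p"
  unfolding free_diff_def lin_ext_sum lin_ext_single
  by (simp only: lin_ext_def[of _ p] scaleC_sum_right)

lemma lin_ext_cyclic_diff:
  "lin_ext \<phi> (cyclic_diff j p) =
    lin_ext (\<lambda>w. \<Sum>k | k < length w \<and> w ! k = j. \<phi> (drop (Suc k) w @ take k w)) p"
  unfolding cyclic_diff_def lin_ext_sum lin_ext_single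
  by (simp only: lin_ext_def[of _ p] scaleC_sum_right)

text \<open>\<open>D\<^sub>i V\<^sub>C = \<Sum>\<^sub>b (C\<^sup>-\<^sup>1)\<^sub>i\<^sub>b t\<^sub>b\<close>; the symmetry of \<open>C\<^sup>-\<^sup>1\<close> lets the two occurrences of \<open>t\<^sub>i\<close> cancel the
  factor \<open>1/2\<close>.\<close>

lemma lin_ext_cyclic_diff_quadratic:
  assumes sym: "\<And>i j. matrix_inv C $ i $ j = matrix_inv C $ j $ i"
  shows "lin_ext \<phi> (cyclic_diff i (quadratic_potential C)) =
    (\<Sum>b\<in>UNIV. of_real (matrix_inv C $ i $ b) *\<^sub>C \<phi> [b])"
proof -
  let ?c = "\<lambda>a b. complex_of_real (1/2 * matrix_inv C $ a $ b)"
  have two: "(\<Sum>k | k < length [a, b] \<and> [a, b] ! k = i. \<phi> (drop (Suc k) [a, b] @ take k [a, b]))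
      = (if a = i then \<phi> [b] else 0) + (if b = i then \<phi> [a] else 0)" for a b
  proof -
    have "k < length [a, b] \<and> [a, b] ! k = i \<longleftrightarrow> k = 0 \<and> a = i \<or> k = 1 \<and> b = i" for k
      by (cases k) auto
    then have eq: "{k. k < length [a, b] \<and> [a, b] ! k = i}
        = (if a = i then {0} else {}) \<union> (if b = i then {1} else {})"
      by auto
    show ?thesis unfolding eq by (cases "a = i"; cases "b = i") simp_all
  qed
  have "lin_ext \<phi> (cyclic_diff i (quadratic_potential C))
      = (\<Sum>a\<in>UNIV. \<Sum>b\<in>UNIV. (if a = i then ?c a b *\<^sub>C \<phi> [b] else 0) + (if b = i then ?c a b *\<^sub>C \<phi> [a] else 0))"
    unfolding lin_ext_cyclic_diff quadratic_potential_def lin_ext_sum lin_ext_single two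
    by (intro sum.cong refl) (simp add: scaleC_add_right scaleC_zero_right)
  also have "\<dots> = (\<Sum>a\<in>UNIV. \<Sum>b\<in>UNIV. if a = i then ?c a b *\<^sub>C \<phi> [b] else 0)
      + (\<Sum>a\<in>UNIV. \<Sum>b\<in>UNIV. if b = i then ?c a b *\<^sub>C \<phi> [a] else 0)"
    by (simp only: sum.distrib)
  also have "(\<Sum>a\<in>UNIV. \<Sum>b\<in>UNIV. if a = i then ?c a b *\<^sub>C \<phi> [b] else 0) = (\<Sum>b\<in>UNIV. ?c i b *\<^sub>C \<phi> [b])"
    by (subst sum.swap) simp
  also have "(\<Sum>a\<in>UNIV. \<Sum>b\<in>UNIV. if b = i then ?c a b *\<^sub>C \<phi> [a] else 0) = (\<Sum>a\<in>UNIV. ?c i a *\<^sub>C \<phi> [a])"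
    by (simp add: sym[of _ i])
  also have "(\<Sum>b\<in>UNIV. ?c i b *\<^sub>C \<phi> [b]) + (\<Sum>a\<in>UNIV. ?c i a *\<^sub>C \<phi> [a])
      = (\<Sum>b\<in>UNIV. of_real (matrix_inv C $ i $ b) *\<^sub>C \<phi> [b])"
    unfolding sum.distrib[symmetric] scaleC_add_left[symmetric] by (intro sum.cong refl) simp
  finally show ?thesis .
qed

lemma invertible_if_positive_definite:
  fixes C :: "real^'n^'n"
  assumes "\<And>v. v \<noteq> 0 \<Longrightarrow> v \<bullet> (C *v v) > 0"
  shows "matrix_inv C ** C = mat 1" "C ** matrix_inv C = mat 1"
proof -
  have "v = 0" if "C *v v = 0" for v using assms[of v] that by force
  then have "\<exists>B. B ** C = mat 1"
    unfolding matrix_left_invertible_ker by blast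
  then have "\<exists>B. C ** B = mat 1 \<and> B ** C = mat 1"
    using matrix_left_right_inverse by blast
  from someI_ex[OF this] show "matrix_inv C ** C = mat 1" "C ** matrix_inv C = mat 1"
    unfolding matrix_inv_def by blast+
qed

lemma matrix_inv_symmetric:
  fixes C :: "real^'n^'n"
  assumes inv: "matrix_inv C ** C = mat 1" and sym: "transpose C = C"
  shows "matrix_inv C $ i $ j = matrix_inv C $ j $ i"
proof -
  have "C ** transpose (matrix_inv C) = mat 1"
    using arg_cong[OF inv, of transpose] by (simp add: matrix_transpose_mul sym)
  then have "matrix_inv C ** C ** transpose (matrix_inv C) = matrix_inv C"
    by (simp add: matrix_mul_assoc[symmetric])
  then have "transpose (matrix_inv C) $ j $ i = matrix_inv C $ j $ i" by (simp add: inv)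
  then show ?thesis by (simp add: transpose_def)
qed

text \<open>If \<open>E\<close> has rows \<open>e i\<close>, then \<open>E E\<^sup>T = C\<close> is invertible, so \<open>E\<close> has the right inverse \<open>E\<^sup>T C\<^sup>-\<^sup>1\<close>, which is
  also a left inverse.\<close>

lemma axis_eq_combination:
  fixes e :: "'n::finite \<Rightarrow> real^'n"
  assumes inv: "C ** matrix_inv C = mat 1" and gram: "\<And>i j. e i \<bullet> e j = C $ i $ j"
  shows "\<exists>c. axis i 1 = (\<Sum>j\<in>UNIV. c j *\<^sub>R e j)"
proof -
  define E where "E = (\<chi> i. e i)"
  have "E ** transpose E = C"
    by (simp add: vec_eq_iff E_def matrix_matrix_mult_def transpose_def gram[symmetric] inner_vec_def)
  then have "E ** (transpose E ** matrix_inv C) = mat 1"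
    using inv by (simp add: matrix_mul_assoc)
  then have left: "(transpose E ** matrix_inv C) ** E = mat 1"
    by (simp add: matrix_left_right_inverse)
  have "axis i 1 $ k = (\<Sum>j\<in>UNIV. (transpose E ** matrix_inv C) $ i $ j *\<^sub>R e j) $ k" for k
  proof -
    have "(\<Sum>j\<in>UNIV. (transpose E ** matrix_inv C) $ i $ j *\<^sub>R e j) $ k
        = ((transpose E ** matrix_inv C) ** E) $ i $ k"
      unfolding matrix_matrix_mult_def[of "transpose E ** matrix_inv C" E] by (simp add: E_def)
    then show ?thesis unfolding left by (simp add: mat_def axis_def)
  qed
  then have "axis i 1 = (\<Sum>j\<in>UNIV. (transpose E ** matrix_inv C) $ i $ j *\<^sub>R e j)"
    unfolding vec_eq_iff by (rule allI)
  then show ?thesis by (rule exI[of _ "\<lambda>j. (transpose E ** matrix_inv C) $ i $ j"])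
qed

context q_fock
begin

lemma eval_ncpoly_adjoint: "\<exists>B. adjoint_pair (eval_ncpoly H X p) B"
  unfolding eval_ncpoly_def by (rule exI, rule adjoint_pair_sum, rule adjoint_pair_scale, rule eval_word_adjoint)

lemma eval_ncpoly_vacuum: "eval_ncpoly H X p vacuum = lin_ext (\<lambda>w. field_word q e w vacuum) p"
  unfolding eval_ncpoly_def lin_ext_def sum_fun_apply scaleC_fun_apply
  by (simp only: eval_word_apply[OF vacuum_mem])

lemma lin_ext_mem: "(\<And>w. \<phi> w \<in> vecs H) \<Longrightarrow> lin_ext \<phi> p \<in> vecs H"
  unfolding lin_ext_def by (intro sum_mem scale_mem)

lemma ip_lin_ext_left:
  assumes "\<And>w. \<phi> w \<in> vecs H" "g \<in> vecs H"
  shows "ip H (lin_ext \<phi> p) g = lin_ext (\<lambda>w. ip H (\<phi> w) g) p"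
  unfolding lin_ext_def using assms by (simp add: ip_sum_left scale_mem ip_scale_left scaleC_complex)

lemma tau_adjoint_eval_ncpoly:
  "tau q (adjoint_op H (eval_ncpoly H X r) \<circ> eval_ncpoly H X p) =
    lin_ext (\<lambda>w. ip H (field_word q e w vacuum) (eval_ncpoly H X r vacuum)) p"
proof -
  obtain B where B: "adjoint_pair (eval_ncpoly H X r) B" using eval_ncpoly_adjoint by blast
  have mem: "eval_ncpoly H X p vacuum \<in> vecs H" for p
    unfolding eval_ncpoly_vacuum by (intro lin_ext_mem field_word_mem vacuum_mem)
  have "tau q (B \<circ> eval_ncpoly H X p) = ip H (eval_ncpoly H X p vacuum) (eval_ncpoly H X r vacuum)"
    unfolding tau_def using adjoint_pairD(3)[OF adjoint_pair_sym[OF B] mem vacuum_mem] by simp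
  also have "\<dots> = lin_ext (\<lambda>w. ip H (field_word q e w vacuum) (eval_ncpoly H X r vacuum)) p"
    unfolding eval_ncpoly_vacuum[of p] by (intro ip_lin_ext_left field_word_mem vacuum_mem mem)
  finally show ?thesis by (simp only: adjoint_op_eq[OF B])
qed

lemma Xi_selfadjoint: "adjoint_pair (Xi q) (Xi q)"
  unfolding Xi_eq by (rule numop_adjoint_pair)

lemma ip_HS_eval_nc2poly_Xi:
  "ip (HS H) (eval_nc2poly q X B) (Xi q) = lin_ext (\<lambda>(a, b).
    ip H (numop q (field_word q e a vacuum)) (field_word q e (rev b) vacuum)) B"
proof -
  have op: "tensor_op q (eval_word H X a) (eval_word H X b)
      = rank_one H (field_word q e (rev b) vacuum) (field_word q e a vacuum)" for a b
    unfolding tensor_op_def rank_one_def adjoint_op_eq[OF eval_word_adjoint] eval_word_apply[OF vacuum_mem] ..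
  have eval: "eval_nc2poly q X B = (\<Sum>x\<in>Poly_Mapping.keys B. Poly_Mapping.lookup B x *\<^sub>C
      rank_one H (field_word q e (rev (snd x)) vacuum) (field_word q e (fst x) vacuum))"
    unfolding eval_nc2poly_def op by (simp only: case_prod_unfold prod.collapse)
  have "ip (HS H) (eval_nc2poly q X B) (Xi q) = (\<Sum>x\<in>Poly_Mapping.keys B. Poly_Mapping.lookup B x *
      ip H (Xi q (field_word q e (fst x) vacuum)) (field_word q e (rev (snd x)) vacuum))"
    unfolding eval
    by (rule ip_HS_rank_one_sum[OF finite_keys Xi_selfadjoint]) (rule field_word_mem[OF vacuum_mem])+
  then show ?thesis
    by (simp add: lin_ext_def scaleC_complex Xi_eq field_word_mem vacuum_mem case_prod_unfold)
qed

lemma ip_HS_zero_right: "ip (HS H) A 0 = 0"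
proof -
  have "ip H u 0 = 0" for u :: "'n fock_vec"
    by (simp add: fock_def level_ip_permute_list)
  then show ?thesis by (simp add: HS_def)
qed

end

section \<open>The Stein kernel\<close>

theorem lemma9:
  fixes q :: real
    and C :: "real^'n^'n"
    and e :: "'n::finite \<Rightarrow> real^'n"
  assumes "-1 < q" and "q < 1"
    and "q\<^sup>2 * real CARD('n) < 1"
    and "transpose C = C"
    and "\<And>v. v \<noteq> 0 \<Longrightarrow> v \<bullet> (C *v v) > 0"
    and "\<And>i j. e i \<bullet> e j = C $ i $ j"
  shows "free_stein_kernel q (\<lambda>i. q_semicircular q (e i)) (quadratic_potential C)
           (\<lambda>i j. if i = j then Xi q else 0)"
proof -
  note C_inv = invertible_if_positive_definite[OF assms(5)]
  note C_sym = matrix_inv_symmetric[OF C_inv(1) assms(4)]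
  interpret q_semicircular_family q e
  proof
    show "\<bar>q\<bar> < 1" using assms(1,2) by simp
  qed (fact assms(3), rule axis_eq_combination[OF C_inv(2) assms(6)])
  let ?S = "\<lambda>w m. ip H (numop q (field_word q e (take m w) vacuum))
      (field_word q e (rev (drop (Suc m) w)) vacuum)"
  have potential: "eval_ncpoly H X (cyclic_diff i (quadratic_potential C)) vacuum
      = (\<Sum>b\<in>UNIV. of_real (matrix_inv C $ i $ b) *\<^sub>C field q (e b) vacuum)" for i
    using lin_ext_cyclic_diff_quadratic[OF C_sym, of "\<lambda>w. field_word q e w vacuum" i]
    unfolding eval_ncpoly_vacuum field_word_simps .
  have word: "ip H (field_word q e w vacuum) (eval_ncpoly H X (cyclic_diff i (quadratic_potential C)) vacuum)
      = (\<Sum>m | m < length w \<and> w ! m = i. ?S w m)" for i w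
  proof -
    \<comment> \<open>\<open>C\<close> is the Gram matrix of the \<open>e b\<close>.\<close>
    have delta: "(\<Sum>b\<in>UNIV. matrix_inv C $ i $ b * (e b \<bullet> e j)) = (if j = i then 1 else 0)" for j
      using arg_cong[OF C_inv(1), of "\<lambda>M. M $ i $ j"]
      by (simp add: assms(6) matrix_matrix_mult_def mat_def eq_commute)
    have "ip H (field_word q e w vacuum) (eval_ncpoly H X (cyclic_diff i (quadratic_potential C)) vacuum)
        = (\<Sum>b\<in>UNIV. of_real (matrix_inv C $ i $ b) * ip H (field_word q e w vacuum) (field q (e b) vacuum))"
      unfolding potential
      by (simp add: ip_sum_right field_word_mem field_mem vacuum_mem scale_mem ip_scale_right)
    also have "\<dots> = (\<Sum>b\<in>UNIV. \<Sum>m<length w. of_real (matrix_inv C $ i $ b * (e b \<bullet> e (w ! m))) * ?S w m)"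
      unfolding ip_field_word_vacuum sum_distrib_left by (simp add: mult.assoc)
    also have "\<dots> = (\<Sum>m<length w. of_real (\<Sum>b\<in>UNIV. matrix_inv C $ i $ b * (e b \<bullet> e (w ! m))) * ?S w m)"
      unfolding of_real_sum sum_distrib_right by (rule sum.swap)
    also have "\<dots> = (\<Sum>m<length w. if w ! m = i then ?S w m else 0)"
      unfolding delta by (intro sum.cong refl) simp
    also have "\<dots> = (\<Sum>m | m < length w \<and> w ! m = i. ?S w m)"
      by (subst sum.inter_filter[symmetric]) (auto intro: sum.cong)
    finally show ?thesis .
  qed
  show ?thesis
    unfolding free_stein_kernel_def
  proof (intro conjI allI)
    fix i j
    show "(if i = j then Xi q else 0) \<in> L2_tensor q X"
      using Xi_in_L2_tensor zero_in_L2_tensor by (cases "i = j") (simp_all only: refl if_True if_False)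
  next
    fix P :: "'n \<Rightarrow> 'n ncpoly"
    have "tau q (adjoint_op H (eval_ncpoly H X (cyclic_diff i (quadratic_potential C))) \<circ> eval_ncpoly H X (P i))
        = (\<Sum>j\<in>UNIV. ip (HS H) (eval_nc2poly q X (jacobian P i j)) (if i = j then Xi q else 0))" for i
    proof -
      have "(\<Sum>j\<in>UNIV. ip (HS H) (eval_nc2poly q X (jacobian P i j)) (if i = j then Xi q else 0))
          = (\<Sum>j\<in>UNIV. if j = i then ip (HS H) (eval_nc2poly q X (free_diff i (P i))) (Xi q) else 0)"
        by (intro sum.cong refl) (auto simp only: jacobian_def ip_HS_zero_right split: if_splits)
      also have "\<dots> = ip (HS H) (eval_nc2poly q X (free_diff i (P i))) (Xi q)" by simp
      also have "\<dots> = lin_ext (\<lambda>w. \<Sum>m | m < length w \<and> w ! m = i. ?S w m) (P i)"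
        unfolding ip_HS_eval_nc2poly_Xi lin_ext_free_diff by (simp only: prod.case)
      finally show ?thesis
        unfolding tau_adjoint_eval_ncpoly word by (simp only:)
    qed
    then show "(\<Sum>i\<in>UNIV. tau q (adjoint_op H (eval_ncpoly H X (cyclic_diff i (quadratic_potential C))) \<circ>
          eval_ncpoly H X (P i)))
        = (\<Sum>i\<in>UNIV. \<Sum>j\<in>UNIV. ip (HS H) (eval_nc2poly q X (jacobian P i j)) (if i = j then Xi q else 0))"
      by (intro sum.cong refl)
  qed
qed

end
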